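(* Let $G$ be a group of $\mu$-good symmetries of $(Q,L_d,\mathcal{D},\mathcal{D}_d)$ for some $\mu\in\mathfrak{g}^*$, and assume that $Ad_g^*(\mu)=\mu$ for all $g\in G$. Let $q_\cdot=(q_0,\dots,q_N)$ be a discrete curve in $Q$ and $r_k:=\pi(q_k)$ the corresponding discrete curve in $Q/G$. If $J_d(q_k,q_{k+1})=\mu$ for all $k$, then the following statements are equivalent. (1) $(q_k,q_{k+1})\in\mathcal{D}_d$ for all $k$ and $dS_d(q_\cdot)(\delta q_\cdot)=0$ for all vanishing end points variations $\delta q_\cdot$ such that $\delta q_k\in\mathcal{D}_{q_k}$ for all $k$. (2) $(q_k,q_{k+1})\in\mathcal{D}_d$ for all $k$ and $D_1L_d(q_k,q_{k+1})+D_2L_d(q_{k-1},q_k)\in\mathcal{D}_{q_k}^\circ$ for all $1\le k\le N-1$. (3) $r_\cdot$ satisfies $$d\breve{S}_d(r_\cdot)(\delta r_\cdot)=-\sum_{k=1}^{N-1}\big(\breve{F}_d^-(r_k,r_{k+1})+\breve{F}_d^+(r_{k-1},r_k)\big)(\delta r_k)$$ for all vanishing end points variations such that $\delta r_k\in\breve{\mathcal{D}}_{r_k}$ for all $k$, where $\breve{S}_d(r_\cdot)=\sum_{k=0}^{N-1}\breve{L}_d(r_k,r_{k+1})$; in addition, $(r_k,r_{k+1})\in\breve{\mathcal{D}}_d$ for all $k$. (4) For all $1\le k\le N-1$, $$D_1\breve{L}_d(r_k,r_{k+1})+D_2\breve{L}_d(r_{k-1},r_k)+\breve{F}_d^+(r_{k-1},r_k)+\breve{F}_d^-(r_k,r_{k+1})\in(\breve{\mathcal{D}}_{r_k})^\circ;$$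 in addition, $(r_k,r_{k+1})\in\breve{\mathcal{D}}_d$ for all $k$.
   Context: All manifolds and maps are smooth. $G$ is a Lie group with Lie algebra $\mathfrak{g}$ and identity $e$, acting on the left, freely and properly on a manifold $Q$ by $l^Q_g(q)$, so that $\pi:Q\to Q/G$ is a principal bundle. Notation: $\xi_Q(q)=\frac{d}{dt}\big|_{t=0}l^Q_{\exp(t\xi)}(q)$; $l^{TQ}_g=dl^Q_g$ (lifted action); $l^{Q\times Q}_g(q_0,q_1)=(l^Q_g(q_0),l^Q_g(q_1))$ (diagonal action); $l^G_g(h)=ghg^{-1}$; $\mathcal{V}^G(q)=T_q(l^Q_G(\{q\}))$; $Ad_g^*\mu=\mu\circ Ad_g$; $D_j$ is differentiation with respect to the $j$-th factor; $p_j$ is the projection on the $j$-th factor; $^\circ$ denotes annihilator. Systems. A nonholonomic discrete mechanical system is $(Q,L_d,\mathcal{D},\mathcal{D}_d)$ with $L_d:Q\times Q\to\mathbb{R}$ smooth, $\mathcal{D}$ a subbundle of $TQ$ and $\mathcal{D}_d\subset Q\times Q$ a submanifold. A Lie group is a symmetry group of it if it acts on the left, freely and properly on $Q$ (so that the quotient map from $Q$ to its orbit space is a principal bundle), $L_d$ and $\mathcal{D}_d$ are invariant under the diagonal action and $\mathcal{D}$ under the lifted action. A discrete curve is a map $q_\cdot:\{0,\dots,N\}\to Q$; a variation is $\delta q_\cdot$ with $\delta q_k\in T_{q_k}Q$, with vanishing end points if $\delta q_0=0$, $\delta q_N=0$; $S_d(q_\cdot)=\sum_{k=0}^{N-1}L_d(q_k,q_{k+1})$.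 Horizontal symmetries. Let $M$ be a symmetry group of the system. A closed subgroup $G\subset M$ is a horizontal symmetry (sub)group if $\mathcal{V}^M(q)\cap\mathcal{D}_q=\mathcal{V}^G(q)$ for all $q\in Q$. One then considers only the action of $G$; so $\mathcal{S}:=\mathcal{V}^G\cap\mathcal{D}=\mathcal{V}^G$. Fixed $G$-invariant subbundles $\mathcal{H},\mathcal{W}$ of $TQ$ satisfy $\mathcal{D}=\mathcal{S}\oplus\mathcal{H}$, $TQ=\mathcal{W}\oplus\mathcal{D}$; $\mathcal{A}$ is the principal connection on $\pi$ with horizontal bundle $\mathcal{W}\oplus\mathcal{H}$ and $h^q$ its horizontal lift. The momentum map is $J_d:Q\times Q\to\mathfrak{g}^*$, $J_d(q_0,q_1)\xi=-D_1L_d(q_0,q_1)(\xi_Q(q_0))$; $J_d^{q_0}(q_1)=J_d(q_0,q_1)$. $L_d$ is regular if for all $(q_0,q_1)$ the bilinear form $D_2D_1L_d(q_0,q_1):T_{q_0}Q\times T_{q_1}Q\to\mathbb{R}$ (mixed second derivative) is nondegenerate, and $G$-regular if for all $(q_0,q_1)$ its restriction to $\mathcal{V}^G(q_0)\times\mathcal{V}^G(q_1)$ is nondegenerate. A horizontal symmetry group $G$ with $L_d$ regular and $G$-regular is a group of $\mu$-good symmetries if for each $q\in Q$ there is a unique $g\in G$ with $J_d^q(l^Q_g(q))=\mu$; set $\gamma(q):=g$. Affine discrete connection. Let $\gamma:Q\to G$ be smooth and $G$-equivariant for $l^Q$ and $l^G$, $\Gamma=\{(q,l^Q_{\gamma(q)}(q)):q\in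 Q\}$, and $Hor\subset Q\times Q$ a $G$-invariant submanifold with $\Gamma\subset Hor$; put $Hor^2(q)=p_2(Hor\cap(\{q\}\times Q))$. $Hor$ defines an affine discrete connection $\mathcal{A}_d$ of level $\gamma$ if for each $q\in Q$, $Hor^2(q)$ is a submanifold of $Q$ and $T_{q_1}Q=T_{q_1}(l^Q_G(\{q\}))\oplus T_{q_1}Hor^2(q)$ for all $q_1\in l^Q_G(\{q\})\cap Hor^2(q)$. Then there are a $G$-invariant open neighborhood $U$ of $\Gamma$ and an open neighborhood $\mathcal{O}$ of the diagonal in $(Q/G)\times(Q/G)$ such that for all $(q_0,q_1)\in\mathfrak{U}:=(\pi\times\pi)^{-1}(\mathcal{O})$ there is a unique $g\in G$ with $(q_0,l^Q_{g^{-1}}(q_1))\in Hor\cap U$; fix such $U,\mathcal{O}$ and set $\mathcal{A}_d(q_0,q_1):=g$ (smooth on $\mathfrak{U}$). For $(\pi(q_0),r_1)\in\mathcal{O}$, $\overline{h_d^{q_0}}(r_1)$ is the unique $q_1$ with $\pi(q_1)=r_1$ and $\mathcal{A}_d(q_0,q_1)=e$. When $G$ is $\mu$-good and $Ad_g^*\mu=\mu$ for all $g$, the set $\mathcal{J}_\mu=J_d^{-1}(\mu)$ defines an affine discrete connection of level $\gamma$; $\mathcal{A}_d$ is this one ($Hor=\mathcal{J}_\mu$). Convention: the notation treats $\mathcal{A}_d$ as defined everywhere; all pairs at which $\mathcal{A}_d$ is evaluated are assumed to be in $\mathfrak{U}$, pairs in $Hor=\mathcal{J}_\mu$ (in particular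 $(q_k,q_{k+1})$) are taken in $U\cap\mathfrak{U}$, so that belonging to $\mathcal{J}_\mu$ means $\mathcal{A}_d=e$; other subsets of $Q\times Q$ are intersected with $\mathfrak{U}$ where needed, and $Q\times G\times(Q/G)$, $\tilde{G}\times(Q/G)$, $(Q/G)\times(Q/G)$ stand for the open subsets where $(\pi(q_0),r_1)\in\mathcal{O}$, resp. $(r_0,r_1)\in\mathcal{O}$. Reduced objects. $\tilde{G}=(Q\times G)/G$ for the action $g\cdot(q,w)=(l^Q_g(q),gwg^{-1})$, with quotient map $\rho$. $\Phi_{\mathcal{A}_d}:(Q\times Q)/G\to\tilde{G}\times(Q/G)$ is induced by $(q_0,q_1)\mapsto(\rho(q_0,\mathcal{A}_d(q_0,q_1)),\pi(q_1))$; $\hat{\mathcal{D}}_d=\Phi_{\mathcal{A}_d}(\mathcal{D}_d/G)$. $\tilde{F}_1(q_0,w_0,r_1)=l^Q_{w_0}(\overline{h_d^{q_0}}(r_1))$; $\check{L}_d(q_0,w_0,r_1)=L_d(q_0,\tilde{F}_1(q_0,w_0,r_1))$; $\hat{L}_d(\rho(q_0,w_0),r_1)=\check{L}_d(q_0,w_0,r_1)$. For $v_0=\rho(q_0,w_0)$, $q_1=\tilde{F}_1(q_0,w_0,r_1)$: $\hat{F}_d^+(v_0,r_1)(\delta r_1)=D_2\check{L}_d(q_0,w_0,r_1)\,D_2\mathcal{A}_d(q_0,q_1)(h^{q_1}(\delta r_1))$, $\hat{F}_d^-(v_0,r_1)(\delta r_0)=D_2\check{L}_d(q_0,w_0,r_1)\,D_1\mathcal{A}_d(q_0,q_1)(h^{q_0}(\delta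 r_0))$. $\mathcal{Y}(r_0,r_1)=(\rho(q_0,e),r_1)$ for any $q_0\in\pi^{-1}(r_0)$; $\breve{L}_d=\hat{L}_d\circ\mathcal{Y}$; $\breve{\mathcal{D}}=d\pi(\mathcal{D})$; $\breve{\mathcal{D}}_d=\mathcal{Y}^{-1}(\hat{\mathcal{D}}_d)$; $\breve{F}_d^\pm(r_0,r_1)=\hat{F}_d^\pm(\rho(q_0,e),r_1)$ for $q_0\in\pi^{-1}(r_0)$. *)

theory Defs
  imports "HOL-Analysis.Analysis" "HOL-Algebra.Group_Action"
begin

section \<open>Smooth manifolds\<close>

text \<open>
  Manifolds are modelled on a finite-dimensional normed space \<open>'e\<close>.  The class \<open>banach\<close> is used
  instead of \<open>euclidean_space\<close> because the latter excludes dimension 0 (discrete Lie groups,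
  transitive actions); finite-dimensionality is part of the predicate \<open>manifold\<close>, and a
  finite-dimensional normed space is automatically complete.
\<close>

fun Ck_on :: "nat \<Rightarrow> 'a::real_normed_vector set \<Rightarrow> ('a \<Rightarrow> 'b::real_normed_vector) \<Rightarrow> bool" where
  "Ck_on 0 S f \<longleftrightarrow> continuous_on S f"
| "Ck_on (Suc k) S f \<longleftrightarrow>
     (\<forall>x\<in>S. f differentiable (at x)) \<and> (\<forall>v. Ck_on k S (\<lambda>x. frechet_derivative f (at x) v))"

text \<open>Only used for open \<open>S\<close> in finite-dimensional spaces, where it is the usual notion of a
  \<open>C\<^sup>\<infinity>\<close> function.\<close>

definition smooth_on :: "'a::real_normed_vector set \<Rightarrow> ('a \<Rightarrow> 'b::real_normed_vector) \<Rightarrow> bool" where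
  "smooth_on S f \<longleftrightarrow> (\<forall>k. Ck_on k S f)"

text \<open>A chart is a pair of its domain and its coordinate map; the values of the coordinate map
  off the domain are irrelevant.\<close>

type_synonym ('a, 'e) chart = "'a set \<times> ('a \<Rightarrow> 'e)"

abbreviation cdom :: "('a, 'e) chart \<Rightarrow> 'a set" where "cdom \<equiv> fst"
abbreviation cmap :: "('a, 'e) chart \<Rightarrow> 'a \<Rightarrow> 'e" where "cmap \<equiv> snd"

definition cinv :: "('a, 'e) chart \<Rightarrow> 'e \<Rightarrow> 'a" where
  "cinv c = inv_into (cdom c) (cmap c)"

definition is_chart :: "'a topology \<Rightarrow> ('a, 'e::banach) chart \<Rightarrow> bool" where
  "is_chart X c \<longleftrightarrow> openin X (cdom c) \<and> open (cmap c ` cdom c) \<and>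
     homeomorphic_map (subtopology X (cdom c)) (top_of_set (cmap c ` cdom c)) (cmap c)"

definition smooth_transition :: "('a, 'e::banach) chart \<Rightarrow> ('a, 'e) chart \<Rightarrow> bool" where
  "smooth_transition c d \<longleftrightarrow>
     smooth_on (cmap c ` (cdom c \<inter> cdom d)) (\<lambda>y. cmap d (cinv c y))"

record ('a, 'e) mfd =
  mtop :: "'a topology"
  charts :: "('a, 'e) chart set"

abbreviation points :: "('a, 'e) mfd \<Rightarrow> 'a set" where
  "points M \<equiv> topspace (mtop M)"

definition manifold :: "('a, 'e::banach) mfd \<Rightarrow> bool" where
  "manifold M \<longleftrightarrow>
     (\<exists>B::'e set. finite B \<and> span B = UNIV) \<and>
     Hausdorff_space (mtop M) \<and> second_countable (mtop M) \<and>
     (\<Union>c\<in>charts M. cdom c) = points M \<and>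
     (\<forall>c\<in>charts M. is_chart (mtop M) c) \<and>
     (\<forall>c\<in>charts M. \<forall>d\<in>charts M. smooth_transition c d)"

definition real_mfd :: "(real, real) mfd" where
  "real_mfd = \<lparr>mtop = euclidean, charts = {(UNIV, id)}\<rparr>"

definition prod_mfd :: "('a, 'e) mfd \<Rightarrow> ('b, 'f) mfd \<Rightarrow> ('a \<times> 'b, 'e \<times> 'f) mfd" where
  "prod_mfd M N = \<lparr>mtop = prod_topology (mtop M) (mtop N),
     charts = {(cdom c \<times> cdom d, map_prod (cmap c) (cmap d)) | c d. c \<in> charts M \<and> d \<in> charts N}\<rparr>"

definition smooth_map_on ::
  "'a set \<Rightarrow> ('a, 'e::banach) mfd \<Rightarrow> ('b, 'f::banach) mfd \<Rightarrow> ('a \<Rightarrow> 'b) \<Rightarrow> bool" where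
  "smooth_map_on U M N f \<longleftrightarrow> openin (mtop M) U \<and>
     continuous_map (subtopology (mtop M) U) (mtop N) f \<and>
     (\<forall>c\<in>charts M. \<forall>d\<in>charts N.
        smooth_on (cmap c ` {x \<in> U \<inter> cdom c. f x \<in> cdom d}) (\<lambda>y. cmap d (f (cinv c y))))"

abbreviation smooth_map ::
  "('a, 'e::banach) mfd \<Rightarrow> ('b, 'f::banach) mfd \<Rightarrow> ('a \<Rightarrow> 'b) \<Rightarrow> bool" where
  "smooth_map M N f \<equiv> smooth_map_on (points M) M N f"

subsection \<open>Tangent spaces and differentials\<close>

text \<open>
  A tangent vector at \<open>p\<close> is an equivalence class of pairs (chart around \<open>p\<close>, vector of \<open>'e\<close>), and
  has exactly one representative in any given chart.  We fix a chart \<open>chart_at M p\<close> at every point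
  and represent tangent vectors at \<open>p\<close> by their coordinates in it, so that each \<open>T\<^sub>pM\<close> is a copy of
  \<open>'e\<close> and a tangent vector is only meaningful together with its base point.
\<close>

definition chart_at :: "('a, 'e) mfd \<Rightarrow> 'a \<Rightarrow> ('a, 'e) chart" where
  "chart_at M p = (SOME c. c \<in> charts M \<and> p \<in> cdom c)"

text \<open>The differential \<open>T\<^sub>pM \<rightarrow> T\<^bsub>f p\<^esub>N\<close> of \<open>f\<close> at \<open>p\<close>.\<close>

definition tmap ::
  "('a, 'e::banach) mfd \<Rightarrow> ('b, 'f::banach) mfd \<Rightarrow> ('a \<Rightarrow> 'b) \<Rightarrow> 'a \<Rightarrow> 'e \<Rightarrow> 'f" where
  "tmap M N f p = frechet_derivative (\<lambda>y. cmap (chart_at N (f p)) (f (cinv (chart_at M p) y)))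
                    (at (cmap (chart_at M p) p))"

abbreviation dfun :: "('a, 'e::banach) mfd \<Rightarrow> ('a \<Rightarrow> real) \<Rightarrow> 'a \<Rightarrow> 'e \<Rightarrow> real" where
  "dfun M f p \<equiv> tmap M real_mfd f p"

abbreviation velocity :: "('a, 'e::banach) mfd \<Rightarrow> (real \<Rightarrow> 'a) \<Rightarrow> 'e" where
  "velocity M c \<equiv> tmap real_mfd M c 0 1"

text \<open>Coordinates in the chart \<open>c\<close> of the tangent vector \<open>v\<close> at \<open>p\<close>.\<close>

definition coords_in :: "('a, 'e::banach) mfd \<Rightarrow> ('a, 'e) chart \<Rightarrow> 'a \<Rightarrow> 'e \<Rightarrow> 'e" where
  "coords_in M c p v = frechet_derivative (\<lambda>y. cmap c (cinv (chart_at M p) y))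
                         (at (cmap (chart_at M p) p)) v"

definition smooth_field_on :: "'a set \<Rightarrow> ('a, 'e::banach) mfd \<Rightarrow> ('a \<Rightarrow> 'e) \<Rightarrow> bool" where
  "smooth_field_on U M X \<longleftrightarrow> (\<forall>c\<in>charts M.
     smooth_on (cmap c ` (U \<inter> cdom c)) (\<lambda>y. coords_in M c (cinv c y) (X (cinv c y))))"

text \<open>Smooth subbundles of \<open>TM\<close>: constant rank, with smooth local frames.\<close>

definition subbundle :: "('a, 'e::banach) mfd \<Rightarrow> ('a \<Rightarrow> 'e set) \<Rightarrow> bool" where
  "subbundle M D \<longleftrightarrow> (\<exists>r.
     (\<forall>p\<in>points M. subspace (D p) \<and> dim (D p) = r) \<and>
     (\<forall>p\<in>points M. \<exists>U X. openin (mtop M) U \<and> p \<in> U \<and>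
        (\<forall>i<r. smooth_field_on U M (X i)) \<and>
        (\<forall>x\<in>U. D x = span ((\<lambda>i::nat. X i x) ` {..<r}))))"

text \<open>Embedded submanifolds, by slice charts (taken from the maximal atlas).\<close>

definition submanifold :: "('a, 'e::banach) mfd \<Rightarrow> 'a set \<Rightarrow> bool" where
  "submanifold M S \<longleftrightarrow> S \<subseteq> points M \<and> (\<exists>r. \<forall>p\<in>S. \<exists>c E.
     is_chart (mtop M) c \<and> p \<in> cdom c \<and>
     (\<forall>d\<in>charts M. smooth_transition c d \<and> smooth_transition d c) \<and>
     subspace E \<and> dim E = r \<and> cmap c ` (cdom c \<inter> S) = cmap c ` cdom c \<inter> E)"

text \<open>For an embedded submanifold \<open>S\<close> (e.g. an orbit of a proper action) this is \<open>T\<^sub>pS\<close>, as a subspace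
  of \<open>T\<^sub>pM\<close>: the velocities of the smooth curves of \<open>M\<close> that run inside \<open>S\<close>.\<close>

definition tangent_to :: "('a, 'e::banach) mfd \<Rightarrow> 'a set \<Rightarrow> 'a \<Rightarrow> 'e set" where
  "tangent_to M S p = {velocity M c | c. \<exists>\<epsilon>>0. smooth_map_on {-\<epsilon><..<\<epsilon>} real_mfd M c \<and>
                                          c ` {-\<epsilon><..<\<epsilon>} \<subseteq> S \<and> c 0 = p}"

definition direct_sum :: "'e::real_vector set \<Rightarrow> 'e set \<Rightarrow> 'e set \<Rightarrow> bool" where
  "direct_sum A B C \<longleftrightarrow> subspace A \<and> subspace B \<and> A \<inter> B = {0} \<and> {a + b | a b. a \<in> A \<and> b \<in> B} = C"

text \<open>\<open>\<D>\<^sup>\<circ>\<close>: the linear functional \<open>\<alpha>\<close> annihilates the subspace \<open>A\<close>.\<close>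

definition annihilates :: "('e \<Rightarrow> real) \<Rightarrow> 'e set \<Rightarrow> bool" where
  "annihilates \<alpha> A \<longleftrightarrow> (\<forall>v\<in>A. \<alpha> v = 0)"

subsection \<open>Functions of two points and of discrete curves\<close>

definition D1 :: "('a, 'e::banach) mfd \<Rightarrow> ('a \<times> 'a \<Rightarrow> real) \<Rightarrow> 'a \<Rightarrow> 'a \<Rightarrow> 'e \<Rightarrow> real" where
  "D1 M f x y = dfun M (\<lambda>x'. f (x', y)) x"

definition D2 :: "('a, 'e::banach) mfd \<Rightarrow> ('a \<times> 'a \<Rightarrow> real) \<Rightarrow> 'a \<Rightarrow> 'a \<Rightarrow> 'e \<Rightarrow> real" where
  "D2 M f x y = dfun M (\<lambda>y'. f (x, y')) y"

definition D2D1 :: "('a, 'e::banach) mfd \<Rightarrow> ('a \<times> 'a \<Rightarrow> real) \<Rightarrow> 'a \<Rightarrow> 'a \<Rightarrow> 'e \<Rightarrow> 'e \<Rightarrow> real" where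
  "D2D1 M f x y v w = dfun M (\<lambda>y'. D1 M f x y' v) y w"

definition nondegenerate_on :: "'e::zero set \<Rightarrow> 'e set \<Rightarrow> ('e \<Rightarrow> 'e \<Rightarrow> real) \<Rightarrow> bool" where
  "nondegenerate_on A B b \<longleftrightarrow>
     (\<forall>v\<in>A. (\<forall>w\<in>B. b v w = 0) \<longrightarrow> v = 0) \<and> (\<forall>w\<in>B. (\<forall>v\<in>A. b v w = 0) \<longrightarrow> w = 0)"

text \<open>A discrete curve \<open>{0,\<dots>,N} \<rightarrow> M\<close> is a function on \<open>nat\<close> of which only the values up to \<open>N\<close> matter.\<close>

definition discrete_curve :: "('a, 'e) mfd \<Rightarrow> nat \<Rightarrow> (nat \<Rightarrow> 'a) \<Rightarrow> bool" where
  "discrete_curve M N q \<longleftrightarrow> (\<forall>k\<le>N. q k \<in> points M)"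

text \<open>Vanishing end points variations of a discrete curve with \<open>\<delta>q\<^sub>k \<in> D(q\<^sub>k)\<close>.\<close>

definition variations_in :: "('a \<Rightarrow> 'e::zero set) \<Rightarrow> nat \<Rightarrow> (nat \<Rightarrow> 'a) \<Rightarrow> (nat \<Rightarrow> 'e) set" where
  "variations_in D N q = {\<delta>. \<delta> 0 = 0 \<and> \<delta> N = 0 \<and> (\<forall>k\<le>N. \<delta> k \<in> D (q k))}"

definition discrete_action :: "nat \<Rightarrow> ('a \<times> 'a \<Rightarrow> real) \<Rightarrow> (nat \<Rightarrow> 'a) \<Rightarrow> real" where
  "discrete_action N f q = (\<Sum>k<N. f (q k, q (Suc k)))"

text \<open>The differential \<open>dS(q\<^sub>\<cdot>)(\<delta>q\<^sub>\<cdot>)\<close> of a function on the manifold \<open>M\<^sup>N\<^sup>+\<^sup>1\<close> of discrete curves, as the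
  directional derivative in the product of the charts at the points \<open>q\<^sub>k\<close>.\<close>

definition curve_diff ::
  "('a, 'e::banach) mfd \<Rightarrow> ((nat \<Rightarrow> 'a) \<Rightarrow> real) \<Rightarrow> (nat \<Rightarrow> 'a) \<Rightarrow> (nat \<Rightarrow> 'e) \<Rightarrow> real" where
  "curve_diff M S q \<delta> = deriv (\<lambda>t. S (\<lambda>k. cinv (chart_at M (q k))
                                           (cmap (chart_at M (q k)) (q k) + t *\<^sub>R \<delta> k))) 0"

section \<open>Lie groups and actions\<close>

record ('g, 'k) lie_grp = "'g monoid" +
  gmfd :: "('g, 'k) mfd"

definition lie_group :: "('g, 'k::banach) lie_grp \<Rightarrow> bool" where
  "lie_group G \<longleftrightarrow> group G \<and> manifold (gmfd G) \<and> points (gmfd G) = carrier G \<and>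
     smooth_map (prod_mfd (gmfd G) (gmfd G)) (gmfd G) (\<lambda>(g, h). g \<otimes>\<^bsub>G\<^esub> h) \<and>
     smooth_map (gmfd G) (gmfd G) (\<lambda>g. inv\<^bsub>G\<^esub> g)"

text \<open>The Lie algebra \<open>T\<^sub>eG\<close> is the model space \<open>'k\<close>.\<close>

definition Ad :: "('g, 'k::banach) lie_grp \<Rightarrow> 'g \<Rightarrow> 'k \<Rightarrow> 'k" where
  "Ad G g = tmap (gmfd G) (gmfd G) (\<lambda>h. g \<otimes>\<^bsub>G\<^esub> h \<otimes>\<^bsub>G\<^esub> inv\<^bsub>G\<^esub> g) \<one>\<^bsub>G\<^esub>"

text \<open>The exponential map is the unique map for which \<open>t \<mapsto> exp(t\<xi>)\<close> is the one-parameter subgroup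
  with initial velocity \<open>\<xi>\<close>, for each \<open>\<xi>\<close>.\<close>

definition exponential_map :: "('g, 'k::banach) lie_grp \<Rightarrow> ('k \<Rightarrow> 'g) \<Rightarrow> bool" where
  "exponential_map G ex \<longleftrightarrow> (\<forall>\<xi>.
     smooth_map real_mfd (gmfd G) (\<lambda>t. ex (t *\<^sub>R \<xi>)) \<and>
     (\<forall>s t. ex ((s + t) *\<^sub>R \<xi>) = ex (s *\<^sub>R \<xi>) \<otimes>\<^bsub>G\<^esub> ex (t *\<^sub>R \<xi>)) \<and>
     velocity (gmfd G) (\<lambda>t. ex (t *\<^sub>R \<xi>)) = \<xi>)"

text \<open>\<open>G\<close> is a closed subgroup of \<open>M\<close> with its structure of an embedded Lie subgroup.\<close>

definition closed_lie_subgroup :: "('g, 'k::banach) lie_grp \<Rightarrow> ('g, 'm::banach) lie_grp \<Rightarrow> bool" where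
  "closed_lie_subgroup G M \<longleftrightarrow> lie_group G \<and>
     subgroup (carrier G) M \<and> mult G = mult M \<and> one G = one M \<and>
     closedin (mtop (gmfd M)) (carrier G) \<and>
     mtop (gmfd G) = subtopology (mtop (gmfd M)) (carrier G) \<and>
     smooth_map (gmfd G) (gmfd M) (\<lambda>g. g) \<and>
     (\<forall>g\<in>carrier G. inj (tmap (gmfd G) (gmfd M) (\<lambda>g. g) g))"

definition smooth_action ::
  "('g, 'k::banach) lie_grp \<Rightarrow> ('q, 'e::banach) mfd \<Rightarrow> ('g \<Rightarrow> 'q \<Rightarrow> 'q) \<Rightarrow> bool" where
  "smooth_action G Q l \<longleftrightarrow> group_action G (points Q) l \<and>
     smooth_map (prod_mfd (gmfd G) Q) Q (\<lambda>(g, q). l g q)"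

definition free_action :: "('g, 'k) lie_grp \<Rightarrow> ('q, 'e) mfd \<Rightarrow> ('g \<Rightarrow> 'q \<Rightarrow> 'q) \<Rightarrow> bool" where
  "free_action G Q l \<longleftrightarrow> (\<forall>g\<in>carrier G. \<forall>q\<in>points Q. l g q = q \<longrightarrow> g = \<one>\<^bsub>G\<^esub>)"

definition proper_action :: "('g, 'k) lie_grp \<Rightarrow> ('q, 'e) mfd \<Rightarrow> ('g \<Rightarrow> 'q \<Rightarrow> 'q) \<Rightarrow> bool" where
  "proper_action G Q l \<longleftrightarrow>
     proper_map (prod_topology (mtop (gmfd G)) (mtop Q)) (prod_topology (mtop Q) (mtop Q))
       (\<lambda>(g, q). (q, l g q))"

definition diag_action :: "('g \<Rightarrow> 'q \<Rightarrow> 'q) \<Rightarrow> 'g \<Rightarrow> 'q \<times> 'q \<Rightarrow> 'q \<times> 'q" where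
  "diag_action l g = (\<lambda>(q0, q1). (l g q0, l g q1))"

definition invariant_set :: "('g, 'k) lie_grp \<Rightarrow> ('g \<Rightarrow> 'x \<Rightarrow> 'x) \<Rightarrow> 'x set \<Rightarrow> bool" where
  "invariant_set G a S \<longleftrightarrow> (\<forall>g\<in>carrier G. a g ` S \<subseteq> S)"

definition invariant_bundle ::
  "('g, 'k) lie_grp \<Rightarrow> ('q, 'e::banach) mfd \<Rightarrow> ('g \<Rightarrow> 'q \<Rightarrow> 'q) \<Rightarrow> ('q \<Rightarrow> 'e set) \<Rightarrow> bool" where
  "invariant_bundle G Q l D \<longleftrightarrow>
     (\<forall>g\<in>carrier G. \<forall>q\<in>points Q. tmap Q Q (l g) q ` D q \<subseteq> D (l g q))"

definition vertical ::
  "('g, 'k) lie_grp \<Rightarrow> ('q, 'e::banach) mfd \<Rightarrow> ('g \<Rightarrow> 'q \<Rightarrow> 'q) \<Rightarrow> 'q \<Rightarrow> 'e set" where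
  "vertical G Q l q = tangent_to Q (orbit G l q) q"

text \<open>\<open>B\<close> is the manifold \<open>Q/G\<close>: its points are the orbits, and it carries the (unique) smooth
  structure for which the projection \<open>orbit G l\<close> is a smooth submersion.\<close>

definition quotient_manifold ::
  "('g, 'k::banach) lie_grp \<Rightarrow> ('q, 'e::banach) mfd \<Rightarrow> ('g \<Rightarrow> 'q \<Rightarrow> 'q) \<Rightarrow> ('q set, 'b::banach) mfd \<Rightarrow> bool"
  where
  "quotient_manifold G Q l B \<longleftrightarrow> manifold B \<and> points B = orbits G (points Q) l \<and>
     smooth_map Q B (orbit G l) \<and> (\<forall>q\<in>points Q. surj (tmap Q B (orbit G l) q))"

section \<open>Nonholonomic discrete mechanical systems and their symmetries\<close>

record ('q, 'e) nh_system =
  cfg :: "('q, 'e) mfd"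
  Ld :: "'q \<times> 'q \<Rightarrow> real"
  Dv :: "'q \<Rightarrow> 'e set"
  Dd :: "('q \<times> 'q) set"

definition nonholonomic_system :: "('q, 'e::banach, 'z) nh_system_scheme \<Rightarrow> bool" where
  "nonholonomic_system S \<longleftrightarrow> manifold (cfg S) \<and>
     smooth_map (prod_mfd (cfg S) (cfg S)) real_mfd (Ld S) \<and>
     subbundle (cfg S) (Dv S) \<and> submanifold (prod_mfd (cfg S) (cfg S)) (Dd S)"

definition symmetry_group ::
  "('q, 'e::banach, 'z) nh_system_scheme \<Rightarrow> ('g, 'k::banach) lie_grp \<Rightarrow> ('g \<Rightarrow> 'q \<Rightarrow> 'q) \<Rightarrow> bool" where
  "symmetry_group S G l \<longleftrightarrow> lie_group G \<and>
     smooth_action G (cfg S) l \<and> free_action G (cfg S) l \<and> proper_action G (cfg S) l \<and>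
     (\<forall>g\<in>carrier G. \<forall>q0\<in>points (cfg S). \<forall>q1\<in>points (cfg S).
        Ld S (diag_action l g (q0, q1)) = Ld S (q0, q1)) \<and>
     invariant_set G (diag_action l) (Dd S) \<and>
     invariant_bundle G (cfg S) l (Dv S)"

definition horizontal_symmetry_group ::
  "('q, 'e::banach, 'z) nh_system_scheme \<Rightarrow> ('g, 'm::banach) lie_grp \<Rightarrow> ('g, 'k::banach) lie_grp \<Rightarrow>
   ('g \<Rightarrow> 'q \<Rightarrow> 'q) \<Rightarrow> bool" where
  "horizontal_symmetry_group S M G l \<longleftrightarrow> symmetry_group S M l \<and> closed_lie_subgroup G M \<and>
     (\<forall>q\<in>points (cfg S). vertical M (cfg S) l q \<inter> Dv S q = vertical G (cfg S) l q)"

definition regular_lagrangian :: "('q, 'e::banach, 'z) nh_system_scheme \<Rightarrow> bool" where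
  "regular_lagrangian S \<longleftrightarrow> (\<forall>q0\<in>points (cfg S). \<forall>q1\<in>points (cfg S).
     nondegenerate_on UNIV UNIV (D2D1 (cfg S) (Ld S) q0 q1))"

definition G_regular_lagrangian ::
  "('q, 'e::banach, 'z) nh_system_scheme \<Rightarrow> ('g, 'k) lie_grp \<Rightarrow> ('g \<Rightarrow> 'q \<Rightarrow> 'q) \<Rightarrow> bool" where
  "G_regular_lagrangian S G l \<longleftrightarrow> (\<forall>q0\<in>points (cfg S). \<forall>q1\<in>points (cfg S).
     nondegenerate_on (vertical G (cfg S) l q0) (vertical G (cfg S) l q1) (D2D1 (cfg S) (Ld S) q0 q1))"

section \<open>Reduction\<close>

text \<open>
  The data of the reduction of a system \<open>(cfg, Ld, Dv, Dd)\<close>: the symmetry group \<open>G = grp\<close>, its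
  exponential map and its action on \<open>Q = cfg\<close>, the quotient manifold \<open>Q/G = qmf\<close>, the complementary
  bundles \<open>\<H> = Hb\<close> and \<open>\<W> = Wb\<close>, the momentum \<open>\<mu> = mom\<close>, and the neighbourhoods \<open>U = nbU\<close> of \<open>\<Gamma>\<close> and
  \<open>\<O> = nbO\<close> of the diagonal used to define the affine discrete connection.
\<close>

record ('q, 'e, 'g, 'k, 'b) reduction = "('q, 'e) nh_system" +
  grp :: "('g, 'k) lie_grp"
  expo :: "'k \<Rightarrow> 'g"
  act :: "'g \<Rightarrow> 'q \<Rightarrow> 'q"
  qmf :: "('q set, 'b) mfd"
  Hb :: "'q \<Rightarrow> 'e set"
  Wb :: "'q \<Rightarrow> 'e set"
  mom :: "'k \<Rightarrow> real"
  nbU :: "('q \<times> 'q) set"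
  nbO :: "('q set \<times> 'q set) set"

definition proj :: "('q, 'e, 'g, 'k, 'b) reduction \<Rightarrow> 'q \<Rightarrow> 'q set" where
  "proj R q = orbit (grp R) (act R) q"

text \<open>The infinitesimal generator \<open>\<xi>\<^sub>Q(q)\<close>.\<close>

definition generator :: "('q, 'e::banach, 'g, 'k::banach, 'b) reduction \<Rightarrow> 'k \<Rightarrow> 'q \<Rightarrow> 'e" where
  "generator R \<xi> q = velocity (cfg R) (\<lambda>t. act R (expo R (t *\<^sub>R \<xi>)) q)"

definition Jd :: "('q, 'e::banach, 'g, 'k::banach, 'b) reduction \<Rightarrow> 'q \<Rightarrow> 'q \<Rightarrow> 'k \<Rightarrow> real" where
  "Jd R q0 q1 = (\<lambda>\<xi>. - D1 (cfg R) (Ld R) q0 q1 (generator R \<xi> q0))"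

text \<open>\<open>grp R\<close> is a group of \<open>\<mu>\<close>-good symmetries, as a horizontal symmetry subgroup of \<open>M\<close>.\<close>

definition mu_good ::
  "('g, 'm::banach) lie_grp \<Rightarrow> ('q, 'e::banach, 'g, 'k::banach, 'b::banach) reduction \<Rightarrow> bool" where
  "mu_good M R \<longleftrightarrow> horizontal_symmetry_group R M (grp R) (act R) \<and>
     regular_lagrangian R \<and> G_regular_lagrangian R (grp R) (act R) \<and>
     (\<forall>q\<in>points (cfg R). \<exists>!g. g \<in> carrier (grp R) \<and> Jd R q (act R g q) = mom R)"

definition gam :: "('q, 'e::banach, 'g, 'k::banach, 'b) reduction \<Rightarrow> 'q \<Rightarrow> 'g" where
  "gam R q = (THE g. g \<in> carrier (grp R) \<and> Jd R q (act R g q) = mom R)"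

text \<open>The bundles \<open>\<H>\<close> and \<open>\<W>\<close>, with \<open>\<S> = \<V>\<^sup>G \<inter> \<D>\<close>.\<close>

definition adapted_splitting :: "('q, 'e::banach, 'g, 'k::banach, 'b::banach) reduction \<Rightarrow> bool" where
  "adapted_splitting R \<longleftrightarrow>
     subbundle (cfg R) (Hb R) \<and> invariant_bundle (grp R) (cfg R) (act R) (Hb R) \<and>
     subbundle (cfg R) (Wb R) \<and> invariant_bundle (grp R) (cfg R) (act R) (Wb R) \<and>
     (\<forall>q\<in>points (cfg R).
        direct_sum (vertical (grp R) (cfg R) (act R) q \<inter> Dv R q) (Hb R q) (Dv R q) \<and>
        direct_sum (Wb R q) (Dv R q) UNIV)"

text \<open>Horizontal lift of the principal connection with horizontal bundle \<open>\<W> \<oplus> \<H>\<close>.\<close>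

definition hlift :: "('q, 'e::banach, 'g, 'k, 'b::banach) reduction \<Rightarrow> 'q \<Rightarrow> 'b \<Rightarrow> 'e" where
  "hlift R q \<delta>r = (THE v. v \<in> {w + h | w h. w \<in> Wb R q \<and> h \<in> Hb R q} \<and>
                          tmap (cfg R) (qmf R) (proj R) q v = \<delta>r)"

subsection \<open>The affine discrete connection defined by \<open>\<J>\<^sub>\<mu>\<close>\<close>

definition Jmu :: "('q, 'e::banach, 'g, 'k::banach, 'b) reduction \<Rightarrow> ('q \<times> 'q) set" where
  "Jmu R = {(q0, q1). q0 \<in> points (cfg R) \<and> q1 \<in> points (cfg R) \<and> Jd R q0 q1 = mom R}"

text \<open>\<open>\<UU> = (\<pi> \<times> \<pi>)\<^sup>-\<^sup>1(\<O>)\<close>\<close>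

definition UO :: "('q, 'e, 'g, 'k, 'b) reduction \<Rightarrow> ('q \<times> 'q) set" where
  "UO R = {(q0, q1). q0 \<in> points (cfg R) \<and> q1 \<in> points (cfg R) \<and> (proj R q0, proj R q1) \<in> nbO R}"

definition Acon :: "('q, 'e::banach, 'g, 'k::banach, 'b) reduction \<Rightarrow> 'q \<Rightarrow> 'q \<Rightarrow> 'g" where
  "Acon R q0 q1 = (THE g. g \<in> carrier (grp R) \<and>
                          (q0, act R (inv\<^bsub>grp R\<^esub> g) q1) \<in> Jmu R \<inter> nbU R)"

text \<open>The choice of \<open>U\<close> and \<open>\<O>\<close> that makes \<open>\<A>\<^sub>d\<close> a well-defined smooth map on \<open>\<UU>\<close>.\<close>

definition connection_domains :: "('q, 'e::banach, 'g, 'k::banach, 'b::banach) reduction \<Rightarrow> bool" where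
  "connection_domains R \<longleftrightarrow>
     openin (prod_topology (mtop (cfg R)) (mtop (cfg R))) (nbU R) \<and>
     invariant_set (grp R) (diag_action (act R)) (nbU R) \<and>
     (\<forall>q\<in>points (cfg R). (q, act R (gam R q) q) \<in> nbU R) \<and>
     openin (prod_topology (mtop (qmf R)) (mtop (qmf R))) (nbO R) \<and>
     (\<forall>r\<in>points (qmf R). (r, r) \<in> nbO R) \<and>
     (\<forall>(q0, q1)\<in>UO R. \<exists>!g. g \<in> carrier (grp R) \<and>
        (q0, act R (inv\<^bsub>grp R\<^esub> g) q1) \<in> Jmu R \<inter> nbU R) \<and>
     smooth_map_on (UO R) (prod_mfd (cfg R) (cfg R)) (gmfd (grp R)) (\<lambda>(q0, q1). Acon R q0 q1)"

text \<open>\<open>\<overline>h\<^sub>d\<^bsup>q0\<^esup>(r\<^sub>1)\<close>\<close>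

definition hd_bar :: "('q, 'e::banach, 'g, 'k::banach, 'b) reduction \<Rightarrow> 'q \<Rightarrow> 'q set \<Rightarrow> 'q" where
  "hd_bar R q0 r1 = (THE q1. q1 \<in> points (cfg R) \<and> proj R q1 = r1 \<and> Acon R q0 q1 = \<one>\<^bsub>grp R\<^esub>)"

subsection \<open>Reduced objects\<close>

text \<open>
  The elements of \<open>\<tilde>G = (Q \<times> G)/G\<close> and \<open>(Q \<times> Q)/G\<close> are orbits, i.e. sets of representatives.
  A map \<open>f\<close> that is constant on an orbit \<open>X\<close> induces the value \<open>the_elem (f ` X)\<close>.
\<close>

definition rho :: "('q, 'e, 'g, 'k, 'b) reduction \<Rightarrow> 'q \<Rightarrow> 'g \<Rightarrow> ('q \<times> 'g) set" where
  "rho R q w = orbit (grp R)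
     (\<lambda>g (q, w). (act R g q, g \<otimes>\<^bsub>grp R\<^esub> w \<otimes>\<^bsub>grp R\<^esub> inv\<^bsub>grp R\<^esub> g)) (q, w)"

definition Phi ::
  "('q, 'e::banach, 'g, 'k::banach, 'b) reduction \<Rightarrow> ('q \<times> 'q) set \<Rightarrow> ('q \<times> 'g) set \<times> 'q set" where
  "Phi R X = the_elem ((\<lambda>(q0, q1). (rho R q0 (Acon R q0 q1), proj R q1)) ` X)"

definition Dd_hat :: "('q, 'e::banach, 'g, 'k::banach, 'b) reduction \<Rightarrow> (('q \<times> 'g) set \<times> 'q set) set" where
  "Dd_hat R = Phi R ` orbits (grp R) (Dd R \<inter> UO R) (diag_action (act R))"

definition F1 :: "('q, 'e::banach, 'g, 'k::banach, 'b) reduction \<Rightarrow> 'q \<Rightarrow> 'g \<Rightarrow> 'q set \<Rightarrow> 'q" where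
  "F1 R q0 w0 r1 = act R w0 (hd_bar R q0 r1)"

definition L_check :: "('q, 'e::banach, 'g, 'k::banach, 'b) reduction \<Rightarrow> 'q \<Rightarrow> 'g \<Rightarrow> 'q set \<Rightarrow> real" where
  "L_check R q0 w0 r1 = Ld R (q0, F1 R q0 w0 r1)"

definition D2_L_check ::
  "('q, 'e::banach, 'g, 'k::banach, 'b) reduction \<Rightarrow> 'q \<Rightarrow> 'g \<Rightarrow> 'q set \<Rightarrow> 'k \<Rightarrow> real" where
  "D2_L_check R q0 w0 r1 = dfun (gmfd (grp R)) (\<lambda>w. L_check R q0 w r1) w0"

definition L_hat ::
  "('q, 'e::banach, 'g, 'k::banach, 'b) reduction \<Rightarrow> ('q \<times> 'g) set \<times> 'q set \<Rightarrow> real" where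
  "L_hat R = (\<lambda>(v0, r1). the_elem ((\<lambda>(q0, w0). L_check R q0 w0 r1) ` v0))"

definition F_hat_plus ::
  "('q, 'e::banach, 'g, 'k::banach, 'b::banach) reduction \<Rightarrow> ('q \<times> 'g) set \<times> 'q set \<Rightarrow> 'b \<Rightarrow> real" where
  "F_hat_plus R = (\<lambda>(v0, r1) \<delta>r1. the_elem ((\<lambda>(q0, w0).
     let q1 = F1 R q0 w0 r1
     in D2_L_check R q0 w0 r1
          (tmap (cfg R) (gmfd (grp R)) (\<lambda>x. Acon R q0 x) q1 (hlift R q1 \<delta>r1))) ` v0))"

definition F_hat_minus ::
  "('q, 'e::banach, 'g, 'k::banach, 'b::banach) reduction \<Rightarrow> ('q \<times> 'g) set \<times> 'q set \<Rightarrow> 'b \<Rightarrow> real" where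
  "F_hat_minus R = (\<lambda>(v0, r1) \<delta>r0. the_elem ((\<lambda>(q0, w0).
     let q1 = F1 R q0 w0 r1
     in D2_L_check R q0 w0 r1
          (tmap (cfg R) (gmfd (grp R)) (\<lambda>x. Acon R x q1) q0 (hlift R q0 \<delta>r0))) ` v0))"

text \<open>A point \<open>r\<^sub>0\<close> of \<open>Q/G\<close> is itself the fibre \<open>\<pi>\<^sup>-\<^sup>1(r\<^sub>0)\<close>.\<close>

definition Ymap ::
  "('q, 'e, 'g, 'k, 'b) reduction \<Rightarrow> 'q set \<times> 'q set \<Rightarrow> ('q \<times> 'g) set \<times> 'q set" where
  "Ymap R = (\<lambda>(r0, r1). (the_elem ((\<lambda>q0. rho R q0 \<one>\<^bsub>grp R\<^esub>) ` r0), r1))"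

definition L_breve :: "('q, 'e::banach, 'g, 'k::banach, 'b) reduction \<Rightarrow> 'q set \<times> 'q set \<Rightarrow> real" where
  "L_breve R = L_hat R \<circ> Ymap R"

definition Dv_breve :: "('q, 'e::banach, 'g, 'k, 'b::banach) reduction \<Rightarrow> 'q set \<Rightarrow> 'b set" where
  "Dv_breve R r = (\<Union>q\<in>r. tmap (cfg R) (qmf R) (proj R) q ` Dv R q)"

definition Dd_breve :: "('q, 'e::banach, 'g, 'k::banach, 'b) reduction \<Rightarrow> ('q set \<times> 'q set) set" where
  "Dd_breve R = {p \<in> nbO R. Ymap R p \<in> Dd_hat R}"

definition F_breve_plus ::
  "('q, 'e::banach, 'g, 'k::banach, 'b::banach) reduction \<Rightarrow> 'q set \<Rightarrow> 'q set \<Rightarrow> 'b \<Rightarrow> real" where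
  "F_breve_plus R r0 r1 = F_hat_plus R (Ymap R (r0, r1))"

definition F_breve_minus ::
  "('q, 'e::banach, 'g, 'k::banach, 'b::banach) reduction \<Rightarrow> 'q set \<Rightarrow> 'q set \<Rightarrow> 'b \<Rightarrow> real" where
  "F_breve_minus R r0 r1 = F_hat_minus R (Ymap R (r0, r1))"

end

theory Submission
  imports Defs
begin

text \<open>
  Statements (1) and (2), and likewise (3) and (4), say the same thing by one argument
  (\<open>variational_iff_pointwise\<close>): the differential of a discrete action along a variation with
  vanishing ends is a sum over the inner vertices of \<open>D\<^sub>1 + D\<^sub>2\<close>, and variations supported at a single
  vertex separate the summands.  The content is the equivalence of (2) and (4), where the momentum
  constraint enters.

  Write \<open>S(x, y) = \<A>\<^sub>d(x, y)\<^sup>-\<^sup>1 y\<close> (\<open>horizontal_part\<close>), so that \<open>y = \<A>\<^sub>d(x, y) S(x, y)\<close>, where \<open>S(x, y)\<close>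
  depends on \<open>y\<close> only through its orbit and the reduced Lagrangian pulls back to \<open>L\<^sub>d(x, S(x, y))\<close>
  (\<open>L_breve_eq\<close>).  Along the curve \<open>J\<^sub>d = \<mu>\<close> means \<open>\<A>\<^sub>d = e\<close>, that is \<open>S(q\<^sub>k, q\<^sub>k\<^sub>+\<^sub>1) = q\<^sub>k\<^sub>+\<^sub>1\<close>.  Hence a pair
  on the curve is determined by its first point and the orbit of the second, and \<open>\<D>\<^sub>d\<close>, being
  invariant, contains it iff \<open>\<breve>\<D>\<^sub>d\<close> contains its projection (\<open>Dd_breve_iff\<close>).  For the equations,
  split \<open>\<D> = \<V> \<oplus> \<H>\<close>.

  \<^item> On \<open>\<V>\<close> the unreduced equation is automatic (\<open>vertical_equation\<close>): since \<open>L\<^sub>d\<close> is invariant,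
    \<open>D\<^sub>2L\<^sub>d(q\<^sub>k\<^sub>-\<^sub>1, q\<^sub>k)(\<xi>\<^sub>Q) = J\<^sub>d(q\<^sub>k\<^sub>-\<^sub>1, q\<^sub>k)\<xi>\<close> while \<open>D\<^sub>1L\<^sub>d(q\<^sub>k, q\<^sub>k\<^sub>+\<^sub>1)(\<xi>\<^sub>Q) = -J\<^sub>d(q\<^sub>k, q\<^sub>k\<^sub>+\<^sub>1)\<xi>\<close>, and both momenta are \<open>\<mu>\<close>.

  \<^item> On horizontal vectors, differentiating \<open>y = \<A>\<^sub>d(x, y) S(x, y)\<close> at a pair with \<open>\<A>\<^sub>d = e\<close> compares
    the two Lagrangians: what \<open>d(L\<^sub>d(x, S))\<close> lacks of \<open>dL\<^sub>d\<close> is \<open>D\<^sub>2L\<^sub>d\<close> applied to the generator of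
    \<open>d\<A>\<^sub>d\<close>, and this is the reduced force (\<open>force_minus\<close>, \<open>force_plus\<close>).  So the covector in (4) at \<open>\<delta>r\<close> is
    the covector in (2) at the horizontal lift of \<open>\<delta>r\<close> (\<open>equation_iff\<close>).

  Two facts about the quotient underlie this.  First, \<open>Q/G\<close> is known only through the submersion
  \<open>\<pi>\<close>, so differentiability of the reduced Lagrangian has to be deduced from that of its pullback; a
  strict derivative with a right inverse gives a local section that is differentiable at one point
  (\<open>descent_has_derivative\<close>), which suffices.  Second, horizontal lifts are unique only if
  \<open>ker d\<pi> = \<V>\<close>.  The differential of \<open>x \<mapsto> S(q, x)\<close> kills \<open>ker d\<pi>\<close> because \<open>S(q, \<cdot>)\<close> factors through
  \<open>\<pi>\<close>; the product rule for \<open>x = \<A>\<^sub>d(q, x) S(q, x)\<close> then turns every vector of \<open>ker d\<pi>\<close> into an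
  infinitesimal generator (\<open>kernel_infinitesimal\<close>), and generators are velocities of the curves
  \<open>exp(t\<xi>)q\<close> in the orbit.
\<close>

section \<open>Linear maps on finite-dimensional normed spaces\<close>


text \<open>The sup-norm unit sphere of the coefficients is compact and the norm of the linear combination is
positive on it by independence, hence bounded below by some \<open>d > 0\<close>; scaling gives the bound \<open>1/d\<close>.\<close>

lemma coordinates_bounded:
  fixes B :: "'a::real_normed_vector set"
  assumes fin: "finite B" and ind: "independent B" and sp: "span B = UNIV"
  shows "\<exists>C>0. \<forall>v. \<forall>b\<in>B. \<bar>representation B v b\<bar> \<le> C * norm v"
proof -
  define comb :: "('a \<Rightarrow> real) \<Rightarrow> 'a" where "comb c = (\<Sum>b\<in>B. c b *\<^sub>R b)" for c
  define box :: "('a \<Rightarrow> real) set" where "box = (\<Pi>\<^sub>E b\<in>UNIV. if b \<in> B then {-1..1} else {0})"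
  define sphere where "sphere = box \<inter> (\<Union>b\<in>B. (\<lambda>c. \<bar>c b\<bar>) -` {1})"
  have proj: "continuous_on UNIV (\<lambda>c::'a \<Rightarrow> real. c b)" for b
    by (rule continuous_on_product_coordinates)
  have "compact box"
  proof -
    have "compactin (product_topology (\<lambda>_. euclidean) UNIV) box"
      unfolding box_def by (subst compactin_PiE) auto
    then show ?thesis by (simp add: euclidean_product_topology)
  qed
  moreover have "closed (\<Union>b\<in>B. (\<lambda>c::'a \<Rightarrow> real. \<bar>c b\<bar>) -` {1})"
  proof (rule closed_UN[OF fin], rule ballI)
    fix b
    have "continuous_on UNIV (\<lambda>c::'a \<Rightarrow> real. \<bar>c b\<bar>)"
      by (rule continuous_on_rabs[OF proj])
    then show "closed ((\<lambda>c::'a \<Rightarrow> real. \<bar>c b\<bar>) -` {1})"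
      by (rule closed_vimage[OF closed_singleton])
  qed
  ultimately have cpt: "compact sphere" unfolding sphere_def by (rule compact_Int_closed)
  have rep_comb: "representation B (comb c) b = c b" if "b \<in> B" for c b
  proof -
    have "representation B (comb c) = (\<lambda>b. if b \<in> B then c b else 0)"
    proof (rule representation_eqI[OF ind])
      show "comb c \<in> span B" by (simp add: sp)
      show "finite {b. (if b \<in> B then c b else 0) \<noteq> 0}"
        by (rule finite_subset[OF _ fin]) auto
      have "{b. (if b \<in> B then c b else 0) \<noteq> 0} \<subseteq> B" by auto
      then show "(\<Sum>b | (if b \<in> B then c b else 0) \<noteq> 0. (if b \<in> B then c b else 0) *\<^sub>R b) = comb c"
        unfolding comb_def using fin by (intro sum.mono_neutral_cong_left) (auto split: if_splits)
    qed (auto split: if_splits)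
    then show ?thesis using that by simp
  qed
  have comb_rep: "comb (representation B v) = v" for v
    unfolding comb_def
    using sum_representation_eq[OF ind _ fin order_refl, of v] sp by simp
  have cont: "continuous_on sphere (\<lambda>c. norm (comb c))"
    unfolding comb_def by (intro continuous_intros continuous_on_subset[OF proj]) auto
  obtain d where d: "d > 0" "\<And>c. c \<in> sphere \<Longrightarrow> d \<le> norm (comb c)"
  proof (cases "sphere = {}")
    case True
    then show ?thesis using that[of 1] by auto
  next
    case False
    obtain c0 where c0: "c0 \<in> sphere" "\<And>c. c \<in> sphere \<Longrightarrow> norm (comb c0) \<le> norm (comb c)"
      using continuous_attains_inf[OF cpt False cont] by auto
    obtain b where "b \<in> B" "\<bar>c0 b\<bar> = 1" using c0(1) unfolding sphere_def by auto
    moreover have "representation B (0::'a) b = 0" by (simp add: representation_zero)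
    ultimately have "comb c0 \<noteq> 0" using rep_comb[of b c0] by auto
    then show ?thesis using that[of "norm (comb c0)"] c0 by auto
  qed
  have "\<bar>representation B v b\<bar> \<le> (1/d) * norm v" if b: "b \<in> B" for v b
  proof -
    define m where "m = Max ((\<lambda>b. \<bar>representation B v b\<bar>) ` B)"
    have m_ge: "\<bar>representation B v b\<bar> \<le> m" if "b \<in> B" for b
      unfolding m_def using fin that by auto
    have "m \<in> (\<lambda>b. \<bar>representation B v b\<bar>) ` B"
      unfolding m_def using fin b by (intro Max_in) auto
    then obtain b' where b': "b' \<in> B" "m = \<bar>representation B v b'\<bar>" by auto
    have "d * m \<le> norm v"
    proof (cases "m = 0")
      case False
      then have m: "m > 0" using b' by auto
      define c where "c = (\<lambda>b. representation B v b / m)"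
      have out: "representation B v b = 0" if "b \<notin> B" for b
        using representation_ne_zero that by blast
      have "\<bar>c b\<bar> \<le> 1" if "b \<in> B" for b
        using m_ge[OF that] m by (simp add: c_def)
      moreover have "c b = 0" if "b \<notin> B" for b
        using out[OF that] by (simp add: c_def)
      ultimately have "c \<in> box"
        by (auto simp: box_def PiE_UNIV_domain abs_le_iff minus_le_iff)
      moreover have "\<bar>c b'\<bar> = 1" using m b'(2) by (simp add: c_def)
      ultimately have "c \<in> sphere" unfolding sphere_def using b'(1) by auto
      moreover have "comb c = (1/m) *\<^sub>R v"
        using comb_rep[of v] unfolding comb_def c_def
        by (metis (no_types, lifting) divide_inverse inverse_eq_divide mult.commute scaleR_scaleR scaleR_sum_right sum.cong)
      ultimately have "d \<le> norm v / m" using d(2)[of c] m by simp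
      then show ?thesis using m by (simp add: field_simps)
    qed auto
    then have "d * \<bar>representation B v b\<bar> \<le> norm v"
      using m_ge[OF b] d(1) by (meson mult_left_mono less_imp_le order_trans)
    then show ?thesis using d(1) by (simp add: field_simps)
  qed
  then show ?thesis using d(1) by (intro exI[of _ "1/d"]) auto
qed

lemma finite_basis_exists:
  assumes "\<exists>B::'a::real_vector set. finite B \<and> span B = UNIV"
  obtains B :: "'a::real_vector set" where "finite B" "independent B" "span B = UNIV"
  using assms by (metis UNIV_I finite_subset maximal_independent_subset span_mono span_span subset_UNIV top.extremum_uniqueI)

lemma linear_eq_sum_basis:
  assumes "linear (f :: 'a::real_vector \<Rightarrow> 'b::real_vector)" "finite B" "independent B" "span B = (UNIV::'a::real_vector set)"
  shows "f v = (\<Sum>b\<in>B. representation B v b *\<^sub>R f b)"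
proof -
  have "f v = f (\<Sum>b\<in>B. representation B v b *\<^sub>R b)"
    using sum_representation_eq[OF assms(3) _ assms(2) order_refl, of v] assms(4) by simp
  then show ?thesis by (simp add: linear_sum[OF assms(1)] linear_scale[OF assms(1)])
qed

lemma linear_imp_bounded_linear:
  fixes f :: "'a::real_normed_vector \<Rightarrow> 'b::real_normed_vector"
  assumes "\<exists>B::'a set. finite B \<and> span B = UNIV" and lin: "linear f"
  shows "bounded_linear f"
proof -
  obtain B :: "'a set" where B: "finite B" "independent B" "span B = UNIV"
    using finite_basis_exists assms(1) .
  obtain C where C: "C > 0" "\<And>v b. b \<in> B \<Longrightarrow> \<bar>representation B v b\<bar> \<le> C * norm v"
    using coordinates_bounded[OF B] by blast
  have "norm (f v) \<le> norm v * (\<Sum>b\<in>B. C * norm (f b))" for v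
  proof -
    have "norm (f v) \<le> (\<Sum>b\<in>B. norm (representation B v b *\<^sub>R f b))"
      unfolding linear_eq_sum_basis[OF lin B, of v] by (rule norm_sum)
    also have "\<dots> \<le> (\<Sum>b\<in>B. (C * norm v) * norm (f b))"
      by (rule sum_mono) (simp add: C mult_right_mono)
    finally show ?thesis by (simp add: sum_distrib_left ac_simps)
  qed
  then show ?thesis using lin by (intro bounded_linear_intro[where K="\<Sum>b\<in>B. C * norm (f b)"])
      (auto simp: linear_add linear_scale)
qed


section \<open>Calculus of \<open>C\<^sup>k\<close> maps\<close>

lemma has_frechet_derivative:
  "f differentiable (at x) \<Longrightarrow> (f has_derivative frechet_derivative f (at x)) (at x)"
  by (simp add: frechet_derivative_works[symmetric])

lemma frechet_derivative_cong_open: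
  assumes "open S" "x \<in> S" "\<And>y. y \<in> S \<Longrightarrow> f y = g y"
  shows "frechet_derivative f (at x) = frechet_derivative g (at x)"
proof -
  have "(f has_derivative D) (at x) \<longleftrightarrow> (g has_derivative D) (at x)" for D
    using has_derivative_transform_within_open[OF _ assms(1,2)] assms(3) by metis
  then show ?thesis unfolding frechet_derivative_def by simp
qed

lemma differentiable_cong_open:
  assumes "open S" "x \<in> S" "\<And>y. y \<in> S \<Longrightarrow> f y = g y"
  shows "f differentiable (at x) \<longleftrightarrow> g differentiable (at x)"
  using has_derivative_transform_within_open[OF _ assms(1,2)] assms(3)
  unfolding differentiable_def by metis

lemma Ck_on_cong:
  assumes "open S" "\<And>x. x \<in> S \<Longrightarrow> f x = g x"
  shows "Ck_on k S f \<longleftrightarrow> Ck_on k S g"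
  using assms(2)
proof (induction k arbitrary: f g)
  case 0
  then show ?case by (simp cong: continuous_on_cong)
next
  case (Suc k)
  have "Ck_on k S (\<lambda>x. frechet_derivative f (at x) v) \<longleftrightarrow> Ck_on k S (\<lambda>x. frechet_derivative g (at x) v)" for v
    by (rule Suc.IH) (simp add: frechet_derivative_cong_open[OF assms(1) _ Suc.prems])
  moreover have "f differentiable (at x) \<longleftrightarrow> g differentiable (at x)" if "x \<in> S" for x
    by (rule differentiable_cong_open[OF assms(1) that Suc.prems])
  ultimately show ?case by simp
qed

lemma Ck_on_subset: "Ck_on k S f \<Longrightarrow> T \<subseteq> S \<Longrightarrow> Ck_on k T f"
  by (induction k arbitrary: f) (auto intro: continuous_on_subset)

lemma Ck_on_imp_continuous_on: "Ck_on k S f \<Longrightarrow> continuous_on S f"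
proof (cases k)
  case (Suc j)
  assume "Ck_on k S f"
  then have "isCont f x" if "x \<in> S" for x
    using that differentiable_imp_continuous_within[of f x UNIV] Suc by simp
  then show ?thesis by (simp add: continuous_at_imp_continuous_on)
qed simp

lemma Ck_on_Suc_imp: "Ck_on (Suc k) S f \<Longrightarrow> Ck_on k S f"
proof (induction k arbitrary: f)
  case 0
  then show ?case using Ck_on_imp_continuous_on[of "Suc 0" S f] by simp
next
  case (Suc k)
  then show ?case by (metis Ck_on.simps(2))
qed

lemma Ck_on_local:
  assumes "\<And>x. x \<in> S \<Longrightarrow> \<exists>T. open T \<and> x \<in> T \<and> Ck_on k T f"
  shows "Ck_on k S f"
  using assms
proof (induction k arbitrary: f)
  case 0
  have "continuous (at x) f" if "x \<in> S" for x
    using 0[OF that] by (auto simp: continuous_on_eq_continuous_at)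
  then show ?case by (simp add: continuous_at_imp_continuous_on)
next
  case (Suc k)
  have "Ck_on k S (\<lambda>x. frechet_derivative f (at x) v)" for v
    by (rule Suc.IH) (metis Suc.prems Ck_on.simps(2))
  moreover have "f differentiable (at x)" if "x \<in> S" for x
    using Suc.prems[OF that] by auto
  ultimately show ?case by simp
qed

lemma Ck_on_const: "Ck_on k S (\<lambda>x. c)"
  by (induction k arbitrary: c) auto

lemma Ck_on_bounded_linear:
  assumes L: "bounded_linear L" and "open S" "Ck_on k S f"
  shows "Ck_on k S (\<lambda>x. L (f x))"
  using assms(3)
proof (induction k arbitrary: f)
  case 0
  then show ?case using L by (auto intro: bounded_linear.continuous_on)
next
  case (Suc k)
  have d: "((\<lambda>x. L (f x)) has_derivative (\<lambda>v. L (frechet_derivative f (at x) v))) (at x)"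
    if "x \<in> S" for x
    using Suc.prems that by (auto intro: bounded_linear.has_derivative[OF L has_frechet_derivative])
  have "Ck_on k S (\<lambda>x. L (frechet_derivative f (at x) v))" for v
    by (rule Suc.IH) (use Suc.prems in simp)
  then have "Ck_on k S (\<lambda>x. frechet_derivative (\<lambda>x. L (f x)) (at x) v)" for v
    by (subst Ck_on_cong[OF \<open>open S\<close>, of _ "\<lambda>x. L (frechet_derivative f (at x) v)"])
       (simp_all add: frechet_derivative_at[OF d, symmetric])
  then show ?case using d by (auto simp: differentiable_def)
qed

lemma Ck_on_add:
  assumes "open S" "Ck_on k S f" "Ck_on k S g"
  shows "Ck_on k S (\<lambda>x. f x + g x)"
  using assms(2,3)
proof (induction k arbitrary: f g)
  case 0
  then show ?case by (auto intro: continuous_intros)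
next
  case (Suc k)
  have d: "((\<lambda>x. f x + g x) has_derivative
      (\<lambda>v. frechet_derivative f (at x) v + frechet_derivative g (at x) v)) (at x)" if "x \<in> S" for x
    using Suc.prems that by (auto intro: has_derivative_add[OF has_frechet_derivative has_frechet_derivative])
  have "Ck_on k S (\<lambda>x. frechet_derivative f (at x) v + frechet_derivative g (at x) v)" for v
    by (rule Suc.IH) (use Suc.prems in simp_all)
  then have "Ck_on k S (\<lambda>x. frechet_derivative (\<lambda>x. f x + g x) (at x) v)" for v
    by (subst Ck_on_cong[OF \<open>open S\<close>, of _ "\<lambda>x. frechet_derivative f (at x) v + frechet_derivative g (at x) v"])
       (simp_all add: frechet_derivative_at[OF d, symmetric])
  then show ?case using d by (auto simp: differentiable_def)
qed

lemma Ck_on_sum: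
  assumes "open S" "finite I" "\<And>i. i \<in> I \<Longrightarrow> Ck_on k S (f i)"
  shows "Ck_on k S (\<lambda>x. \<Sum>i\<in>I. f i x)"
  using assms(2,3) by (induction rule: finite_induct) (auto intro: Ck_on_const Ck_on_add[OF assms(1)])

lemma Ck_on_scaleR:
  fixes f :: "'a::real_normed_vector \<Rightarrow> real"
  assumes "open S" "Ck_on k S f" "Ck_on k S g"
  shows "Ck_on k S (\<lambda>x. f x *\<^sub>R g x)"
  using assms(2,3)
proof (induction k arbitrary: f g)
  case 0
  then show ?case by (auto intro: continuous_intros)
next
  case (Suc k)
  let ?D = "\<lambda>x v. f x *\<^sub>R frechet_derivative g (at x) v + frechet_derivative f (at x) v *\<^sub>R g x"
  have d: "((\<lambda>x. f x *\<^sub>R g x) has_derivative ?D x) (at x)" if "x \<in> S" for x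
    using Suc.prems that by (auto intro: has_derivative_scaleR[OF has_frechet_derivative has_frechet_derivative])
  have "Ck_on k S (\<lambda>x. ?D x v)" for v
    using Ck_on_Suc_imp[OF Suc.prems(1)] Ck_on_Suc_imp[OF Suc.prems(2)] Suc.prems
    by (intro Ck_on_add[OF \<open>open S\<close>] Suc.IH) simp_all
  then have "Ck_on k S (\<lambda>x. frechet_derivative (\<lambda>x. f x *\<^sub>R g x) (at x) v)" for v
    by (subst Ck_on_cong[OF \<open>open S\<close>, of _ "\<lambda>x. ?D x v"])
       (simp_all add: frechet_derivative_at[OF d, symmetric])
  then show ?case using d by (auto simp: differentiable_def)
qed

text \<open>With respect to a basis \<open>B\<close> the chain rule reads
\<open>D(g \<circ> f)(x)v = \<Sum>\<^sub>b (Df(x)v)\<^sub>b Dg(f x)b\<close>, in which the first factor is linear in the derivative of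
\<open>f\<close> and the second is covered by the induction hypothesis.  The sum over \<open>B\<close> is needed because \<open>Ck_on\<close> speaks about the derivative in fixed
directions only.\<close>

lemma Ck_on_compose:
  fixes f :: "'a::real_normed_vector \<Rightarrow> 'b::real_normed_vector"
    and g :: "'b \<Rightarrow> 'c::real_normed_vector"
  assumes fin: "\<exists>B::'b set. finite B \<and> span B = UNIV"
    and S: "open S" and T: "f ` S \<subseteq> T"
    and f: "Ck_on k S f" and g: "Ck_on k T g"
  shows "Ck_on k S (\<lambda>x. g (f x))"
  using f g
proof (induction k arbitrary: g)
  case 0
  then show ?case using T by (auto intro: continuous_on_compose2)
next
  case (Suc k)
  obtain B :: "'b set" where B: "finite B" "independent B" "span B = UNIV"
    using finite_basis_exists fin .
  let ?f' = "\<lambda>x. frechet_derivative f (at x)"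
  let ?g' = "\<lambda>y. frechet_derivative g (at y)"
  let ?D = "\<lambda>x v. \<Sum>b\<in>B. representation B (?f' x v) b *\<^sub>R ?g' (f x) b"
  have d: "((\<lambda>x. g (f x)) has_derivative ?D x) (at x)" if x: "x \<in> S" for x
  proof -
    have "f x \<in> T" using x T by blast
    then have gd: "(g has_derivative ?g' (f x)) (at (f x))" and fd: "(f has_derivative ?f' x) (at x)"
      using Suc.prems x by (auto intro: has_frechet_derivative)
    have "((\<lambda>x. g (f x)) has_derivative (\<lambda>v. ?g' (f x) (?f' x v))) (at x)"
      using diff_chain_at[OF fd gd] by (simp add: comp_def)
    also have "(\<lambda>v. ?g' (f x) (?f' x v)) = ?D x"
      by (rule ext) (rule linear_eq_sum_basis[OF has_derivative_linear[OF gd] B])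
    finally show ?thesis .
  qed
  have rep: "bounded_linear (\<lambda>w. representation B w b)" for b
    by (rule linear_imp_bounded_linear[OF fin], rule linearI)
       (use B in \<open>auto simp: representation_add representation_scale\<close>)
  have "Ck_on k S (\<lambda>x. ?D x v)" for v
  proof (intro Ck_on_sum[OF S B(1)] Ck_on_scaleR[OF S])
    fix b
    show "Ck_on k S (\<lambda>x. representation B (?f' x v) b)"
      using Suc.prems by (intro Ck_on_bounded_linear[OF rep S]) simp
    show "Ck_on k S (\<lambda>x. ?g' (f x) b)"
      by (rule Suc.IH) (use Suc.prems Ck_on_Suc_imp[OF Suc.prems(1)] in simp_all)
  qed
  then have "Ck_on k S (\<lambda>x. frechet_derivative (\<lambda>x. g (f x)) (at x) v)" for v
    by (subst Ck_on_cong[OF S, of _ "\<lambda>x. ?D x v"])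
       (simp_all add: frechet_derivative_at[OF d, symmetric])
  then show ?case using d by (auto simp: differentiable_def)
qed

section \<open>Strict derivatives and descent along submersions\<close>

text \<open>The two points \<open>x\<close>, \<open>y\<close> vary independently, so \<open>f - A\<close> is Lipschitz near \<open>a\<close> with arbitrarily small
constant.  This is what the contraction argument for local sections needs, and it is available for
\<open>C\<^sup>1\<close> maps.\<close>

definition has_strict_derivative ::
  "('a::real_normed_vector \<Rightarrow> 'b::real_normed_vector) \<Rightarrow> ('a \<Rightarrow> 'b) \<Rightarrow> 'a \<Rightarrow> bool" where
  "has_strict_derivative f A a \<longleftrightarrow> bounded_linear A \<and>
     (\<forall>\<epsilon>>0. \<exists>\<delta>>0. \<forall>x\<in>ball a \<delta>. \<forall>y\<in>ball a \<delta>. norm (f x - f y - A (x - y)) \<le> \<epsilon> * norm (x - y))"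

text \<open>Continuity of \<open>x \<mapsto> Df(x)b\<close> for the finitely many basis vectors \<open>b\<close> makes \<open>Df\<close> continuous in operator
norm; the mean value inequality does the rest.\<close>

lemma C1_imp_strict_derivative:
  fixes f :: "'a::real_normed_vector \<Rightarrow> 'b::real_normed_vector"
  assumes fin: "\<exists>B::'a set. finite B \<and> span B = UNIV"
    and C1: "Ck_on (Suc 0) S f" and S: "open S" "a \<in> S"
  shows "has_strict_derivative f (frechet_derivative f (at a)) a"
  unfolding has_strict_derivative_def
proof (intro conjI allI impI)
  let ?D = "\<lambda>x. frechet_derivative f (at x)"
  have der: "(f has_derivative ?D x) (at x)" if "x \<in> S" for x
    using C1 that by (auto intro: has_frechet_derivative)
  show "bounded_linear (?D a)" using der[OF S(2)] by (rule has_derivative_bounded_linear)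
  fix \<epsilon> :: real assume "\<epsilon> > 0"
  obtain B :: "'a set" where B: "finite B" "independent B" "span B = UNIV"
    using finite_basis_exists fin .
  obtain C where C: "C > 0" "\<And>v b. b \<in> B \<Longrightarrow> \<bar>representation B v b\<bar> \<le> C * norm v"
    using coordinates_bounded[OF B] by blast
  define \<eta> where "\<eta> = \<epsilon> / (C * (1 + real (card B)))"
  have \<eta>: "\<eta> > 0" using \<open>\<epsilon> > 0\<close> C(1) by (simp add: \<eta>_def)
  have "\<forall>\<^sub>F x in nhds a. norm (?D x b - ?D a b) < \<eta>" for b
  proof -
    have "continuous_on S (\<lambda>x. ?D x b)" using C1 by simp
    then have "isCont (\<lambda>x. ?D x b) a" using S by (simp add: continuous_on_eq_continuous_at)
    then have "((\<lambda>x. ?D x b) \<longlongrightarrow> ?D a b) (nhds a)"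
      using tendsto_at_iff_tendsto_nhds[of "\<lambda>x. ?D x b" a] by (simp add: isCont_def)
    then show ?thesis using \<eta> by (simp add: tendsto_iff dist_norm)
  qed
  then have "\<forall>\<^sub>F x in nhds a. x \<in> S \<and> (\<forall>b\<in>B. norm (?D x b - ?D a b) < \<eta>)"
    using B(1) S by (auto intro: eventually_conj eventually_nhds_in_open simp: eventually_ball_finite)
  then obtain \<delta> where \<delta>: "\<delta> > 0" "\<And>x. x \<in> ball a \<delta> \<Longrightarrow> x \<in> S"
      "\<And>x b. x \<in> ball a \<delta> \<Longrightarrow> b \<in> B \<Longrightarrow> norm (?D x b - ?D a b) < \<eta>"
    unfolding eventually_nhds_metric by (auto simp: dist_commute)
  have on: "onorm (\<lambda>v. ?D x v - ?D a v) \<le> \<epsilon>" if x: "x \<in> ball a \<delta>" for x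
  proof (rule onorm_bound)
    show "0 \<le> \<epsilon>" using \<open>\<epsilon> > 0\<close> by simp
    fix v
    have lin: "linear (\<lambda>v. ?D x v - ?D a v)"
      using der[OF \<delta>(2)[OF x]] der[OF S(2)]
      by (intro linear_compose_sub has_derivative_linear) auto
    have "norm (?D x v - ?D a v) = norm (\<Sum>b\<in>B. representation B v b *\<^sub>R (?D x b - ?D a b))"
      by (subst linear_eq_sum_basis[OF lin B]) simp
    also have "\<dots> \<le> (\<Sum>b\<in>B. norm (representation B v b *\<^sub>R (?D x b - ?D a b)))"
      by (rule norm_sum)
    also have "\<dots> \<le> (\<Sum>b\<in>B. (C * norm v) * \<eta>)"
    proof (rule sum_mono)
      fix b assume b: "b \<in> B"
      have "\<bar>representation B v b\<bar> * norm (?D x b - ?D a b) \<le> (C * norm v) * \<eta>"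
        using C(2)[OF b, of v] \<delta>(3)[OF x b] C(1) by (intro mult_mono) auto
      then show "norm (representation B v b *\<^sub>R (?D x b - ?D a b)) \<le> (C * norm v) * \<eta>" by simp
    qed
    also have "\<dots> = real (card B) * norm v * (C * \<eta>)" by simp
    also have "C * \<eta> = \<epsilon> / (1 + real (card B))" using C(1) by (simp add: \<eta>_def)
    also have "real (card B) * norm v * (\<epsilon> / (1 + real (card B)))
        = (real (card B) / (1 + real (card B))) * (\<epsilon> * norm v)" by simp
    also have "\<dots> \<le> 1 * (\<epsilon> * norm v)"
      using \<open>\<epsilon> > 0\<close> by (intro mult_right_mono) auto
    finally show "norm (?D x v - ?D a v) \<le> \<epsilon> * norm v" by simp
  qed
  have "norm (f x - f y - ?D a (x - y)) \<le> \<epsilon> * norm (x - y)"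
    if x: "x \<in> ball a \<delta>" and y: "y \<in> ball a \<delta>" for x y
  proof -
    have "norm (f x - f y - ?D a (x - y)) \<le> norm (x - y) * \<epsilon>"
    proof (rule differentiable_bound_linearization[where S="ball a \<delta>" and f'="?D"])
      show "y + t *\<^sub>R (x - y) \<in> ball a \<delta>" if "t \<in> {0..1}" for t
      proof -
        have "(1 - t) *\<^sub>R y + t *\<^sub>R x \<in> ball a \<delta>"
          using convex_ball[of a \<delta>] x y that unfolding convex_alt by auto
        then show ?thesis by (simp add: algebra_simps)
      qed
      show "(f has_derivative ?D z) (at z within ball a \<delta>)" if "z \<in> ball a \<delta>" for z
        using der[OF \<delta>(2)[OF that]] by (rule has_derivative_at_withinI)
    qed (use on \<delta>(1) in \<open>auto simp: fun_diff_def\<close>)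
    then show ?thesis by (simp add: mult.commute)
  qed
  then show "\<exists>\<delta>>0. \<forall>x\<in>ball a \<delta>. \<forall>y\<in>ball a \<delta>. norm (f x - f y - ?D a (x - y)) \<le> \<epsilon> * norm (x - y)"
    using \<delta>(1) by blast
qed

lemma has_strict_derivative_map_prod:
  assumes f: "has_strict_derivative f A a" and g: "has_strict_derivative g B b"
  shows "has_strict_derivative (map_prod f g) (map_prod A B) (a, b)"
  unfolding has_strict_derivative_def
proof (intro conjI allI impI)
  have A: "bounded_linear A" and B: "bounded_linear B"
    using f g by (auto simp: has_strict_derivative_def)
  show "bounded_linear (map_prod A B)"
    using bounded_linear_Pair[OF bounded_linear_compose[OF A bounded_linear_fst]
        bounded_linear_compose[OF B bounded_linear_snd]]
    by (simp add: map_prod_def split_def)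
  fix \<epsilon> :: real assume \<epsilon>: "\<epsilon> > 0"
  then have "\<epsilon>/2 > 0" by simp
  from f[unfolded has_strict_derivative_def] this obtain \<delta>1 where 1: "\<delta>1 > 0"
    "\<And>x y. x \<in> ball a \<delta>1 \<Longrightarrow> y \<in> ball a \<delta>1 \<Longrightarrow> norm (f x - f y - A (x - y)) \<le> \<epsilon>/2 * norm (x - y)" by meson
  from g[unfolded has_strict_derivative_def] \<open>\<epsilon>/2 > 0\<close> obtain \<delta>2 where 2: "\<delta>2 > 0"
    "\<And>x y. x \<in> ball b \<delta>2 \<Longrightarrow> y \<in> ball b \<delta>2 \<Longrightarrow> norm (g x - g y - B (x - y)) \<le> \<epsilon>/2 * norm (x - y)" by meson
  have "norm (map_prod f g x - map_prod f g y - map_prod A B (x - y)) \<le> \<epsilon> * norm (x - y)"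
    if x: "x \<in> ball (a, b) (min \<delta>1 \<delta>2)" and y: "y \<in> ball (a, b) (min \<delta>1 \<delta>2)" for x y
  proof -
    have in1: "fst z \<in> ball a \<delta>1" and in2: "snd z \<in> ball b \<delta>2" if "z \<in> ball (a, b) (min \<delta>1 \<delta>2)" for z
      using that dist_fst_le[of "(a, b)" z] dist_snd_le[of "(a, b)" z] by auto
    have "norm (map_prod f g x - map_prod f g y - map_prod A B (x - y))
        = norm (f (fst x) - f (fst y) - A (fst x - fst y), g (snd x) - g (snd y) - B (snd x - snd y))"
      by (simp add: map_prod_def split_def)
    also have "\<dots> \<le> norm (f (fst x) - f (fst y) - A (fst x - fst y)) + norm (g (snd x) - g (snd y) - B (snd x - snd y))"
      by (rule norm_Pair_le)
    also have "\<dots> \<le> \<epsilon>/2 * norm (fst (x - y)) + \<epsilon>/2 * norm (snd (x - y))"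
      using 1(2)[OF in1 in1, OF x y] 2(2)[OF in2 in2, OF x y] by simp
    also have "\<dots> \<le> \<epsilon>/2 * norm (x - y) + \<epsilon>/2 * norm (x - y)"
      using \<epsilon> norm_fst_le[of "fst (x - y)" "snd (x - y)", unfolded prod.collapse]
        norm_snd_le[of "snd (x - y)" "fst (x - y)", unfolded prod.collapse]
      by (intro add_mono mult_left_mono) simp_all
    finally show ?thesis by simp
  qed
  then show "\<exists>\<delta>>0. \<forall>x\<in>ball (a, b) \<delta>. \<forall>y\<in>ball (a, b) \<delta>.
      norm (map_prod f g x - map_prod f g y - map_prod A B (x - y)) \<le> \<epsilon> * norm (x - y)"
    using 1(1) 2(1) by (intro exI[of _ "min \<delta>1 \<delta>2"]) auto
qed

text \<open>A solution of \<open>P (a + B x) = y\<close> is a fixed point of \<open>x \<mapsto> x - P (a + B x) + y\<close>, which is a contraction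
of a small ball because \<open>x \<mapsto> P (a + B x)\<close> has the strict derivative \<open>A \<circ> B = id\<close>.\<close>

lemma strict_derivative_local_section:
  fixes P :: "'a::real_normed_vector \<Rightarrow> 'b::banach"
  assumes P: "has_strict_derivative P A a"
    and B: "bounded_linear B" and AB: "\<And>v. A (B v) = v"
  shows "\<exists>\<rho>>0. \<forall>y\<in>cball (P a) \<rho>. \<exists>x. P (a + B x) = y \<and> norm x \<le> 2 * norm (y - P a)"
proof -
  obtain K where K: "K > 0" "\<And>x. norm (B x) \<le> norm x * K"
    using bounded_linear.pos_bounded[OF B] by blast
  define \<psi> where "\<psi> x = P (a + B x)" for x
  have "1 / (2 * K) > 0" using K(1) by simp
  from P[unfolded has_strict_derivative_def] this obtain \<delta> where \<delta>: "\<delta> > 0"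
    "\<And>x y. x \<in> ball a \<delta> \<Longrightarrow> y \<in> ball a \<delta> \<Longrightarrow> norm (P x - P y - A (x - y)) \<le> 1 / (2 * K) * norm (x - y)"
    by meson
  define \<rho> where "\<rho> = \<delta> / (2 * K)"
  have \<rho>: "\<rho> > 0" using \<delta>(1) K(1) by (simp add: \<rho>_def)
  have contr: "norm ((x - \<psi> x) - (x' - \<psi> x')) \<le> 1/2 * norm (x - x')"
    if "x \<in> cball 0 \<rho>" "x' \<in> cball 0 \<rho>" for x x'
  proof -
    have inb: "a + B z \<in> ball a \<delta>" if "z \<in> cball 0 \<rho>" for z
    proof -
      have "norm (B z) \<le> norm z * K" by (rule K(2))
      also have "\<dots> \<le> \<rho> * K" using that K(1) by (intro mult_right_mono) auto
      also have "\<dots> < \<delta>" using \<delta>(1) K(1) by (simp add: \<rho>_def)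
      finally show ?thesis by (simp add: dist_norm)
    qed
    have Bd: "B x - B x' = B (x - x')" using linear_diff[OF bounded_linear.linear[OF B]] by simp
    have "norm ((x - \<psi> x) - (x' - \<psi> x')) = norm (P (a + B x) - P (a + B x') - A ((a + B x) - (a + B x')))"
      by (simp add: \<psi>_def Bd AB norm_minus_commute algebra_simps)
    also have "\<dots> \<le> 1 / (2 * K) * norm (B (x - x'))"
      using \<delta>(2)[OF inb inb, OF that] by (simp add: Bd)
    also have "\<dots> \<le> 1 / (2 * K) * (norm (x - x') * K)"
      using K by (intro mult_left_mono) auto
    finally show ?thesis using K(1) by simp
  qed
  have B0: "B 0 = 0" using linear_0[OF bounded_linear.linear[OF B]] by simp
  have "\<exists>x. \<psi> x = y \<and> norm x \<le> 2 * norm (y - P a)" if y: "y \<in> cball (P a) (\<rho>/2)" for y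
  proof -
    let ?T = "\<lambda>x. x - \<psi> x + y"
    have n: "norm (?T x) \<le> 1/2 * norm x + norm (y - P a)" if "x \<in> cball 0 \<rho>" for x
    proof -
      have "?T x = ((x - \<psi> x) - (0 - \<psi> 0)) + (y - P a)" by (simp add: \<psi>_def B0)
      also have "norm \<dots> \<le> norm ((x - \<psi> x) - (0 - \<psi> 0)) + norm (y - P a)" by (rule norm_triangle_ineq)
      also have "\<dots> \<le> 1/2 * norm x + norm (y - P a)"
        using contr[OF that, of 0] \<rho> by simp
      finally show ?thesis .
    qed
    have "\<exists>!x\<in>cball 0 \<rho>. ?T x = x"
    proof (rule Banach_fix[where c="1/2"])
      show "complete (cball (0::'b) \<rho>)" by (simp add: complete_eq_closed)
      show "cball (0::'b) \<rho> \<noteq> {}" using \<rho> by simp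
      show "?T ` cball 0 \<rho> \<subseteq> cball 0 \<rho>"
      proof safe
        fix x :: 'b assume x: "x \<in> cball 0 \<rho>"
        have "norm x \<le> \<rho>" using x by simp
        moreover have "norm (y - P a) \<le> \<rho>/2" using y by (simp add: dist_norm norm_minus_commute)
        ultimately have "norm (?T x) \<le> \<rho>" using n[OF x] by linarith
        then show "?T x \<in> cball 0 \<rho>" by simp
      qed
      show "dist (?T x) (?T x') \<le> 1/2 * dist x x'" if "x \<in> cball 0 \<rho>" "x' \<in> cball 0 \<rho>" for x x'
        using contr[OF that] by (simp add: dist_norm algebra_simps)
    qed auto
    then obtain x where x: "x \<in> cball 0 \<rho>" "?T x = x" by blast
    then have "norm x \<le> 2 * norm (y - P a)" "\<psi> x = y"
      using n[OF x(1)] by (simp_all add: algebra_simps)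
    then show ?thesis by blast
  qed
  then show ?thesis using \<rho> unfolding \<psi>_def by (intro exI[of _ "\<rho>/2"]) auto
qed

text \<open>Near \<open>P a\<close> write \<open>y = P (a + B x)\<close> with \<open>x\<close> of size \<open>O(\<parallel>y - P a\<parallel>)\<close>.  Then \<open>x = y - P a + o(\<parallel>y - P a\<parallel>)\<close>, and
the expansion of \<open>f \<circ> P\<close> at \<open>a\<close> becomes one of \<open>f\<close> at \<open>P a\<close>.\<close>

lemma descent_has_derivative:
  fixes P :: "'a::real_normed_vector \<Rightarrow> 'b::banach" and f :: "'b \<Rightarrow> 'c::real_normed_vector"
  assumes P: "has_strict_derivative P A a"
    and B: "bounded_linear B" and AB: "\<And>v. A (B v) = v"
    and fP: "((\<lambda>x. f (P x)) has_derivative F) (at a)"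
  shows "(f has_derivative (\<lambda>v. F (B v))) (at (P a))"
  unfolding has_derivative_at_alt
proof (intro conjI allI impI)
  have F: "bounded_linear F" using fP by (rule has_derivative_bounded_linear)
  have A: "bounded_linear A" using P by (simp add: has_strict_derivative_def)
  show "bounded_linear (\<lambda>v. F (B v))" by (rule bounded_linear_compose[OF F B])
  obtain K where K: "K > 0" "\<And>x. norm (B x) \<le> norm x * K"
    using bounded_linear.pos_bounded[OF B] by blast
  obtain L where L: "L > 0" "\<And>x. norm (F (B x)) \<le> norm x * L"
    using bounded_linear.pos_bounded[OF bounded_linear_compose[OF F B]] by blast
  obtain \<rho> where \<rho>: "\<rho> > 0"
    "\<And>y. y \<in> cball (P a) \<rho> \<Longrightarrow> \<exists>x. P (a + B x) = y \<and> norm x \<le> 2 * norm (y - P a)"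
    using strict_derivative_local_section[OF P B AB] by blast
  fix e :: real assume e: "e > 0"
  define e1 where "e1 = e / (4 * K)"
  define e2 where "e2 = e / (4 * K * L)"
  have e12: "e1 > 0" "e2 > 0" using e K L by (simp_all add: e1_def e2_def)
  obtain d1 where d1: "d1 > 0"
    "\<And>z. norm (z - a) < d1 \<Longrightarrow> norm (f (P z) - f (P a) - F (z - a)) \<le> e1 * norm (z - a)"
    using fP e12(1) unfolding has_derivative_at_alt by meson
  obtain d2 where d2: "d2 > 0"
    "\<And>z w. z \<in> ball a d2 \<Longrightarrow> w \<in> ball a d2 \<Longrightarrow> norm (P z - P w - A (z - w)) \<le> e2 * norm (z - w)"
    using P e12(2) unfolding has_strict_derivative_def by meson
  define d where "d = min \<rho> (min d1 d2 / (2 * K))"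
  have "norm (f y - f (P a) - F (B (y - P a))) \<le> e * norm (y - P a)" if y: "norm (y - P a) < d" for y
  proof -
    define n where "n = norm (y - P a)"
    have "y \<in> cball (P a) \<rho>" using y by (simp add: d_def dist_norm norm_minus_commute)
    then obtain x where x: "P (a + B x) = y" "norm x \<le> 2 * n" using \<rho>(2) n_def by blast
    have Bx: "norm (B x) \<le> 2 * K * n"
      using order_trans[OF K(2)[of x] mult_right_mono[OF x(2)]] K(1) by (simp add: algebra_simps)
    also have "\<dots> < min d1 d2"
      using y K(1) by (simp add: d_def n_def pos_less_divide_eq algebra_simps)
    finally have Bxd: "norm (B x) < min d1 d2" .
    have 1: "norm (f y - f (P a) - F (B x)) \<le> e1 * norm (B x)"
      using d1(2)[of "a + B x"] x(1) Bxd by simp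
    have "norm (P (a + B x) - P a - A (B x)) \<le> e2 * norm (B x)"
      using d2(2)[of "a + B x" a] Bxd d2(1) by (simp add: dist_norm)
    then have 2: "norm (y - P a - x) \<le> e2 * norm (B x)" using x(1) AB by simp
    have Fd: "F (B (y - P a)) = F (B x) + F (B (y - P a - x))"
      using linear_diff[OF bounded_linear.linear[OF bounded_linear_compose[OF F B]], of "y - P a" x] by simp
    have "norm (f y - f (P a) - F (B (y - P a)))
        = norm ((f y - f (P a) - F (B x)) - F (B (y - P a - x)))"
      unfolding Fd by (simp add: algebra_simps)
    also have "\<dots> \<le> norm (f y - f (P a) - F (B x)) + norm (F (B (y - P a - x)))"
      by (rule norm_triangle_ineq4)
    also have "\<dots> \<le> e1 * norm (B x) + (e2 * norm (B x)) * L"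
      using 1 order_trans[OF L(2) mult_right_mono[OF 2]] L(1) by (intro add_mono) auto
    also have "\<dots> = (e / (2 * K)) * norm (B x)"
      using K(1) L(1) by (simp add: e1_def e2_def field_simps)
    also have "\<dots> \<le> (e / (2 * K)) * (2 * K * n)"
      using Bx e K(1) by (intro mult_left_mono) auto
    also have "\<dots> = e * n" using K(1) by simp
    finally show ?thesis by (simp add: n_def)
  qed
  moreover have "d > 0" using \<rho>(1) d1(1) d2(1) K(1) by (simp add: d_def)
  ultimately show "\<exists>d>0. \<forall>y. norm (y - P a) < d \<longrightarrow>
      norm (f y - f (P a) - F (B (y - P a))) \<le> e * norm (y - P a)" by blast
qed


section \<open>Differentials of maps between manifolds\<close>

text \<open>\<open>par M p\<close> is the parametrization of a neighbourhood of \<open>p\<close> by its coordinates, and \<open>crd M p\<close> are the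
coordinates of \<open>p\<close> itself.\<close>

abbreviation par :: "('a, 'e) mfd \<Rightarrow> 'a \<Rightarrow> 'e \<Rightarrow> 'a" where
  "par M p \<equiv> cinv (chart_at M p)"

abbreviation crd :: "('a, 'e) mfd \<Rightarrow> 'a \<Rightarrow> 'e" where
  "crd M p \<equiv> cmap (chart_at M p) p"

lemma chart_at_props:
  assumes "manifold M" "p \<in> points M"
  shows "chart_at M p \<in> charts M" "p \<in> cdom (chart_at M p)"
proof -
  have "\<exists>c. c \<in> charts M \<and> p \<in> cdom c"
    using assms unfolding manifold_def by blast
  from someI_ex[OF this] show "chart_at M p \<in> charts M" "p \<in> cdom (chart_at M p)"
    unfolding chart_at_def by auto
qed

lemma is_chart_inj:
  assumes "is_chart X c"
  shows "inj_on (cmap c) (cdom c)"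
proof -
  have "topspace (subtopology X (cdom c)) = cdom c"
    using assms openin_subset[of X "cdom c"] by (auto simp: is_chart_def)
  moreover have "homeomorphic_map (subtopology X (cdom c)) (top_of_set (cmap c ` cdom c)) (cmap c)"
    using assms by (simp add: is_chart_def)
  ultimately show ?thesis using homeomorphic_imp_injective_map by metis
qed

lemma cinv_cmap: "is_chart X c \<Longrightarrow> x \<in> cdom c \<Longrightarrow> cinv c (cmap c x) = x"
  unfolding cinv_def by (rule inv_into_f_f[OF is_chart_inj])

lemma chart_image_open:
  assumes c: "is_chart X c" and V: "openin X V" "V \<subseteq> cdom c"
  shows "open (cmap c ` V)"
proof -
  have hom: "homeomorphic_map (subtopology X (cdom c)) (top_of_set (cmap c ` cdom c)) (cmap c)"
    and op: "open (cmap c ` cdom c)" and dom: "openin X (cdom c)"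
    using c by (auto simp: is_chart_def)
  have "openin (subtopology X (cdom c)) V"
    using V openin_open_subtopology[OF dom] by blast
  then have "openin (top_of_set (cmap c ` cdom c)) (cmap c ` V)"
    using homeomorphic_imp_open_map[OF hom] by (simp add: open_map_def)
  then show ?thesis using openin_open_eq[OF op] by simp
qed

lemma manifold_is_chart: "manifold M \<Longrightarrow> c \<in> charts M \<Longrightarrow> is_chart (mtop M) c"
  by (simp add: manifold_def)

lemma manifold_finite_dim:
  "manifold (M :: ('a, 'e::banach) mfd) \<Longrightarrow> \<exists>B::'e set. finite B \<and> span B = UNIV"
  by (simp add: manifold_def)

lemma is_chart_at: "manifold M \<Longrightarrow> p \<in> points M \<Longrightarrow> is_chart (mtop M) (chart_at M p)"
  by (intro manifold_is_chart chart_at_props(1))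

lemma par_crd: "manifold M \<Longrightarrow> p \<in> points M \<Longrightarrow> par M p (crd M p) = p"
  by (rule cinv_cmap[OF is_chart_at chart_at_props(2)])

lemma eventually_par:
  assumes M: "manifold M" and p: "p \<in> points M" and V: "openin (mtop M) V" "p \<in> V"
  shows "\<forall>\<^sub>F z in nhds (crd M p). par M p z \<in> V \<and> par M p z \<in> cdom (chart_at M p)
           \<and> cmap (chart_at M p) (par M p z) = z"
proof -
  let ?c = "chart_at M p"
  have c: "is_chart (mtop M) ?c" using is_chart_at[OF M p] .
  have "openin (mtop M) (V \<inter> cdom ?c)" using V c by (auto simp: is_chart_def)
  then have "open (cmap ?c ` (V \<inter> cdom ?c))" by (intro chart_image_open[OF c]) auto
  moreover have "crd M p \<in> cmap ?c ` (V \<inter> cdom ?c)" using V chart_at_props(2)[OF M p] by auto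
  ultimately have "\<forall>\<^sub>F z in nhds (crd M p). z \<in> cmap ?c ` (V \<inter> cdom ?c)"
    by (rule eventually_nhds_in_open)
  then show ?thesis by eventually_elim (auto simp: cinv_cmap[OF c])
qed

lemma isCont_imp_filterlim_nhds: "isCont f x \<Longrightarrow> filterlim f (nhds (f x)) (nhds x)"
  unfolding isCont_def by (simp add: tendsto_at_iff_tendsto_nhds)

lemma eventually_par2:
  assumes M: "manifold M" and p: "p \<in> points M" and N: "manifold N" and q: "q \<in> points N"
    and W: "openin (prod_topology (mtop M) (mtop N)) W" "(p, q) \<in> W"
  shows "\<forall>\<^sub>F z in nhds (crd M p, crd N q). (par M p (fst z), par N q (snd z)) \<in> W
           \<and> (par M p (fst z) \<in> cdom (chart_at M p) \<and> cmap (chart_at M p) (par M p (fst z)) = fst z)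
           \<and> (par N q (snd z) \<in> cdom (chart_at N q) \<and> cmap (chart_at N q) (par N q (snd z)) = snd z)"
proof -
  obtain V1 V2 where V: "openin (mtop M) V1" "openin (mtop N) V2" "p \<in> V1" "q \<in> V2" "V1 \<times> V2 \<subseteq> W"
    using openin_prod_topology_alt[THEN iffD1, rule_format, OF W] by (elim exE conjE)
  have 1: "\<forall>\<^sub>F z in nhds (crd M p, crd N q). par M p (fst z) \<in> V1 \<and> par M p (fst z) \<in> cdom (chart_at M p)
         \<and> cmap (chart_at M p) (par M p (fst z)) = fst z"
    by (rule eventually_compose_filterlim[OF eventually_par[OF M p V(1,3)]])
       (use isCont_imp_filterlim_nhds[where f=fst and x="(crd M p, crd N q)"] in simp)
  have 2: "\<forall>\<^sub>F z in nhds (crd M p, crd N q). par N q (snd z) \<in> V2 \<and> par N q (snd z) \<in> cdom (chart_at N q)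
         \<and> cmap (chart_at N q) (par N q (snd z)) = snd z"
    by (rule eventually_compose_filterlim[OF eventually_par[OF N q V(2,4)]])
       (use isCont_imp_filterlim_nhds[where f=snd and x="(crd M p, crd N q)"] in simp)
  from 1 2 show ?thesis
  proof eventually_elim
    case (elim z)
    then show ?case using V(5) by (simp add: subset_iff)
  qed
qed

lemma has_derivative_cong_nhds:
  assumes "\<forall>\<^sub>F y in nhds x. f y = g y"
  shows "(f has_derivative D) (at x) \<longleftrightarrow> (g has_derivative D) (at x)"
proof -
  obtain S where "open S" "x \<in> S" "\<And>y. y \<in> S \<Longrightarrow> f y = g y"
    using assms by (auto simp: eventually_nhds)
  then show ?thesis using has_derivative_transform_within_open by metis
qed

text \<open>Differentiability of a map from a normed space into a manifold.  Curves, the parametrizations \<open>par\<close>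
and maps of two points in coordinates are all of this kind, so that one chain rule serves them all.
The second conjunct is continuity at \<open>x\<close>: without it the coordinates of \<open>h y\<close> could be taken outside
the domain of the chart.\<close>

definition has_deriv_into ::
  "('a, 'e::banach) mfd \<Rightarrow> ('x::real_normed_vector \<Rightarrow> 'a) \<Rightarrow> 'x \<Rightarrow> ('x \<Rightarrow> 'e) \<Rightarrow> bool" where
  "has_deriv_into M h x D \<longleftrightarrow> h x \<in> points M \<and>
     (\<forall>V. openin (mtop M) V \<longrightarrow> h x \<in> V \<longrightarrow> (\<forall>\<^sub>F y in nhds x. h y \<in> V)) \<and>
     ((\<lambda>y. cmap (chart_at M (h x)) (h y)) has_derivative D) (at x)"

definition has_tmap ::
  "('a, 'e::banach) mfd \<Rightarrow> ('b, 'f::banach) mfd \<Rightarrow> ('a \<Rightarrow> 'b) \<Rightarrow> 'a \<Rightarrow> ('e \<Rightarrow> 'f) \<Rightarrow> bool" where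
  "has_tmap M N f p A \<longleftrightarrow> p \<in> points M \<and> has_deriv_into N (\<lambda>z. f (par M p z)) (crd M p) A"

text \<open>A map of two points is differentiated in the product of the charts at the two points; the chart that
\<open>chart_at\<close> selects for the product manifold need not be this one.\<close>

definition has_tmap2 ::
  "('a, 'e::banach) mfd \<Rightarrow> ('b, 'f::banach) mfd \<Rightarrow> ('c, 'h::banach) mfd \<Rightarrow>
   ('a \<Rightarrow> 'b \<Rightarrow> 'c) \<Rightarrow> 'a \<Rightarrow> 'b \<Rightarrow> ('e \<times> 'f \<Rightarrow> 'h) \<Rightarrow> bool" where
  "has_tmap2 M N P F p q A \<longleftrightarrow> p \<in> points M \<and> q \<in> points N \<and>
     has_deriv_into P (\<lambda>z. F (par M p (fst z)) (par N q (snd z))) (crd M p, crd N q) A"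

lemma has_deriv_into_linear: "has_deriv_into M h x D \<Longrightarrow> linear D"
  unfolding has_deriv_into_def using has_derivative_linear by blast

lemma has_deriv_into_unique:
  "has_deriv_into M h x D \<Longrightarrow> has_deriv_into M h x D' \<Longrightarrow> D = D'"
  by (auto simp: has_deriv_into_def intro: has_derivative_unique)

lemma has_tmap_linear: "has_tmap M N f p A \<Longrightarrow> linear A"
  unfolding has_tmap_def using has_deriv_into_linear by blast

lemma has_tmap2_linear: "has_tmap2 M N P F p q A \<Longrightarrow> linear A"
  unfolding has_tmap2_def using has_deriv_into_linear by blast

lemma has_tmap_point: "manifold M \<Longrightarrow> has_tmap M N f p A \<Longrightarrow> f p \<in> points N"
  using par_crd[of M p] by (simp add: has_tmap_def has_deriv_into_def)

lemma tmap_eq: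
  assumes "manifold M" "has_tmap M N f p A"
  shows "tmap M N f p = A"
proof -
  have "par M p (crd M p) = p" using assms by (intro par_crd) (simp_all add: has_tmap_def)
  then have "((\<lambda>z. cmap (chart_at N (f p)) (f (par M p z))) has_derivative A) (at (crd M p))"
    using assms(2) unfolding has_tmap_def has_deriv_into_def by simp
  from frechet_derivative_at[OF this] show ?thesis by (simp add: tmap_def)
qed

lemma has_deriv_into_cong:
  assumes "\<forall>\<^sub>F y in nhds x. h y = k y"
  shows "has_deriv_into M h x D \<longleftrightarrow> has_deriv_into M k x D"
proof -
  have hk: "h x = k x" using assms eventually_nhds_x_imp_x by fast
  have 1: "(\<forall>\<^sub>F y in nhds x. h y \<in> V) \<longleftrightarrow> (\<forall>\<^sub>F y in nhds x. k y \<in> V)" for V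
    by (rule eventually_cong[OF assms]) simp
  have 2: "((\<lambda>y. cmap c (h y)) has_derivative D) (at x) \<longleftrightarrow> ((\<lambda>y. cmap c (k y)) has_derivative D) (at x)"
    for c
    by (rule has_derivative_cong_nhds) (use assms in \<open>eventually_elim, simp\<close>)
  show ?thesis unfolding has_deriv_into_def 1 2 hk by simp
qed

lemma has_deriv_into_const: "p \<in> points M \<Longrightarrow> has_deriv_into M (\<lambda>_. p) x (\<lambda>_. 0)"
  unfolding has_deriv_into_def by auto

lemma has_deriv_into_par:
  assumes "manifold M" "p \<in> points M"
  shows "has_deriv_into M (par M p) (crd M p) (\<lambda>v. v)"
  unfolding has_deriv_into_def par_crd[OF assms]
proof (intro conjI allI impI)
  show "p \<in> points M" by fact
  fix V assume "openin (mtop M) V" "p \<in> V"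
  from eventually_par[OF assms this] show "\<forall>\<^sub>F z in nhds (crd M p). par M p z \<in> V"
    by (rule eventually_mono) auto
next
  have "\<forall>\<^sub>F z in nhds (crd M p). cmap (chart_at M p) (par M p z) = z"
    using eventually_par[OF assms openin_topspace assms(2)] by (rule eventually_mono) auto
  from has_derivative_cong_nhds[OF this]
  show "((\<lambda>z. cmap (chart_at M p) (par M p z)) has_derivative (\<lambda>v. v)) (at (crd M p))" by simp
qed

lemma has_derivative_imp_filterlim_nhds:
  "(f has_derivative D) (at x) \<Longrightarrow> filterlim f (nhds (f x)) (nhds x)"
  using has_derivative_continuous isCont_imp_filterlim_nhds by blast

lemma has_deriv_into_precompose:
  assumes h: "has_deriv_into M h (u x) D" and u: "(u has_derivative U) (at x)"
  shows "has_deriv_into M (\<lambda>y. h (u y)) x (\<lambda>v. D (U v))"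
  unfolding has_deriv_into_def
proof (intro conjI allI impI)
  show "h (u x) \<in> points M" using h by (simp add: has_deriv_into_def)
  fix V assume "openin (mtop M) V" "h (u x) \<in> V"
  then have "\<forall>\<^sub>F y in nhds (u x). h y \<in> V" using h by (simp add: has_deriv_into_def)
  from eventually_compose_filterlim[OF this has_derivative_imp_filterlim_nhds[OF u]]
  show "\<forall>\<^sub>F y in nhds x. h (u y) \<in> V" .
next
  have "((\<lambda>y. cmap (chart_at M (h (u x))) (h y)) has_derivative D) (at (u x))"
    using h by (simp add: has_deriv_into_def)
  from diff_chain_at[OF u this]
  show "((\<lambda>y. cmap (chart_at M (h (u x))) (h (u y))) has_derivative (\<lambda>v. D (U v))) (at x)"
    by (simp add: comp_def)
qed

lemma eventually_par_cmap:
  assumes M: "manifold M" and h: "has_deriv_into M h x D"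
  shows "\<forall>\<^sub>F y in nhds x. par M (h x) (cmap (chart_at M (h x)) (h y)) = h y"
proof -
  have p: "h x \<in> points M" using h by (simp add: has_deriv_into_def)
  have c: "is_chart (mtop M) (chart_at M (h x))" using is_chart_at[OF M p] .
  then have "\<forall>\<^sub>F y in nhds x. h y \<in> cdom (chart_at M (h x))"
    using h chart_at_props(2)[OF M p] unfolding has_deriv_into_def is_chart_def by blast
  then show ?thesis by eventually_elim (rule cinv_cmap[OF c])
qed

lemma has_deriv_into_chain:
  assumes M: "manifold M" and h: "has_deriv_into M h x D" and f: "has_tmap M N f (h x) A"
  shows "has_deriv_into N (\<lambda>y. f (h y)) x (\<lambda>v. A (D v))"
proof -
  have u: "((\<lambda>y. cmap (chart_at M (h x)) (h y)) has_derivative D) (at x)"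
    using h by (simp add: has_deriv_into_def)
  have "has_deriv_into N (\<lambda>y. f (par M (h x) (cmap (chart_at M (h x)) (h y)))) x (\<lambda>v. A (D v))"
    by (rule has_deriv_into_precompose[OF _ u]) (use f in \<open>simp add: has_tmap_def\<close>)
  moreover have "\<forall>\<^sub>F y in nhds x. f (par M (h x) (cmap (chart_at M (h x)) (h y))) = f (h y)"
    using eventually_par_cmap[OF M h] by (rule eventually_mono) simp
  note has_deriv_into_cong[OF this, of N "\<lambda>v. A (D v)"]
  ultimately show ?thesis by simp
qed

text \<open>The Leibniz rule of the whole development: together with \<open>has_tmap2_split\<close> it differentiates products
such as \<open>g(t) q(t)\<close> factor by factor.\<close>

lemma has_deriv_into_chain2:
  assumes M: "manifold M" and N: "manifold N"
    and h: "has_deriv_into M h x D" and k: "has_deriv_into N k x E"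
    and F: "has_tmap2 M N P F (h x) (k x) A"
  shows "has_deriv_into P (\<lambda>y. F (h y) (k y)) x (\<lambda>v. A (D v, E v))"
proof -
  let ?u = "\<lambda>y. (cmap (chart_at M (h x)) (h y), cmap (chart_at N (k x)) (k y))"
  have u: "(?u has_derivative (\<lambda>v. (D v, E v))) (at x)"
    using h k by (intro has_derivative_Pair) (simp_all add: has_deriv_into_def)
  have "has_deriv_into P (\<lambda>y. F (par M (h x) (fst (?u y))) (par N (k x) (snd (?u y)))) x (\<lambda>v. A (D v, E v))"
    by (rule has_deriv_into_precompose[OF _ u]) (use F in \<open>simp add: has_tmap2_def\<close>)
  moreover have "\<forall>\<^sub>F y in nhds x. F (par M (h x) (fst (?u y))) (par N (k x) (snd (?u y))) = F (h y) (k y)"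
    using eventually_par_cmap[OF M h] eventually_par_cmap[OF N k] by eventually_elim simp
  note has_deriv_into_cong[OF this, of P "\<lambda>v. A (D v, E v)"]
  ultimately show ?thesis by simp
qed

lemma has_tmap_const: "p \<in> points M \<Longrightarrow> q \<in> points N \<Longrightarrow> has_tmap M N (\<lambda>_. q) p (\<lambda>_. 0)"
  unfolding has_tmap_def by (simp add: has_deriv_into_const)

lemma has_tmap_id: "manifold M \<Longrightarrow> p \<in> points M \<Longrightarrow> has_tmap M M (\<lambda>x. x) p (\<lambda>v. v)"
  unfolding has_tmap_def by (simp add: has_deriv_into_par)

lemma has_tmap_compose:
  assumes "manifold M" "manifold N" "has_tmap M N f p A" "has_tmap N P g (f p) B"
  shows "has_tmap M P (\<lambda>x. g (f x)) p (\<lambda>v. B (A v))"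
proof -
  have p: "p \<in> points M" using assms(3) by (simp add: has_tmap_def)
  have "has_deriv_into P (\<lambda>z. g (f (par M p z))) (crd M p) (\<lambda>v. B (A v))"
    by (rule has_deriv_into_chain[OF assms(2)])
       (use assms(3,4) p par_crd[OF assms(1) p] in \<open>simp_all add: has_tmap_def\<close>)
  then show ?thesis using p by (simp add: has_tmap_def)
qed

lemma has_tmap_compose2:
  assumes "manifold X" "manifold M" "manifold N"
    "has_tmap X M f p D" "has_tmap X N g p E" "has_tmap2 M N P F (f p) (g p) A"
  shows "has_tmap X P (\<lambda>x. F (f x) (g x)) p (\<lambda>v. A (D v, E v))"
proof -
  have p: "p \<in> points X" using assms(4) by (simp add: has_tmap_def)
  have "has_deriv_into P (\<lambda>z. F (f (par X p z)) (g (par X p z))) (crd X p) (\<lambda>v. A (D v, E v))"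
    by (rule has_deriv_into_chain2[OF assms(2,3)])
       (use assms(4-6) par_crd[OF assms(1) p] in \<open>simp_all add: has_tmap_def\<close>)
  then show ?thesis using p by (simp add: has_tmap_def)
qed

lemma has_tmap2_points: "has_tmap2 M N P F p q A \<Longrightarrow> p \<in> points M \<and> q \<in> points N"
  by (simp add: has_tmap2_def)

lemma has_tmap2_slice1:
  assumes "manifold M" "manifold N" "has_tmap2 M N P F p q A"
  shows "has_tmap M P (\<lambda>x. F x q) p (\<lambda>v. A (v, 0))"
  by (rule has_tmap_compose2[OF assms(1,1,2) has_tmap_id has_tmap_const assms(3)])
     (use has_tmap2_points[OF assms(3)] assms(1) in auto)

lemma has_tmap2_slice2:
  assumes "manifold M" "manifold N" "has_tmap2 M N P F p q A"
  shows "has_tmap N P (\<lambda>y. F p y) q (\<lambda>v. A (0, v))"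
  by (rule has_tmap_compose2[OF assms(2,1,2) has_tmap_const has_tmap_id assms(3)])
     (use has_tmap2_points[OF assms(3)] assms(2) in auto)

lemma has_tmap2_split:
  "has_tmap2 M N P F p q A \<Longrightarrow> A (v, w) = A (v, 0) + A (0, w)"
  using linear_add[OF has_tmap2_linear, of M N P F p q A "(v, 0)" "(0, w)"] by simp

lemma has_tmap2_compose:
  assumes X: "manifold X" "manifold Y" and "manifold M" "manifold N"
    and f: "has_tmap2 X Y M f p q D" and g: "has_tmap2 X Y N g p q E"
    and F: "has_tmap2 M N P F (f p q) (g p q) A"
  shows "has_tmap2 X Y P (\<lambda>x y. F (f x y) (g x y)) p q (\<lambda>v. A (D v, E v))"
proof -
  have p: "p \<in> points X" "q \<in> points Y" using has_tmap2_points[OF f] by auto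
  have "has_deriv_into P (\<lambda>z. F (f (par X p (fst z)) (par Y q (snd z))) (g (par X p (fst z)) (par Y q (snd z))))
      (crd X p, crd Y q) (\<lambda>v. A (D v, E v))"
    by (rule has_deriv_into_chain2[OF assms(3,4)])
       (use f g F par_crd[OF X(1) p(1)] par_crd[OF X(2) p(2)] in \<open>simp_all add: has_tmap2_def\<close>)
  then show ?thesis using p by (simp add: has_tmap2_def)
qed

lemma has_tmap2_after:
  assumes "manifold X" "manifold Y" "manifold M"
    and f: "has_tmap2 X Y M f p q D" and g: "has_tmap M P g (f p q) A"
  shows "has_tmap2 X Y P (\<lambda>x y. g (f x y)) p q (\<lambda>v. A (D v))"
proof -
  have p: "p \<in> points X" "q \<in> points Y" using has_tmap2_points[OF f] by auto
  have "has_deriv_into P (\<lambda>z. g (f (par X p (fst z)) (par Y q (snd z)))) (crd X p, crd Y q) (\<lambda>v. A (D v))"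
    by (rule has_deriv_into_chain[OF assms(3)])
       (use f g par_crd[OF assms(1) p(1)] par_crd[OF assms(2) p(2)] in \<open>simp_all add: has_tmap2_def\<close>)
  then show ?thesis using p by (simp add: has_tmap2_def)
qed

lemma has_tmap2_fst:
  assumes "manifold X" "p \<in> points X" "q \<in> points Y"
  shows "has_tmap2 X Y X (\<lambda>x y. x) p q fst"
  unfolding has_tmap2_def
  using has_deriv_into_precompose[of X "par X p" fst "(crd X p, crd Y q)" "\<lambda>v. v" fst]
    has_deriv_into_par[OF assms(1,2)] assms
  by (simp add: bounded_linear_imp_has_derivative bounded_linear_fst)

lemma has_tmap2_snd:
  assumes "manifold Y" "p \<in> points X" "q \<in> points Y"
  shows "has_tmap2 X Y Y (\<lambda>x y. y) p q snd"
  unfolding has_tmap2_def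
  using has_deriv_into_precompose[of Y "par Y q" snd "(crd X p, crd Y q)" "\<lambda>v. v" snd]
    has_deriv_into_par[OF assms(1,3)] assms
  by (simp add: bounded_linear_imp_has_derivative bounded_linear_snd)

lemma has_tmap_cong:
  assumes M: "manifold M" and V: "openin (mtop M) V" "p \<in> V" and eq: "\<And>x. x \<in> V \<Longrightarrow> f x = g x"
  shows "has_tmap M N f p A \<longleftrightarrow> has_tmap M N g p A"
proof (cases "p \<in> points M")
  case True
  have "\<forall>\<^sub>F z in nhds (crd M p). f (par M p z) = g (par M p z)"
    using eventually_par[OF M True V] by eventually_elim (simp add: eq)
  from has_deriv_into_cong[OF this, of N A] show ?thesis by (simp add: has_tmap_def)
qed (simp add: has_tmap_def)

text \<open>Two maps that agree on a neighbourhood only, such as those built from \<open>\<A>\<^sub>d\<close>, which is meaningful only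
on \<open>\<UU>\<close>, have the same differential.\<close>

lemma has_tmap2_cong:
  assumes M: "manifold M" and N: "manifold N"
    and W: "openin (prod_topology (mtop M) (mtop N)) W" "(p, q) \<in> W"
    and eq: "\<And>x y. (x, y) \<in> W \<Longrightarrow> F x y = F' x y"
  shows "has_tmap2 M N P F p q A \<longleftrightarrow> has_tmap2 M N P F' p q A"
proof (cases "p \<in> points M \<and> q \<in> points N")
  case True
  then have "\<forall>\<^sub>F z in nhds (crd M p, crd N q).
      F (par M p (fst z)) (par N q (snd z)) = F' (par M p (fst z)) (par N q (snd z))"
    using eventually_par2[OF M _ N _ W] by (auto elim!: eventually_mono simp: eq)
  from has_deriv_into_cong[OF this, of P A] show ?thesis by (simp add: has_tmap2_def)
qed (auto simp: has_tmap2_def)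

lemma has_tmap_tmap:
  assumes "manifold M" "has_tmap M N f p A"
  shows "has_tmap M N f p (tmap M N f p)"
  using tmap_eq[OF assms] assms(2) by simp

subsection \<open>Smooth maps are differentiable\<close>

lemma smooth_map_on_point:
  assumes "smooth_map_on U M N f" "x \<in> U"
  shows "x \<in> points M" "f x \<in> points N"
proof -
  have U: "U \<subseteq> points M" using assms(1) by (intro openin_subset) (simp add: smooth_map_on_def)
  then show x: "x \<in> points M" using assms(2) by (rule subsetD)
  have "continuous_map (subtopology (mtop M) U) (mtop N) f" using assms by (simp add: smooth_map_on_def)
  from continuous_map_image_subset_topspace[OF this]
  have "f ` topspace (subtopology (mtop M) U) \<subseteq> points N" by simp
  then show "f x \<in> points N" using assms(2) x by (simp add: image_subset_iff)
qed

lemma smooth_map_on_preimage: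
  assumes f: "smooth_map_on U M N f" and V: "openin (mtop N) V"
  shows "openin (mtop M) {x \<in> U. f x \<in> V}"
proof -
  have U: "openin (mtop M) U" and c: "continuous_map (subtopology (mtop M) U) (mtop N) f"
    using f by (auto simp: smooth_map_on_def)
  have "openin (subtopology (mtop M) U) {x \<in> topspace (subtopology (mtop M) U). f x \<in> V}"
    using openin_continuous_map_preimage[OF c V] .
  moreover have "topspace (subtopology (mtop M) U) = U" using openin_subset[OF U] by auto
  ultimately have "openin (subtopology (mtop M) U) {x \<in> U. f x \<in> V}" by (simp only:)
  then show ?thesis using openin_trans_full[OF _ U] by blast
qed

lemma smooth_on_differentiable:
  assumes "smooth_on S f" "x \<in> S"
  shows "f differentiable (at x)"
proof -
  have "Ck_on (Suc 0) S f" using assms(1) unfolding smooth_on_def by blast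
  then show ?thesis using assms(2) by simp
qed

lemma smooth_map_on_in_charts:
  assumes "smooth_map_on U M N f" "c \<in> charts M" "d \<in> charts N"
  shows "smooth_on (cmap c ` {x \<in> U \<inter> cdom c. f x \<in> cdom d}) (\<lambda>y. cmap d (f (cinv c y)))"
  using assms by (simp add: smooth_map_on_def)

lemma smooth_imp_has_tmap:
  assumes M: "manifold M" and N: "manifold N" and f: "smooth_map_on U M N f" and p: "p \<in> U"
  shows "\<exists>A. has_tmap M N f p A"
proof -
  note pts = smooth_map_on_point[OF f p]
  let ?c = "chart_at M p" and ?d = "chart_at N (f p)"
  let ?g = "\<lambda>y. cmap ?d (f (cinv ?c y))"
  have "smooth_on (cmap ?c ` {x \<in> U \<inter> cdom ?c. f x \<in> cdom ?d}) ?g"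
    using f chart_at_props(1)[OF M pts(1)] chart_at_props(1)[OF N pts(2)] by (simp add: smooth_map_on_def)
  moreover have "crd M p \<in> cmap ?c ` {x \<in> U \<inter> cdom ?c. f x \<in> cdom ?d}"
    using p chart_at_props(2)[OF M pts(1)] chart_at_props(2)[OF N pts(2)] by auto
  ultimately have "?g differentiable (at (crd M p))" by (rule smooth_on_differentiable)
  then obtain A where A: "(?g has_derivative A) (at (crd M p))" by (auto simp: differentiable_def)
  have "\<forall>\<^sub>F z in nhds (crd M p). f (par M p z) \<in> V" if "openin (mtop N) V" "f p \<in> V" for V
    using eventually_par[OF M pts(1) smooth_map_on_preimage[OF f that(1)]] p that(2)
    by (auto elim: eventually_mono)
  then have "has_tmap M N f p A"
    unfolding has_tmap_def has_deriv_into_def using A pts par_crd[OF M pts(1)] by simp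
  then show ?thesis by blast
qed

lemma is_chart_product_inverse:
  assumes "is_chart X c" "is_chart Y d" "x \<in> cdom c" "y \<in> cdom d"
  shows "cinv (cdom c \<times> cdom d, map_prod (cmap c) (cmap d)) (cmap c x, cmap d y) = (x, y)"
proof -
  have "inj_on (map_prod (cmap c) (cmap d)) (cdom c \<times> cdom d)"
    by (rule map_prod_inj_on[OF is_chart_inj[OF assms(1)] is_chart_inj[OF assms(2)]])
  from inv_into_f_f[OF this, of "(x, y)"] show ?thesis using assms by (simp add: cinv_def)
qed

lemma product_chart:
  assumes "c \<in> charts M" "d \<in> charts N"
  shows "(cdom c \<times> cdom d, map_prod (cmap c) (cmap d)) \<in> charts (prod_mfd M N)"
  using assms by (simp only: prod_mfd_def mfd.select_convs) blast

text \<open>The product of the charts at \<open>p\<close> and \<open>q\<close> is a chart of the product manifold, so smoothness on the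
product manifold gives differentiability in exactly the coordinates of \<open>has_tmap2\<close>.\<close>

lemma smooth_imp_has_tmap2:
  assumes M: "manifold M" and N: "manifold N" and P: "manifold P"
    and f: "smooth_map_on U (prod_mfd M N) P (\<lambda>(x, y). F x y)" and pq: "(p, q) \<in> U"
  shows "\<exists>A. has_tmap2 M N P F p q A"
proof -
  note pts = smooth_map_on_point[OF f pq]
  have p: "p \<in> points M" and q: "q \<in> points N" and Fpq: "F p q \<in> points P"
    using pts by (auto simp: prod_mfd_def)
  let ?c = "chart_at M p" and ?d = "chart_at N q" and ?e = "chart_at P (F p q)"
  let ?cd = "(cdom ?c \<times> cdom ?d, map_prod (cmap ?c) (cmap ?d))"
  have c: "is_chart (mtop M) ?c" and d: "is_chart (mtop N) ?d" using is_chart_at[OF M p] is_chart_at[OF N q] by auto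
  let ?S = "cmap ?cd ` {x \<in> U \<inter> cdom ?cd. (\<lambda>(x, y). F x y) x \<in> cdom ?e}"
  let ?g = "\<lambda>y. cmap ?e ((\<lambda>(x, y). F x y) (cinv ?cd y))"
  have "?cd \<in> charts (prod_mfd M N)"
    by (rule product_chart[OF chart_at_props(1)[OF M p] chart_at_props(1)[OF N q]])
  then have "smooth_on ?S ?g"
    by (rule smooth_map_on_in_charts[OF f _ chart_at_props(1)[OF P Fpq]])
  moreover have "(crd M p, crd N q) \<in> ?S"
    by (rule image_eqI[where x="(p, q)"])
       (use pq chart_at_props(2)[OF M p] chart_at_props(2)[OF N q] chart_at_props(2)[OF P Fpq] in simp_all)
  ultimately have "?g differentiable (at (crd M p, crd N q))" by (rule smooth_on_differentiable)
  then obtain A where A: "(?g has_derivative A) (at (crd M p, crd N q))" by (auto simp: differentiable_def)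
  let ?h = "\<lambda>z. (par M p (fst z), par N q (snd z))"
  have nb: "\<forall>\<^sub>F z in nhds (crd M p, crd N q). ?h z \<in> W \<and> cinv ?cd z = ?h z"
    if W: "openin (prod_topology (mtop M) (mtop N)) W" "(p, q) \<in> W" for W
    using eventually_par2[OF M p N q W]
  proof eventually_elim
    case (elim z)
    then show ?case
      using is_chart_product_inverse[OF c d, of "par M p (fst z)" "par N q (snd z)"] by simp
  qed
  have "\<forall>\<^sub>F z in nhds (crd M p, crd N q). cinv ?cd z = ?h z"
    using nb[OF openin_topspace] p q by (auto elim: eventually_mono)
  then have "\<forall>\<^sub>F z in nhds (crd M p, crd N q). ?g z = cmap ?e (F (par M p (fst z)) (par N q (snd z)))"
    by eventually_elim simp
  from has_derivative_cong_nhds[OF this] A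
  have A': "((\<lambda>z. cmap ?e (F (par M p (fst z)) (par N q (snd z)))) has_derivative A) (at (crd M p, crd N q))"
    by blast
  have "\<forall>\<^sub>F z in nhds (crd M p, crd N q). F (par M p (fst z)) (par N q (snd z)) \<in> V"
    if V: "openin (mtop P) V" "F p q \<in> V" for V
  proof -
    have "openin (prod_topology (mtop M) (mtop N)) {x \<in> U. (\<lambda>(x, y). F x y) x \<in> V}"
      using smooth_map_on_preimage[OF f V(1)] by (simp add: prod_mfd_def)
    from nb[OF this] show ?thesis using pq V(2) by (auto elim: eventually_mono)
  qed
  then have "has_tmap2 M N P F p q A"
    unfolding has_tmap2_def has_deriv_into_def
    using A' p q Fpq par_crd[OF M p] par_crd[OF N q] by simp
  then show ?thesis by blast
qed

subsection \<open>Real-valued maps and curves\<close>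

lemma chart_at_real: "chart_at real_mfd x = (UNIV, id)"
  unfolding chart_at_def real_mfd_def by (rule some_equality) auto

lemma points_real [simp]: "points real_mfd = UNIV"
  by (simp add: real_mfd_def)

lemma cinv_id [simp]: "cinv (UNIV, id) = id"
  by (simp add: cinv_def)

lemma has_deriv_into_real: "has_deriv_into real_mfd h x D \<longleftrightarrow> (h has_derivative D) (at x)"
proof -
  have "\<forall>\<^sub>F y in nhds x. h y \<in> V" if "(h has_derivative D) (at x)" "openin (mtop real_mfd) V" "h x \<in> V" for V
  proof -
    have "open V" using that(2) by (simp add: real_mfd_def)
    then have "\<forall>\<^sub>F z in nhds (h x). z \<in> V" using that(3) by (rule eventually_nhds_in_open)
    then show ?thesis by (rule eventually_compose_filterlim[OF _ has_derivative_imp_filterlim_nhds[OF that(1)]])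
  qed
  note cont = this
  have "has_deriv_into real_mfd h x D \<longleftrightarrow> (h has_derivative D) (at x) \<and>
      (\<forall>V. openin (mtop real_mfd) V \<longrightarrow> h x \<in> V \<longrightarrow> (\<forall>\<^sub>F y in nhds x. h y \<in> V))"
    by (auto simp: has_deriv_into_def chart_at_real)
  with cont show ?thesis by blast
qed

lemma has_tmap_real_iff: "has_tmap real_mfd N c t A \<longleftrightarrow> has_deriv_into N c t A"
  unfolding has_tmap_def by (simp add: chart_at_real)

lemma manifold_real: "manifold real_mfd"
proof -
  have "\<exists>B::real set. finite B \<and> span B = UNIV"
    using span_Basis finite_Basis by blast
  moreover have "Hausdorff_space (mtop real_mfd)"
    by (simp add: real_mfd_def Hausdorff_space_euclidean)
  moreover have "second_countable (mtop real_mfd)"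
  proof -
    obtain B :: "real set set" where B: "countable B" "topological_basis B"
      using ex_countable_basis by auto
    then have "\<exists>V\<in>B. x \<in> V \<and> V \<subseteq> U" if "open U" "x \<in> U" for U x
      using topological_basisE[OF B(2) that] by metis
    moreover have "\<forall>V\<in>B. open V" using topological_basis_open[OF B(2)] by simp
    ultimately show ?thesis
      unfolding second_countable_def using B(1)
      by (intro exI[of _ B]) (simp add: real_mfd_def)
  qed
  moreover have "is_chart (mtop real_mfd) (UNIV, id)"
    by (auto simp: is_chart_def real_mfd_def)
  moreover have "smooth_transition (UNIV::real set, id) (UNIV, id::real \<Rightarrow> real)"
    unfolding smooth_transition_def smooth_on_def
  proof
    fix k
    have "Ck_on k UNIV (\<lambda>y::real. y)" by (cases k) (auto simp: Ck_on_const)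
    then show "Ck_on k (cmap (UNIV::real set, id) ` (cdom (UNIV, id) \<inter> cdom (UNIV, id))) (\<lambda>y::real. cmap (UNIV, id) (cinv (UNIV, id) y))"
      by simp
  qed
  ultimately show ?thesis unfolding manifold_def by (auto simp: real_mfd_def)
qed

lemma velocity_eq: "has_deriv_into M c 0 A \<Longrightarrow> velocity M c = A 1"
  using tmap_eq[OF manifold_real, of M c 0 A] by (simp add: has_tmap_real_iff)

subsection \<open>Composition of smooth maps\<close>

lemma smooth_map_on_subset:
  assumes f: "smooth_map_on U M N f" and V: "openin (mtop M) V" "V \<subseteq> U"
  shows "smooth_map_on V M N f"
  unfolding smooth_map_on_def
proof (intro conjI ballI)
  show "openin (mtop M) V" by fact
  show "continuous_map (subtopology (mtop M) V) (mtop N) f"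
    by (rule continuous_map_from_subtopology_mono[OF _ V(2)]) (use f in \<open>simp add: smooth_map_on_def\<close>)
  fix c d assume "c \<in> charts M" "d \<in> charts N"
  then have "smooth_on (cmap c ` {x \<in> U \<inter> cdom c. f x \<in> cdom d}) (\<lambda>y. cmap d (f (cinv c y)))"
    using f by (simp add: smooth_map_on_def)
  moreover have "cmap c ` {x \<in> V \<inter> cdom c. f x \<in> cdom d} \<subseteq> cmap c ` {x \<in> U \<inter> cdom c. f x \<in> cdom d}"
    using V by auto
  ultimately show "smooth_on (cmap c ` {x \<in> V \<inter> cdom c. f x \<in> cdom d}) (\<lambda>y. cmap d (f (cinv c y)))"
    unfolding smooth_on_def by (meson Ck_on_subset)
qed

text \<open>Near each point the composite is read through a chart of the middle manifold, which reduces the claim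
to \<open>Ck_on_compose\<close>.\<close>

lemma smooth_map_on_compose:
  assumes M: "manifold M" and N: "manifold N" and P: "manifold P"
    and f: "smooth_map_on U M N f" and g: "smooth_map_on V N P g" and fU: "f ` U \<subseteq> V"
  shows "smooth_map_on U M P (\<lambda>x. g (f x))"
  unfolding smooth_map_on_def
proof (intro conjI ballI)
  show U: "openin (mtop M) U" using f by (simp add: smooth_map_on_def)
  have contf: "continuous_map (subtopology (mtop M) U) (subtopology (mtop N) V) f"
    using f fU by (auto simp: smooth_map_on_def continuous_map_in_subtopology)
  have contg: "continuous_map (subtopology (mtop N) V) (mtop P) g" using g by (simp add: smooth_map_on_def)
  show "continuous_map (subtopology (mtop M) U) (mtop P) (\<lambda>x. g (f x))"
    using continuous_map_compose[OF contf contg] by (simp add: comp_def)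
  fix c d assume c: "c \<in> charts M" and d: "d \<in> charts P"
  have isc: "is_chart (mtop M) c" and isd: "is_chart (mtop P) d" using manifold_is_chart[OF M c] manifold_is_chart[OF P d] by auto
  show "smooth_on (cmap c ` {x \<in> U \<inter> cdom c. g (f x) \<in> cdom d}) (\<lambda>y. cmap d (g (f (cinv c y))))"
    unfolding smooth_on_def
  proof (intro allI Ck_on_local)
    fix k y assume "y \<in> cmap c ` {x \<in> U \<inter> cdom c. g (f x) \<in> cdom d}"
    then obtain x where x: "y = cmap c x" "x \<in> U" "x \<in> cdom c" "g (f x) \<in> cdom d" by auto
    have fx: "f x \<in> points N" using smooth_map_on_point[OF f x(2)] by blast
    define e where "e = chart_at N (f x)"
    have e: "e \<in> charts N" "f x \<in> cdom e" using chart_at_props[OF N fx] by (auto simp: e_def)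
    have ise: "is_chart (mtop N) e" using manifold_is_chart[OF N e(1)] .
    define W where "W = {z \<in> V. g z \<in> cdom d} \<inter> cdom e"
    have "openin (mtop N) {z \<in> V. g z \<in> cdom d}"
      using smooth_map_on_preimage[OF g] isd by (simp add: is_chart_def)
    then have "openin (mtop N) W" using ise by (auto simp: W_def is_chart_def)
    then have "openin (mtop M) {x \<in> U. f x \<in> W}" using smooth_map_on_preimage[OF f] by blast
    then have "openin (mtop M) ({x \<in> U. f x \<in> W} \<inter> cdom c)" using isc by (auto simp: is_chart_def)
    then have op: "open (cmap c ` ({x \<in> U. f x \<in> W} \<inter> cdom c))" (is "open ?T")
      by (intro chart_image_open[OF isc]) auto
    have yT: "y \<in> ?T" using x fU e by (auto simp: W_def)
    have F: "Ck_on k ?T (\<lambda>y. cmap e (f (cinv c y)))"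
    proof (rule Ck_on_subset)
      show "Ck_on k (cmap c ` {x \<in> U \<inter> cdom c. f x \<in> cdom e}) (\<lambda>y. cmap e (f (cinv c y)))"
        using f c e by (simp add: smooth_map_on_def smooth_on_def)
    qed (auto simp: W_def)
    have G: "Ck_on k (cmap e ` {z \<in> V \<inter> cdom e. g z \<in> cdom d}) (\<lambda>y. cmap d (g (cinv e y)))"
      using g d e by (simp add: smooth_map_on_def smooth_on_def)
    have "Ck_on k ?T (\<lambda>y. cmap d (g (cinv e (cmap e (f (cinv c y))))))"
    proof (rule Ck_on_compose[OF manifold_finite_dim[OF N] op _ F G])
      show "(\<lambda>y. cmap e (f (cinv c y))) ` ?T \<subseteq> cmap e ` {z \<in> V \<inter> cdom e. g z \<in> cdom d}"
        by (auto simp: W_def cinv_cmap[OF isc])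
    qed
    moreover have eq: "cmap d (g (cinv e (cmap e (f (cinv c y))))) = cmap d (g (f (cinv c y)))" if "y \<in> ?T" for y
      using that by (auto simp: W_def cinv_cmap[OF isc] cinv_cmap[OF ise])
    ultimately have "Ck_on k ?T (\<lambda>y. cmap d (g (f (cinv c y))))"
      by (simp only: Ck_on_cong[OF op eq])
    then show "\<exists>T. open T \<and> y \<in> T \<and> Ck_on k T (\<lambda>y. cmap d (g (f (cinv c y))))"
      using op yT by blast
  qed
qed

lemma finite_dim_prod:
  assumes "\<exists>B::'a::real_vector set. finite B \<and> span B = UNIV"
    and "\<exists>B::'b::real_vector set. finite B \<and> span B = UNIV"
  shows "\<exists>B::('a \<times> 'b) set. finite B \<and> span B = UNIV"
proof -
  obtain B :: "'a set" where B: "finite B" "span B = UNIV" using assms(1) by (elim exE conjE)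
  obtain C :: "'b set" where C: "finite C" "span C = UNIV" using assms(2) by (elim exE conjE)
  let ?E = "(\<lambda>b. (b, 0)) ` B \<union> (\<lambda>c. (0, c)) ` C"
  have 1: "linear (\<lambda>b::'a. (b, 0::'b))" and 2: "linear (\<lambda>c::'b. (0::'a, c))"
    by (auto intro!: linearI)
  have "(v, w) \<in> span ?E" for v w
  proof -
    have "(v, 0) \<in> span ((\<lambda>b. (b, 0::'b)) ` B)"
      using B(2) by (simp add: linear_span_image[OF 1])
    moreover have "(0, w) \<in> span ((\<lambda>c. (0::'a, c)) ` C)"
      using C(2) by (simp add: linear_span_image[OF 2])
    ultimately have "(v, 0) + (0, w) \<in> span ?E"
      by (intro span_add) (auto intro: subsetD[OF span_mono])
    then show ?thesis by simp
  qed
  then show ?thesis using B C by (intro exI[of _ ?E]) auto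
qed

text \<open>In charts, fixing the second point is precomposition with the affine map \<open>y \<mapsto> (y, crd N q)\<close>.\<close>

lemma smooth_map_slice:
  assumes M: "manifold M" and N: "manifold N" and P: "manifold P"
    and F: "smooth_map (prod_mfd M N) P (\<lambda>(x, y). F x y)" and q: "q \<in> points N"
  shows "smooth_map M P (\<lambda>x. F x q)"
  unfolding smooth_map_on_def
proof (intro conjI ballI)
  show "openin (mtop M) (points M)" by simp
  have "mtop (prod_mfd M N) = prod_topology (mtop M) (mtop N)" by (simp add: prod_mfd_def)
  moreover have "continuous_map (subtopology (mtop (prod_mfd M N)) (points (prod_mfd M N))) (mtop P) (\<lambda>(x, y). F x y)"
    using F by (simp only: smooth_map_on_def)
  ultimately have contF: "continuous_map (prod_topology (mtop M) (mtop N)) (mtop P) (\<lambda>(x, y). F x y)"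
    by (simp only: subtopology_topspace)
  have contq: "continuous_map (mtop M) (prod_topology (mtop M) (mtop N)) (\<lambda>x. (x, q))"
    using q by (simp add: continuous_map_pairwise comp_def)
  have cont: "continuous_map (mtop M) (mtop P) (\<lambda>x. F x q)"
    using continuous_map_compose[OF contq contF] by (simp add: comp_def)
  then show "continuous_map (subtopology (mtop M) (points M)) (mtop P) (\<lambda>x. F x q)" by simp
  fix c d assume c: "c \<in> charts M" and d: "d \<in> charts P"
  have isc: "is_chart (mtop M) c" and isd: "is_chart (mtop P) d" using manifold_is_chart[OF M c] manifold_is_chart[OF P d] by auto
  define e where "e = chart_at N q"
  have e: "e \<in> charts N" "q \<in> cdom e" using chart_at_props[OF N q] by (auto simp: e_def)
  have ise: "is_chart (mtop N) e" using manifold_is_chart[OF N e(1)] .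
  let ?ce = "(cdom c \<times> cdom e, map_prod (cmap c) (cmap e))"
  let ?T = "cmap c ` {x \<in> points M \<inter> cdom c. F x q \<in> cdom d}"
  have "openin (mtop M) {x \<in> points M. F x q \<in> cdom d}"
    using openin_continuous_map_preimage[OF cont] isd by (auto simp: is_chart_def)
  then have "openin (mtop M) ({x \<in> points M. F x q \<in> cdom d} \<inter> cdom c)" using isc by (auto simp: is_chart_def)
  then have "open (cmap c ` ({x \<in> points M. F x q \<in> cdom d} \<inter> cdom c))"
    by (intro chart_image_open[OF isc]) auto
  moreover have "{x \<in> points M. F x q \<in> cdom d} \<inter> cdom c = {x \<in> points M \<inter> cdom c. F x q \<in> cdom d}" by auto
  ultimately have op: "open ?T" by simp
  show "smooth_on ?T (\<lambda>y. cmap d (F (cinv c y) q))"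
    unfolding smooth_on_def
  proof
    fix k
    have ce: "?ce \<in> charts (prod_mfd M N)" by (rule product_chart[OF c e(1)])
    let ?S = "cmap ?ce ` {z \<in> points (prod_mfd M N) \<inter> cdom ?ce. (\<lambda>(x, y). F x y) z \<in> cdom d}"
    have G: "Ck_on k ?S (\<lambda>y. cmap d ((\<lambda>(x, y). F x y) (cinv ?ce y)))"
      by (rule smooth_map_on_in_charts[OF F ce d, unfolded smooth_on_def, rule_format])
    have bl: "bounded_linear (\<lambda>y::'b. (y, 0::'d))"
      by (rule bounded_linear_Pair[OF bounded_linear_ident bounded_linear_zero])
    have "Ck_on k ?T (\<lambda>y. y)" by (cases k) (auto simp: Ck_on_const continuous_on_id)
    from Ck_on_add[OF op Ck_on_bounded_linear[OF bl op this] Ck_on_const]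
    have "Ck_on k ?T (\<lambda>y. (y, 0::'d) + (0, cmap e q))" .
    then have H: "Ck_on k ?T (\<lambda>y. (y, cmap e q))" by simp
    have A: "Ck_on k ?T (\<lambda>y. cmap d ((\<lambda>(x, y). F x y) (cinv ?ce (y, cmap e q))))"
    proof (rule Ck_on_compose[OF _ op _ H G])
      show "\<exists>B::('b \<times> 'd) set. finite B \<and> span B = UNIV"
        by (rule finite_dim_prod[OF manifold_finite_dim[OF M] manifold_finite_dim[OF N]])
      show "(\<lambda>y. (y, cmap e q)) ` ?T \<subseteq> ?S"
      proof (rule image_subsetI)
        fix z assume "z \<in> ?T"
        then obtain x where x: "z = cmap c x" "x \<in> points M" "x \<in> cdom c" "F x q \<in> cdom d"
          by (elim imageE) simp
        show "(z, cmap e q) \<in> ?S"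
          by (rule image_eqI[where x="(x, q)"]) (use x e q in \<open>simp_all add: prod_mfd_def\<close>)
      qed
    qed
    have eq: "cmap d ((\<lambda>(x, y). F x y) (cinv ?ce (y, cmap e q))) = cmap d (F (cinv c y) q)" if y: "y \<in> ?T" for y
    proof -
      obtain x where x: "y = cmap c x" "x \<in> cdom c" using y by (elim imageE) simp
      show ?thesis
        unfolding x(1) is_chart_product_inverse[OF isc ise x(2) e(2)] cinv_cmap[OF isc x(2)] by simp
    qed
    from iffD1[OF Ck_on_cong[OF op eq] A] show "Ck_on k ?T (\<lambda>y. cmap d (F (cinv c y) q))" .
  qed
qed


section \<open>Variations of discrete curves\<close>

lemma D1_eq: "manifold M \<Longrightarrow> has_tmap2 M M real_mfd (\<lambda>x y. f (x, y)) x y A \<Longrightarrow> D1 M f x y = (\<lambda>v. A (v, 0))"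
  unfolding D1_def by (rule tmap_eq[OF _ has_tmap2_slice1])

lemma D2_eq: "manifold M \<Longrightarrow> has_tmap2 M M real_mfd (\<lambda>x y. f (x, y)) x y A \<Longrightarrow> D2 M f x y = (\<lambda>v. A (0, v))"
  unfolding D2_def by (rule tmap_eq[OF _ has_tmap2_slice2])

lemma curve_diff_action:
  assumes M: "manifold M" and q: "\<And>k. k \<le> N \<Longrightarrow> q k \<in> points M"
    and A: "\<And>k. k < N \<Longrightarrow> has_tmap2 M M real_mfd (\<lambda>x y. f (x, y)) (q k) (q (Suc k)) (A k)"
  shows "curve_diff M (discrete_action N f) q \<delta> = (\<Sum>k<N. A k (\<delta> k, \<delta> (Suc k)))"
proof -
  define c where "c k t = par M (q k) (crd M (q k) + t *\<^sub>R \<delta> k)" for k t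
  have c0: "c k 0 = q k" if "k \<le> N" for k
    using par_crd[OF M q[OF that]] by (simp add: c_def)
  have cd: "has_deriv_into M (c k) 0 (\<lambda>t. t *\<^sub>R \<delta> k)" if "k \<le> N" for k
  proof -
    have u: "((\<lambda>t. crd M (q k) + t *\<^sub>R \<delta> k) has_derivative (\<lambda>t. t *\<^sub>R \<delta> k)) (at 0)"
      by (auto intro!: derivative_eq_intros)
    have "has_deriv_into M (\<lambda>t. par M (q k) (crd M (q k) + t *\<^sub>R \<delta> k)) 0 (\<lambda>t. t *\<^sub>R \<delta> k)"
      by (rule has_deriv_into_precompose[OF _ u]) (simp add: has_deriv_into_par[OF M q[OF that]])
    then show ?thesis by (simp add: c_def[abs_def])
  qed
  have term_deriv: "((\<lambda>t. f (c k t, c (Suc k) t)) has_derivative (\<lambda>t. t * A k (\<delta> k, \<delta> (Suc k)))) (at 0)"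
    if k: "k < N" for k
  proof -
    have "has_deriv_into real_mfd (\<lambda>t. f (c k t, c (Suc k) t)) 0
        (\<lambda>t. A k (t *\<^sub>R \<delta> k, t *\<^sub>R \<delta> (Suc k)))"
      by (rule has_deriv_into_chain2[OF M M cd cd]) (use k A[OF k] c0[of k] c0[of "Suc k"] in simp_all)
    moreover have "A k (t *\<^sub>R \<delta> k, t *\<^sub>R \<delta> (Suc k)) = t * A k (\<delta> k, \<delta> (Suc k))" for t
      using linear_scale[OF has_tmap2_linear[OF A[OF k]], of t "(\<delta> k, \<delta> (Suc k))"] by simp
    ultimately show ?thesis by (simp add: has_deriv_into_real)
  qed
  have "((\<lambda>t. \<Sum>k<N. f (c k t, c (Suc k) t)) has_derivative (\<lambda>t. \<Sum>k<N. t * A k (\<delta> k, \<delta> (Suc k)))) (at 0)"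
    by (rule has_derivative_sum) (rule term_deriv, simp)
  moreover have "(\<lambda>t. \<Sum>k<N. t * A k (\<delta> k, \<delta> (Suc k))) = (*) (\<Sum>k<N. A k (\<delta> k, \<delta> (Suc k)))"
    by (rule ext) (simp add: sum_distrib_left[symmetric] mult.commute)
  ultimately have "((\<lambda>t. \<Sum>k<N. f (c k t, c (Suc k) t)) has_field_derivative (\<Sum>k<N. A k (\<delta> k, \<delta> (Suc k)))) (at 0)"
    by (simp add: has_field_derivative_def)
  from DERIV_imp_deriv[OF this] show ?thesis
    by (simp add: curve_diff_def discrete_action_def c_def)
qed

lemma sum_by_parts_vanishing_ends:
  fixes a b :: "nat \<Rightarrow> real"
  assumes "a 0 = 0" "b N = 0"
  shows "(\<Sum>k<N. a k + b (Suc k)) = (\<Sum>k = 1..N - 1. a k + b k)"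
proof (cases N)
  case (Suc n)
  have "(\<Sum>k<N. a k) = (\<Sum>k = 1..n. a k)"
    by (simp add: Suc sum.lessThan_Suc_shift assms(1) sum.atLeast1_atMost_eq del: sum.lessThan_Suc)
  moreover have "(\<Sum>k<N. b (Suc k)) = (\<Sum>k = 1..n. b k)"
    using assms(2) by (simp add: Suc sum.atLeast1_atMost_eq)
  ultimately show ?thesis by (simp add: sum.distrib Suc)
qed simp

text \<open>Summation by parts moves the differential of the action to the inner vertices, where it pairs
\<open>\<delta> k\<close> with \<open>D\<^sub>1f(q\<^sub>k, q\<^sub>k\<^sub>+\<^sub>1) + D\<^sub>2f(q\<^sub>k\<^sub>-\<^sub>1, q\<^sub>k)\<close>.  The external force \<open>\<Phi>\<close> allows the same lemma to be used
for the unreduced (\<open>\<Phi> = 0\<close>) and for the reduced system.\<close>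

lemma variational_iff_pointwise:
  fixes M :: "('a, 'e::banach) mfd" and \<Phi> :: "nat \<Rightarrow> 'e \<Rightarrow> real"
  assumes M: "manifold M" and q: "\<And>k. k \<le> N \<Longrightarrow> q k \<in> points M"
    and f: "\<And>k. k < N \<Longrightarrow> \<exists>A. has_tmap2 M M real_mfd (\<lambda>x y. f (x, y)) (q k) (q (Suc k)) A"
    and zero: "\<And>k. k \<le> N \<Longrightarrow> 0 \<in> D (q k)"
    and \<Phi>0: "\<And>k. 1 \<le> k \<Longrightarrow> k \<le> N - 1 \<Longrightarrow> \<Phi> k 0 = 0"
  shows "(\<forall>\<delta> \<in> variations_in D N q.
            curve_diff M (discrete_action N f) q \<delta> = - (\<Sum>k = 1..N - 1. \<Phi> k (\<delta> k))) \<longleftrightarrow>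
         (\<forall>k. 1 \<le> k \<and> k \<le> N - 1 \<longrightarrow>
            annihilates (\<lambda>v. D1 M f (q k) (q (k + 1)) v + D2 M f (q (k - 1)) (q k) v + \<Phi> k v) (D (q k)))"
    (is "?L \<longleftrightarrow> ?R")
proof -
  obtain A where A: "\<And>k. k < N \<Longrightarrow> has_tmap2 M M real_mfd (\<lambda>x y. f (x, y)) (q k) (q (Suc k)) (A k)"
    using f by metis
  define E where "E k v = D1 M f (q k) (q (k + 1)) v + D2 M f (q (k - 1)) (q k) v + \<Phi> k v" for k v
  have A0: "A k (0, 0) = 0" if "k < N" for k
    using linear_0[OF has_tmap2_linear[OF A[OF that]]] by (simp add: zero_prod_def)
  have key: "curve_diff M (discrete_action N f) q \<delta> + (\<Sum>k = 1..N - 1. \<Phi> k (\<delta> k)) = (\<Sum>k = 1..N - 1. E k (\<delta> k))"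
    if "\<delta> 0 = 0" "\<delta> N = 0" for \<delta>
  proof -
    define a where "a k = (if k < N then A k (\<delta> k, 0) else 0)" for k
    define b where "b k = (if k \<ge> 1 \<and> k \<le> N then A (k - 1) (0, \<delta> k) else 0)" for k
    have "curve_diff M (discrete_action N f) q \<delta> = (\<Sum>k<N. A k (\<delta> k, \<delta> (Suc k)))"
      by (rule curve_diff_action[OF M, where q=q and A=A, OF q A])
    also have "\<dots> = (\<Sum>k<N. a k + b (Suc k))"
    proof (rule sum.cong)
      fix k assume "k \<in> {..<N}"
      then show "A k (\<delta> k, \<delta> (Suc k)) = a k + b (Suc k)"
        using has_tmap2_split[OF A, of k "\<delta> k" "\<delta> (Suc k)"] by (simp add: a_def b_def)
    qed simp
    also have "\<dots> = (\<Sum>k = 1..N - 1. a k + b k)"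
    proof (rule sum_by_parts_vanishing_ends)
      show "a 0 = 0" using A0[of 0] that by (simp add: a_def)
      show "b N = 0" using A0[of "N - 1"] that by (simp add: b_def)
    qed
    finally have "curve_diff M (discrete_action N f) q \<delta> + (\<Sum>k = 1..N - 1. \<Phi> k (\<delta> k))
        = (\<Sum>k = 1..N - 1. a k + b k + \<Phi> k (\<delta> k))" by (simp add: sum.distrib)
    also have "\<dots> = (\<Sum>k = 1..N - 1. E k (\<delta> k))"
    proof (rule sum.cong)
      fix k assume "k \<in> {1..N - 1}"
      then have k: "k < N" "k - 1 < N" "k \<ge> 1" by auto
      then show "a k + b k + \<Phi> k (\<delta> k) = E k (\<delta> k)"
        using D1_eq[OF M A[OF k(1)]] D2_eq[OF M A[OF k(2)]] by (simp add: a_def b_def E_def)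
    qed simp
    finally show ?thesis .
  qed
  show ?thesis
  proof
    assume L: ?L
    show ?R
    proof (intro allI impI)
      fix j assume j: "1 \<le> j \<and> j \<le> N - 1"
      have jN: "j \<noteq> 0" "j \<noteq> N" "j \<le> N" using j by auto
      have "E j v = 0" if v: "v \<in> D (q j)" for v
      proof -
        \<comment> \<open>vary only the vertex \<open>j\<close>\<close>
        define \<delta> where "\<delta> k = (if k = j then v else 0)" for k
        have \<delta>: "\<delta> 0 = 0" "\<delta> N = 0" using jN by (auto simp: \<delta>_def)
        moreover have "\<delta> k \<in> D (q k)" if "k \<le> N" for k
          using zero[OF that] v by (simp add: \<delta>_def)
        ultimately have "\<delta> \<in> variations_in D N q" by (simp add: variations_in_def)
        then have "(\<Sum>k = 1..N - 1. E k (\<delta> k)) = 0"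
          using L key[OF \<delta>] by simp
        moreover have "E k (\<delta> k) = (if k = j then E j v else 0)" if k: "k \<in> {1..N - 1}" for k
        proof (cases "k = j")
          case False
          have kN: "k < N" "k - 1 < N" "1 \<le> k" "k \<le> N - 1" using k by auto
          have "E k 0 = 0"
            using A0[OF kN(1)] A0[OF kN(2)] \<Phi>0[OF kN(3,4)] D1_eq[OF M A[OF kN(1)]] D2_eq[OF M A[OF kN(2)]] kN
            by (simp add: E_def)
          then show ?thesis using False by (simp add: \<delta>_def)
        qed (simp add: \<delta>_def)
        ultimately have "(\<Sum>k = 1..N - 1. if k = j then E j v else 0) = 0" by simp
        then show ?thesis using j by (simp add: sum.delta')
      qed
      then show "annihilates (\<lambda>v. D1 M f (q j) (q (j + 1)) v + D2 M f (q (j - 1)) (q j) v + \<Phi> j v) (D (q j))"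
        by (simp add: annihilates_def E_def)
    qed
  next
    assume R: ?R
    show ?L
    proof
      fix \<delta> assume \<delta>: "\<delta> \<in> variations_in D N q"
      have "E k (\<delta> k) = 0" if "k \<in> {1..N - 1}" for k
      proof -
        have "annihilates (E k) (D (q k))" using R that unfolding E_def by simp
        moreover have "\<delta> k \<in> D (q k)" using \<delta> that by (auto simp: variations_in_def)
        ultimately show ?thesis by (simp add: annihilates_def)
      qed
      then have "(\<Sum>k = 1..N - 1. E k (\<delta> k)) = 0" by simp
      with key[of \<delta>] \<delta> show "curve_diff M (discrete_action N f) q \<delta> = - (\<Sum>k = 1..N - 1. \<Phi> k (\<delta> k))"
        by (simp add: variations_in_def)
    qed
  qed
qed

section \<open>Derivatives descend along submersions\<close>

lemma strict_derivative_in_charts: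
  assumes Q: "manifold Q" and B: "manifold B" and \<pi>: "smooth_map Q B \<pi>" and p: "p \<in> points Q"
  shows "has_strict_derivative (\<lambda>z. cmap (chart_at B (\<pi> p)) (\<pi> (par Q p z))) (tmap Q B \<pi> p) (crd Q p)"
proof -
  let ?c = "chart_at Q p" and ?d = "chart_at B (\<pi> p)"
  let ?S = "cmap ?c ` {x \<in> points Q \<inter> cdom ?c. \<pi> x \<in> cdom ?d}"
  have \<pi>p: "\<pi> p \<in> points B" using smooth_map_on_point[OF \<pi> p] by simp
  have isc: "is_chart (mtop Q) ?c" and isd: "is_chart (mtop B) ?d"
    using is_chart_at[OF Q p] is_chart_at[OF B \<pi>p] by auto
  have "smooth_on ?S (\<lambda>z. cmap ?d (\<pi> (par Q p z)))"
    by (rule smooth_map_on_in_charts[OF \<pi> chart_at_props(1)[OF Q p] chart_at_props(1)[OF B \<pi>p]])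
  then have C1: "Ck_on (Suc 0) ?S (\<lambda>z. cmap ?d (\<pi> (par Q p z)))" unfolding smooth_on_def by (rule spec)
  have "openin (mtop Q) {x \<in> points Q. \<pi> x \<in> cdom ?d}"
    by (rule smooth_map_on_preimage[OF \<pi>]) (use isd in \<open>simp add: is_chart_def\<close>)
  then have "openin (mtop Q) ({x \<in> points Q. \<pi> x \<in> cdom ?d} \<inter> cdom ?c)"
    using isc by (intro openin_Int) (simp_all add: is_chart_def)
  moreover have "{x \<in> points Q. \<pi> x \<in> cdom ?d} \<inter> cdom ?c = {x \<in> points Q \<inter> cdom ?c. \<pi> x \<in> cdom ?d}" by auto
  ultimately have "openin (mtop Q) {x \<in> points Q \<inter> cdom ?c. \<pi> x \<in> cdom ?d}" by (simp only:)
  then have op: "open ?S" by (rule chart_image_open[OF isc]) auto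
  have mem: "crd Q p \<in> ?S"
    using p chart_at_props(2)[OF Q p] chart_at_props(2)[OF B \<pi>p] by simp
  show ?thesis
    using C1_imp_strict_derivative[OF manifold_finite_dim[OF Q] C1 op mem] by (simp add: tmap_def)
qed

lemma surjective_right_inverse:
  fixes A :: "'a::real_normed_vector \<Rightarrow> 'b::real_normed_vector"
  assumes fin: "\<exists>B::'b set. finite B \<and> span B = UNIV" and A: "linear A" "surj A"
  obtains R where "bounded_linear R" "\<And>v. A (R v) = v"
proof -
  obtain R where R: "linear R" "A \<circ> R = id"
    using linear_surjective_right_inverse[OF A] by blast
  show thesis
  proof (rule that)
    show "bounded_linear R" by (rule linear_imp_bounded_linear[OF fin R(1)])
    show "A (R v) = v" for v using fun_cong[OF R(2), of v] by simp
  qed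
qed

lemma eventually_par_submersion:
  assumes Q: "manifold Q" and B: "manifold B" and \<pi>: "smooth_map Q B \<pi>" and p: "p \<in> points Q"
  shows "\<forall>\<^sub>F z in nhds (crd Q p). par B (\<pi> p) (cmap (chart_at B (\<pi> p)) (\<pi> (par Q p z))) = \<pi> (par Q p z)"
proof -
  obtain A where "has_tmap Q B \<pi> p A" using smooth_imp_has_tmap[OF Q B \<pi> p] by blast
  then have "has_deriv_into B (\<lambda>z. \<pi> (par Q p z)) (crd Q p) A" by (simp add: has_tmap_def)
  from eventually_par_cmap[OF B this] show ?thesis by (simp add: par_crd[OF Q p])
qed

text \<open>By descent \<open>f\<close> itself is differentiable, so \<open>F\<close> is the composite of its derivative with \<open>d\<pi>\<close>.  In
  the application \<open>f\<close> is a local section of \<open>\<pi>\<close>, read in a chart of \<open>Q\<close>.\<close>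

lemma submersion_descent:
  fixes f :: "'b \<Rightarrow> 'c::real_normed_vector"
  assumes Q: "manifold Q" and B: "manifold B" and \<pi>: "smooth_map Q B \<pi>" and p: "p \<in> points Q"
    and surj: "surj (tmap Q B \<pi> p)"
    and f: "((\<lambda>z. f (\<pi> (par Q p z))) has_derivative F) (at (crd Q p))"
    and v: "tmap Q B \<pi> p v = 0"
  shows "F v = 0"
proof -
  let ?A = "tmap Q B \<pi> p" and ?P = "\<lambda>z. cmap (chart_at B (\<pi> p)) (\<pi> (par Q p z))"
  have P: "has_strict_derivative ?P ?A (crd Q p)" by (rule strict_derivative_in_charts[OF Q B \<pi> p])
  have tA: "has_tmap Q B \<pi> p ?A"
    using smooth_imp_has_tmap[OF Q B \<pi> p] tmap_eq[OF Q] by metis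
  obtain R where R: "bounded_linear R" "\<And>v. ?A (R v) = v"
    using surjective_right_inverse[OF manifold_finite_dim[OF B] has_tmap_linear[OF tA] surj] by blast
  have "\<forall>\<^sub>F z in nhds (crd Q p). f (\<pi> (par Q p z)) = f (par B (\<pi> p) (?P z))"
    using eventually_par_submersion[OF Q B \<pi> p] by (rule eventually_mono) simp
  from has_derivative_cong_nhds[OF this] f
  have fP: "((\<lambda>z. f (par B (\<pi> p) (?P z))) has_derivative F) (at (crd Q p))" by blast
  have d: "((\<lambda>y. f (par B (\<pi> p) y)) has_derivative (\<lambda>v. F (R v))) (at (?P (crd Q p)))"
    by (rule descent_has_derivative[OF P R fP])
  have PA: "(?P has_derivative ?A) (at (crd Q p))"
    using tA unfolding has_tmap_def has_deriv_into_def par_crd[OF Q p] by blast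
  have "F = (\<lambda>v. F (R (?A v)))"
    using has_derivative_unique[OF fP diff_chain_at[OF PA d, unfolded comp_def]] .
  from fun_cong[OF this, of v] v show ?thesis
    using linear_0[OF bounded_linear.linear[OF R(1)]] linear_0[OF has_derivative_linear[OF f]] by simp
qed

text \<open>The product of two strictly differentiable submersions is again one, so \<open>descent_has_derivative\<close>
applies to a function of two points of the base.\<close>

lemma submersion_descent2:
  assumes Q: "manifold Q" and B: "manifold B" and \<pi>: "smooth_map Q B \<pi>"
    and p: "p \<in> points Q" "surj (tmap Q B \<pi> p)" and q: "q \<in> points Q" "surj (tmap Q B \<pi> q)"
    and f: "has_tmap2 Q Q real_mfd (\<lambda>x y. f (\<pi> x) (\<pi> y)) p q F"
  shows "\<exists>F'. has_tmap2 B B real_mfd f (\<pi> p) (\<pi> q) F'"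
proof -
  let ?A = "\<lambda>p. tmap Q B \<pi> p" and ?P = "\<lambda>p z. cmap (chart_at B (\<pi> p)) (\<pi> (par Q p z))"
  have tA: "has_tmap Q B \<pi> x (?A x)" if "x \<in> points Q" for x
    using smooth_imp_has_tmap[OF Q B \<pi> that] tmap_eq[OF Q] by metis
  obtain R where R: "bounded_linear R" "\<And>v. ?A p (R v) = v"
    using surjective_right_inverse[OF manifold_finite_dim[OF B] has_tmap_linear[OF tA[OF p(1)]] p(2)] by blast
  obtain R' where R': "bounded_linear R'" "\<And>v. ?A q (R' v) = v"
    using surjective_right_inverse[OF manifold_finite_dim[OF B] has_tmap_linear[OF tA[OF q(1)]] q(2)] by blast
  have P: "has_strict_derivative (map_prod (?P p) (?P q)) (map_prod (?A p) (?A q)) (crd Q p, crd Q q)"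
    by (rule has_strict_derivative_map_prod[OF strict_derivative_in_charts[OF Q B \<pi> p(1)]
        strict_derivative_in_charts[OF Q B \<pi> q(1)]])
  have RR: "bounded_linear (\<lambda>v. (R (fst v), R' (snd v)))"
    by (rule bounded_linear_Pair[OF bounded_linear_compose[OF R(1) bounded_linear_fst]
        bounded_linear_compose[OF R'(1) bounded_linear_snd]])
  let ?g = "\<lambda>z. f (par B (\<pi> p) (fst z)) (par B (\<pi> q) (snd z))"
  have pq: "\<pi> p \<in> points B" "\<pi> q \<in> points B" using smooth_map_on_point[OF \<pi>] p q by auto
  have f': "((\<lambda>z. f (\<pi> (par Q p (fst z))) (\<pi> (par Q q (snd z)))) has_derivative F) (at (crd Q p, crd Q q))"
    using f by (simp add: has_tmap2_def has_deriv_into_real)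
  have 1: "\<forall>\<^sub>F z in nhds (crd Q p, crd Q q). par B (\<pi> p) (?P p (fst z)) = \<pi> (par Q p (fst z))"
    by (rule eventually_compose_filterlim[OF eventually_par_submersion[OF Q B \<pi> p(1)]])
       (use isCont_imp_filterlim_nhds[where f=fst and x="(crd Q p, crd Q q)"] in simp)
  have 2: "\<forall>\<^sub>F z in nhds (crd Q p, crd Q q). par B (\<pi> q) (?P q (snd z)) = \<pi> (par Q q (snd z))"
    by (rule eventually_compose_filterlim[OF eventually_par_submersion[OF Q B \<pi> q(1)]])
       (use isCont_imp_filterlim_nhds[where f=snd and x="(crd Q p, crd Q q)"] in simp)
  have "\<forall>\<^sub>F z in nhds (crd Q p, crd Q q). f (\<pi> (par Q p (fst z))) (\<pi> (par Q q (snd z))) = ?g (map_prod (?P p) (?P q) z)"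
    using 1 2 by eventually_elim (simp add: map_prod_def split_def)
  from has_derivative_cong_nhds[OF this] f'
  have gP: "((\<lambda>z. ?g (map_prod (?P p) (?P q) z)) has_derivative F) (at (crd Q p, crd Q q))" by blast
  have "(?g has_derivative (\<lambda>v. F (R (fst v), R' (snd v)))) (at (map_prod (?P p) (?P q) (crd Q p, crd Q q)))"
    by (rule descent_has_derivative[OF P RR _ gP]) (simp add: map_prod_def split_def R(2) R'(2))
  then have "(?g has_derivative (\<lambda>v. F (R (fst v), R' (snd v)))) (at (crd B (\<pi> p), crd B (\<pi> q)))"
    by (simp add: par_crd[OF Q p(1)] par_crd[OF Q q(1)])
  then show ?thesis using pq by (auto simp: has_tmap2_def has_deriv_into_real)
qed


lemma direct_sumD:
  assumes "direct_sum A B C"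
  shows "subspace A" "subspace B" "A \<inter> B = {0}" "{a + b | a b. a \<in> A \<and> b \<in> B} = C"
  using assms by (simp_all add: direct_sum_def)

section \<open>The group action and the momentum level\<close>

locale reduced_system =
  fixes R :: "('q, 'e::banach, 'g, 'k::banach, 'b::banach) reduction"
    and M :: "('g, 'm::banach) lie_grp"
  assumes system: "nonholonomic_system R"
    and exponential: "exponential_map (grp R) (expo R)"
    and good: "mu_good M R"
    and Ad_invariant: "\<forall>g\<in>carrier (grp R). mom R \<circ> Ad (grp R) g = mom R"
    and quotient: "quotient_manifold (grp R) (cfg R) (act R) (qmf R)"
    and splitting: "adapted_splitting R"
    and connection: "connection_domains R"
begin

abbreviation "Q \<equiv> cfg R"
abbreviation "G \<equiv> grp R"
abbreviation "GM \<equiv> gmfd (grp R)"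
abbreviation "B \<equiv> qmf R"
abbreviation "L \<equiv> Ld R"
abbreviation "\<pi> \<equiv> proj R"
abbreviation "a \<equiv> act R"
abbreviation "e \<equiv> \<one>\<^bsub>grp R\<^esub>"

lemma horizontal: "horizontal_symmetry_group R M G a"
  using good by (simp add: mu_good_def)

lemma symM: "symmetry_group R M a" and subM: "closed_lie_subgroup G M"
  using horizontal by (simp_all add: horizontal_symmetry_group_def)

lemma liegroups: "lie_group G" "lie_group M"
  using symM subM by (simp_all add: symmetry_group_def closed_lie_subgroup_def)

lemma groups: "group G" "group M"
  using liegroups by (simp_all add: lie_group_def)

lemma manifolds: "manifold Q" "manifold GM" "manifold (gmfd M)" "manifold B"
  using system liegroups quotient
  by (simp_all add: nonholonomic_system_def lie_group_def quotient_manifold_def)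

lemmas mQ = manifolds(1) and mG = manifolds(2) and mM = manifolds(3) and mB = manifolds(4)

lemma pointsG: "points GM = carrier G" and pointsM: "points (gmfd M) = carrier M"
  using liegroups by (simp_all add: lie_group_def)

lemma carrier_sub: "g \<in> carrier G \<Longrightarrow> g \<in> carrier M"
  using subM by (auto simp: closed_lie_subgroup_def dest: subgroup.mem_carrier)

lemma mult_same: "x \<otimes>\<^bsub>G\<^esub> y = x \<otimes>\<^bsub>M\<^esub> y" and one_same: "e = \<one>\<^bsub>M\<^esub>"
  using subM by (simp_all add: closed_lie_subgroup_def)

lemma action_M: "group_action M (points Q) a"
  using symM by (simp add: symmetry_group_def smooth_action_def)

lemma G_closed [simp]:
  "e \<in> carrier G"
  "g \<in> carrier G \<Longrightarrow> h \<in> carrier G \<Longrightarrow> g \<otimes>\<^bsub>G\<^esub> h \<in> carrier G"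
  "g \<in> carrier G \<Longrightarrow> inv\<^bsub>G\<^esub> g \<in> carrier G"
proof -
  interpret group G by (rule groups)
  show "e \<in> carrier G" by simp
  show "g \<in> carrier G \<Longrightarrow> h \<in> carrier G \<Longrightarrow> g \<otimes>\<^bsub>G\<^esub> h \<in> carrier G" by simp
  show "g \<in> carrier G \<Longrightarrow> inv\<^bsub>G\<^esub> g \<in> carrier G" by simp
qed

lemma act_closed [simp]: "g \<in> carrier G \<Longrightarrow> q \<in> points Q \<Longrightarrow> a g q \<in> points Q"
  by (rule group_action.element_image[OF action_M carrier_sub _ refl])

lemma act_mult: "g \<in> carrier G \<Longrightarrow> h \<in> carrier G \<Longrightarrow> q \<in> points Q \<Longrightarrow> a (g \<otimes>\<^bsub>G\<^esub> h) q = a g (a h q)"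
  unfolding mult_same by (rule group_action.composition_rule[OF action_M _ carrier_sub carrier_sub])

lemma act_one [simp]: "q \<in> points Q \<Longrightarrow> a e q = q"
  unfolding one_same using fun_cong[OF group_action.id_eq_one[OF action_M], of q] by simp

lemma act_inv [simp]:
  assumes "g \<in> carrier G" "q \<in> points Q"
  shows "a (inv\<^bsub>G\<^esub> g) (a g q) = q" "a g (a (inv\<^bsub>G\<^esub> g) q) = q"
proof -
  interpret group G by (rule groups)
  show "a (inv\<^bsub>G\<^esub> g) (a g q) = q" using assms act_mult[of "inv\<^bsub>G\<^esub> g" g q] by simp
  show "a g (a (inv\<^bsub>G\<^esub> g) q) = q" using assms act_mult[of g "inv\<^bsub>G\<^esub> g" q] by simp
qed

lemma proj_iff: "y \<in> \<pi> q \<longleftrightarrow> (\<exists>g\<in>carrier G. y = a g q)"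
  unfolding proj_def orbit_def by blast

lemma proj_refl: "q \<in> points Q \<Longrightarrow> q \<in> \<pi> q"
  unfolding proj_iff by (rule bexI[of _ e]) simp_all

lemma proj_act [simp]:
  assumes "g \<in> carrier G" "q \<in> points Q"
  shows "\<pi> (a g q) = \<pi> q"
proof -
  have "y \<in> \<pi> (a g q) \<longleftrightarrow> y \<in> \<pi> q" for y
  proof
    assume "y \<in> \<pi> (a g q)"
    then obtain h where h: "h \<in> carrier G" "y = a h (a g q)" unfolding proj_iff by blast
    then show "y \<in> \<pi> q" unfolding proj_iff using assms act_mult[of h g q] by (intro bexI[of _ "h \<otimes>\<^bsub>G\<^esub> g"]) simp_all
  next
    assume "y \<in> \<pi> q"
    then obtain h where h: "h \<in> carrier G" "y = a h q" unfolding proj_iff by blast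
    then have "y = a (h \<otimes>\<^bsub>G\<^esub> inv\<^bsub>G\<^esub> g) (a g q)"
      using assms act_mult[of h "inv\<^bsub>G\<^esub> g" "a g q"] by simp
    then show "y \<in> \<pi> (a g q)" unfolding proj_iff using h assms by (intro bexI[of _ "h \<otimes>\<^bsub>G\<^esub> inv\<^bsub>G\<^esub> g"]) simp_all
  qed
  then show ?thesis by blast
qed

lemma proj_eqD:
  assumes "\<pi> x = \<pi> y" "x \<in> points Q"
  obtains g where "g \<in> carrier G" "x = a g y"
proof -
  have "x \<in> \<pi> y" using proj_refl[OF assms(2)] assms(1) by simp
  then show thesis using that unfolding proj_iff by blast
qed

lemma pi_eq_orbit: "\<pi> = orbit G a"
  by (rule ext) (simp add: proj_def)

lemma proj_smooth: "smooth_map Q B \<pi>" and proj_surj: "q \<in> points Q \<Longrightarrow> surj (tmap Q B \<pi> q)"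
  using quotient unfolding pi_eq_orbit quotient_manifold_def by simp_all

abbreviation "d\<pi> q \<equiv> tmap Q B \<pi> q"

lemma proj_tmap: "q \<in> points Q \<Longrightarrow> has_tmap Q B \<pi> q (d\<pi> q)"
  using smooth_imp_has_tmap[OF mQ mB proj_smooth] has_tmap_tmap[OF mQ] by blast

subsection \<open>Derivatives of the action\<close>

lemma inclusion_smooth: "smooth_map GM (gmfd M) (\<lambda>g. g)"
  using subM unfolding closed_lie_subgroup_def by (elim conjE)

lemma act_smooth: "smooth_map (prod_mfd (gmfd M) Q) Q (\<lambda>(g, q). a g q)"
  using symM by (simp add: symmetry_group_def smooth_action_def)

lemma act_tmap2:
  assumes g: "g \<in> carrier G" and q: "q \<in> points Q"
  shows "\<exists>A. has_tmap2 GM Q Q a g q A"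
proof -
  have "(g, q) \<in> points (prod_mfd (gmfd M) Q)"
    using carrier_sub[OF g] q by (simp add: prod_mfd_def pointsM)
  then obtain A where A: "has_tmap2 (gmfd M) Q Q a g q A"
    using smooth_imp_has_tmap2[OF mM mQ mQ act_smooth] by blast
  obtain I where I: "has_tmap GM (gmfd M) (\<lambda>g. g) g I"
    using smooth_imp_has_tmap[OF mG mM inclusion_smooth] g pointsG by blast
  have "g \<in> points GM" using g pointsG by simp
  from has_tmap2_compose[OF mG mQ mM mQ
      has_tmap2_after[OF mG mQ mG has_tmap2_fst[OF mG this q] I]
      has_tmap2_snd[OF mQ this q] A]
  show ?thesis by blast
qed

abbreviation "da g q \<equiv> tmap Q Q (a g) q"

text \<open>The value at \<open>\<xi>\<close> is the infinitesimal generator \<open>\<xi>\<^sub>Q(q)\<close>.\<close>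

definition infinitesimal :: "'q \<Rightarrow> 'k \<Rightarrow> 'e" where
  "infinitesimal q = tmap GM Q (\<lambda>g. a g q) e"

lemma act_tmap:
  assumes "g \<in> carrier G" "q \<in> points Q"
  shows "has_tmap Q Q (a g) q (da g q)"
proof -
  obtain A where "has_tmap2 GM Q Q a g q A" using act_tmap2[OF assms] by blast
  from has_tmap_tmap[OF mQ has_tmap2_slice2[OF mG mQ this]] show ?thesis .
qed

lemma infinitesimal_tmap:
  assumes "q \<in> points Q"
  shows "has_tmap GM Q (\<lambda>g. a g q) e (infinitesimal q)"
proof -
  obtain A where "has_tmap2 GM Q Q a e q A" using act_tmap2[OF G_closed(1) assms] by blast
  from has_tmap_tmap[OF mG has_tmap2_slice1[OF mG mQ this]] show ?thesis
    by (simp add: infinitesimal_def)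
qed

text \<open>At the identity the derivative of the action in the group variable is the infinitesimal generator and
its derivative in the point is the identity.\<close>

lemma act_product_rule:
  assumes X: "manifold X" and f: "has_tmap X GM f p D" "f p = e" and g: "has_tmap X Q g p E"
  shows "has_tmap X Q (\<lambda>x. a (f x) (g x)) p (\<lambda>v. infinitesimal (g p) (D v) + E v)"
proof -
  have gp: "g p \<in> points Q" by (rule has_tmap_point[OF X g])
  obtain A where A: "has_tmap2 GM Q Q a e (g p) A" using act_tmap2[OF G_closed(1) gp] by blast
  have A1: "A (v, 0) = infinitesimal (g p) v" for v
    using tmap_eq[OF mG has_tmap2_slice1[OF mG mQ A]] by (simp add: infinitesimal_def)
  have "has_tmap Q Q (\<lambda>y. y) (g p) (\<lambda>v. A (0, v))"
    using has_tmap2_slice2[OF mG mQ A] has_tmap_cong[OF mQ openin_topspace gp, of "a e" "\<lambda>y. y" Q] by simp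
  then have A2: "A (0, v) = v" for v
    using tmap_eq[OF mQ, of Q "\<lambda>y. y"] has_tmap_id[OF mQ gp] by metis
  have "has_tmap X Q (\<lambda>x. a (f x) (g x)) p (\<lambda>v. A (D v, E v))"
    by (rule has_tmap_compose2[OF X mG mQ f(1) g]) (simp add: f(2) A)
  moreover have "A (D v, E v) = infinitesimal (g p) (D v) + E v" for v
    using has_tmap2_split[OF A, of "D v" "E v"] by (simp add: A1 A2)
  ultimately show ?thesis by simp
qed

lemma expo_props:
  "smooth_map real_mfd GM (\<lambda>t. expo R (t *\<^sub>R \<xi>))"
  "expo R 0 = e"
  "velocity GM (\<lambda>t. expo R (t *\<^sub>R \<xi>)) = \<xi>"
proof -
  show s: "smooth_map real_mfd GM (\<lambda>t. expo R (t *\<^sub>R \<xi>))" for \<xi>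
    using exponential by (simp add: exponential_map_def)
  show "velocity GM (\<lambda>t. expo R (t *\<^sub>R \<xi>)) = \<xi>"
    using exponential by (simp add: exponential_map_def)
  interpret group G by (rule groups)
  have "expo R ((0 + 0) *\<^sub>R 0) = expo R (0 *\<^sub>R 0) \<otimes>\<^bsub>G\<^esub> expo R (0 *\<^sub>R 0)"
    using exponential unfolding exponential_map_def by blast
  then have "expo R 0 = expo R 0 \<otimes>\<^bsub>G\<^esub> expo R 0" by simp
  moreover have "expo R 0 \<in> carrier G"
    using smooth_map_on_point(2)[OF s, of 0 0] by (simp add: pointsG)
  ultimately show "expo R 0 = e" using l_cancel_one by metis
qed

lemma expo_deriv:
  "\<exists>D. has_deriv_into GM (\<lambda>t. expo R (t *\<^sub>R \<xi>)) 0 D \<and> D 1 = \<xi>"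
proof -
  obtain D where "has_deriv_into GM (\<lambda>t. expo R (t *\<^sub>R \<xi>)) 0 D"
    using smooth_imp_has_tmap[OF manifold_real mG expo_props(1), of 0 \<xi>]
    by (auto simp: has_tmap_real_iff)
  with velocity_eq[OF this] expo_props(3)[of \<xi>] show ?thesis by auto
qed

text \<open>Only the initial velocity of \<open>exp(t\<xi>)\<close> matters, so \<open>\<xi>\<^sub>Q(q)\<close> is the derivative at \<open>e\<close> of the orbit map
\<open>g \<mapsto> g q\<close>.\<close>

lemma generator_deriv:
  assumes q: "q \<in> points Q"
  shows "\<exists>D. has_deriv_into Q (\<lambda>t. a (expo R (t *\<^sub>R \<xi>)) q) 0 D \<and> D 1 = infinitesimal q \<xi>"
proof -
  obtain D where D: "has_deriv_into GM (\<lambda>t. expo R (t *\<^sub>R \<xi>)) 0 D" "D 1 = \<xi>" using expo_deriv by blast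
  have "has_deriv_into Q (\<lambda>t. a (expo R (t *\<^sub>R \<xi>)) q) 0 (\<lambda>t. infinitesimal q (D t))"
    by (rule has_deriv_into_chain[OF mG D(1)]) (simp add: expo_props(2) infinitesimal_tmap[OF q])
  with D(2) show ?thesis by auto
qed

lemma generator_eq: "q \<in> points Q \<Longrightarrow> generator R \<xi> q = infinitesimal q \<xi>"
  unfolding generator_def using generator_deriv velocity_eq by metis

subsection \<open>The Lagrangian\<close>

lemma L_tmap2:
  assumes "x \<in> points Q" "y \<in> points Q"
  shows "\<exists>A. has_tmap2 Q Q real_mfd (\<lambda>x y. L (x, y)) x y A"
proof (rule smooth_imp_has_tmap2[OF mQ mQ manifold_real])
  show "smooth_map (prod_mfd Q Q) real_mfd (\<lambda>(x, y). L (x, y))"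
    using system by (simp add: nonholonomic_system_def)
  show "(x, y) \<in> points (prod_mfd Q Q)" using assms by (simp add: prod_mfd_def)
qed

abbreviation "D1L \<equiv> D1 Q L"
abbreviation "D2L \<equiv> D2 Q L"

lemma L_product_rule:
  assumes X: "manifold X" and f: "has_tmap X Q f p D" and g: "has_tmap X Q g p E"
  shows "has_tmap X real_mfd (\<lambda>x. L (f x, g x)) p (\<lambda>v. D1L (f p) (g p) (D v) + D2L (f p) (g p) (E v))"
proof -
  obtain A where A: "has_tmap2 Q Q real_mfd (\<lambda>x y. L (x, y)) (f p) (g p) A"
    using L_tmap2[OF has_tmap_point[OF X f] has_tmap_point[OF X g]] by blast
  have "A (D v, E v) = D1L (f p) (g p) (D v) + D2L (f p) (g p) (E v)" for v
    using has_tmap2_split[OF A, of "D v" "E v"] D1_eq[OF mQ A] D2_eq[OF mQ A] by simp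
  with has_tmap_compose2[OF X mQ mQ f g A] show ?thesis by simp
qed

lemma DL_linear: 
  assumes "x \<in> points Q" "y \<in> points Q"
  shows "linear (D1L x y)" "linear (D2L x y)"
proof -
  obtain A where A: "has_tmap2 Q Q real_mfd (\<lambda>x y. L (x, y)) x y A" using L_tmap2[OF assms] by blast
  show "linear (D1L x y)" unfolding D1_eq[OF mQ A] by (rule has_tmap_linear[OF has_tmap2_slice1[OF mQ mQ A]])
  show "linear (D2L x y)" unfolding D2_eq[OF mQ A] by (rule has_tmap_linear[OF has_tmap2_slice2[OF mQ mQ A]])
qed

lemma L_invariant:
  assumes "g \<in> carrier G" "x \<in> points Q" "y \<in> points Q"
  shows "L (a g x, a g y) = L (x, y)"
  using symM assms carrier_sub[OF assms(1)] by (simp add: symmetry_group_def diag_action_def)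

lemma DL_equivariant:
  assumes g: "g \<in> carrier G" and x: "x \<in> points Q" and y: "y \<in> points Q"
  shows "D1L (a g x) (a g y) (da g x v) = D1L x y v" "D2L (a g x) (a g y) (da g y v) = D2L x y v"
proof -
  have lin: "linear (D1L (a g x) (a g y))" "linear (D2L (a g x) (a g y))"
    using DL_linear g x y by auto
  have "has_tmap Q real_mfd (\<lambda>x'. L (a g x', a g y)) x (\<lambda>v. D1L (a g x) (a g y) (da g x v))"
    using L_product_rule[OF mQ act_tmap[OF g x] has_tmap_const[OF x act_closed[OF g y]]] linear_0[OF lin(2)] by simp
  then have "has_tmap Q real_mfd (\<lambda>x'. L (x', y)) x (\<lambda>v. D1L (a g x) (a g y) (da g x v))"
    using has_tmap_cong[OF mQ openin_topspace x, of "\<lambda>x'. L (a g x', a g y)" "\<lambda>x'. L (x', y)" real_mfd]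
    by (simp add: L_invariant g y)
  from tmap_eq[OF mQ this] show "D1L (a g x) (a g y) (da g x v) = D1L x y v" by (simp add: D1_def)
  have "has_tmap Q real_mfd (\<lambda>y'. L (a g x, a g y')) y (\<lambda>v. D2L (a g x) (a g y) (da g y v))"
    using L_product_rule[OF mQ has_tmap_const[OF y act_closed[OF g x]] act_tmap[OF g y]] linear_0[OF lin(1)] by simp
  then have "has_tmap Q real_mfd (\<lambda>y'. L (x, y')) y (\<lambda>v. D2L (a g x) (a g y) (da g y v))"
    using has_tmap_cong[OF mQ openin_topspace y, of "\<lambda>y'. L (a g x, a g y')" "\<lambda>y'. L (x, y')" real_mfd]
    by (simp add: L_invariant g x)
  from tmap_eq[OF mQ this] show "D2L (a g x) (a g y) (da g y v) = D2L x y v" by (simp add: D2_def)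
qed

text \<open>The function \<open>g \<mapsto> L\<^sub>d(g x, g y)\<close> is constant by invariance.\<close>

lemma DL_infinitesimal:
  assumes x: "x \<in> points Q" and y: "y \<in> points Q"
  shows "D1L x y (infinitesimal x \<xi>) + D2L x y (infinitesimal y \<xi>) = 0"
proof -
  have eG: "e \<in> points GM" by (simp add: pointsG)
  have "has_tmap GM real_mfd (\<lambda>g. L (a g x, a g y)) e
      (\<lambda>\<xi>. D1L x y (infinitesimal x \<xi>) + D2L x y (infinitesimal y \<xi>))"
    using L_product_rule[OF mG infinitesimal_tmap[OF x] infinitesimal_tmap[OF y]] x y by simp
  then have "has_tmap GM real_mfd (\<lambda>g. L (x, y)) e
      (\<lambda>\<xi>. D1L x y (infinitesimal x \<xi>) + D2L x y (infinitesimal y \<xi>))"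
    using has_tmap_cong[OF mG openin_topspace eG, of "\<lambda>g. L (a g x, a g y)" "\<lambda>g. L (x, y)" real_mfd]
    by (simp add: L_invariant x y pointsG)
  from tmap_eq[OF mG this] tmap_eq[OF mG has_tmap_const[OF eG, of "L (x, y)" real_mfd]]
  have "(\<lambda>\<xi>. D1L x y (infinitesimal x \<xi>) + D2L x y (infinitesimal y \<xi>)) = (\<lambda>_. 0)" by simp
  from fun_cong[OF this] show ?thesis .
qed

lemma Jd_eq: "x \<in> points Q \<Longrightarrow> Jd R x y = (\<lambda>\<xi>. - D1L x y (infinitesimal x \<xi>))"
  unfolding Jd_def by (simp add: generator_eq)

subsection \<open>The momentum level is invariant\<close>

lemma mult_tmap2:
  assumes "g \<in> carrier G" "h \<in> carrier G"
  shows "\<exists>A. has_tmap2 GM GM GM (mult G) g h A"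
proof (rule smooth_imp_has_tmap2[OF mG mG mG])
  show "smooth_map (prod_mfd GM GM) GM (\<lambda>(g, h). g \<otimes>\<^bsub>G\<^esub> h)"
    using liegroups by (simp add: lie_group_def)
  show "(g, h) \<in> points (prod_mfd GM GM)" using assms by (simp add: prod_mfd_def pointsG)
qed

lemma inv_tmap:
  assumes "g \<in> carrier G"
  shows "\<exists>A. has_tmap GM GM (m_inv G) g A"
proof (rule smooth_imp_has_tmap[OF mG mG])
  show "smooth_map GM GM (m_inv G)" using liegroups(1) unfolding lie_group_def by (elim conjE)
  show "g \<in> points GM" using assms by (simp add: pointsG)
qed

lemma Ad_tmap:
  assumes g: "g \<in> carrier G"
  shows "has_tmap GM GM (\<lambda>h. g \<otimes>\<^bsub>G\<^esub> h \<otimes>\<^bsub>G\<^esub> inv\<^bsub>G\<^esub> g) e (Ad G g)"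
proof -
  have pts: "e \<in> points GM" "g \<in> points GM" "inv\<^bsub>G\<^esub> g \<in> points GM" using g by (simp_all add: pointsG)
  obtain A where A: "has_tmap2 GM GM GM (mult G) g e A" using mult_tmap2[OF g G_closed(1)] by blast
  obtain A' where A': "has_tmap2 GM GM GM (mult G) (g \<otimes>\<^bsub>G\<^esub> e) (inv\<^bsub>G\<^esub> g) A'"
    using mult_tmap2[of "g \<otimes>\<^bsub>G\<^esub> e" "inv\<^bsub>G\<^esub> g"] g by auto
  note 1 = has_tmap_compose2[OF mG mG mG has_tmap_const[OF pts(1,2)] has_tmap_id[OF mG pts(1)] A]
  have "\<exists>C. has_tmap GM GM (\<lambda>h. g \<otimes>\<^bsub>G\<^esub> h \<otimes>\<^bsub>G\<^esub> inv\<^bsub>G\<^esub> g) e C"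
    using has_tmap_compose2[OF mG mG mG 1 has_tmap_const[OF pts(1,3)] A'] by blast
  then show ?thesis unfolding Ad_def using has_tmap_tmap[OF mG] by blast
qed

text \<open>Both sides are the derivative at \<open>g = e\<close> of \<open>g (h q) = h ((h\<^sup>-\<^sup>1 g h) q)\<close>.\<close>

lemma infinitesimal_act:
  assumes h: "h \<in> carrier G" and q: "q \<in> points Q"
  shows "infinitesimal (a h q) \<xi> = da h q (infinitesimal q (Ad G (inv\<^bsub>G\<^esub> h) \<xi>))"
proof -
  interpret group G by (rule groups)
  let ?c = "\<lambda>g. inv\<^bsub>G\<^esub> h \<otimes>\<^bsub>G\<^esub> g \<otimes>\<^bsub>G\<^esub> inv\<^bsub>G\<^esub> (inv\<^bsub>G\<^esub> h)"
  have c: "has_tmap GM GM ?c e (Ad G (inv\<^bsub>G\<^esub> h))" by (rule Ad_tmap) (simp add: h)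
  have ce: "?c e = e" using h by simp
  have eG: "e \<in> points GM" by (simp add: pointsG)
  have 1: "has_tmap GM Q (\<lambda>g. a (?c g) q) e (\<lambda>v. infinitesimal q (Ad G (inv\<^bsub>G\<^esub> h) v))"
    using has_tmap_compose[OF mG mG c, of Q "\<lambda>g. a g q" "infinitesimal q"] infinitesimal_tmap[OF q] unfolding ce by simp
  have 2: "has_tmap GM Q (\<lambda>g. a h (a (?c g) q)) e (\<lambda>v. da h q (infinitesimal q (Ad G (inv\<^bsub>G\<^esub> h) v)))"
    by (rule has_tmap_compose[OF mG mQ 1]) (use act_tmap[OF h q] ce q in simp)
  have "a h (a (?c g) q) = a g (a h q)" if g: "g \<in> carrier G" for g
  proof -
    have "a h (a (?c g) q) = a (h \<otimes>\<^bsub>G\<^esub> ?c g) q" using h g q by (simp add: act_mult)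
    also have "h \<otimes>\<^bsub>G\<^esub> ?c g = g \<otimes>\<^bsub>G\<^esub> h"
      using h g by (simp add: m_assoc[symmetric])
    finally show ?thesis using h g q by (simp add: act_mult)
  qed
  then have "has_tmap GM Q (\<lambda>g. a g (a h q)) e (\<lambda>v. da h q (infinitesimal q (Ad G (inv\<^bsub>G\<^esub> h) v)))"
    using 2 has_tmap_cong[OF mG openin_topspace eG, of "\<lambda>g. a h (a (?c g) q)" "\<lambda>g. a g (a h q)" Q]
    by (simp add: pointsG)
  from tmap_eq[OF mG this] show ?thesis by (simp add: infinitesimal_def)
qed

text \<open>Equivariance of the momentum map gives \<open>J\<^sub>d(h x, h y) = Ad\<^sup>*\<^sub>g \<mu>\<close> with \<open>g = h\<^sup>-\<^sup>1\<close>, and \<open>\<mu>\<close> is fixed by \<open>Ad\<^sup>*\<close>.\<close>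

lemma Jmu_invariant:
  assumes h: "h \<in> carrier G" and xy: "(x, y) \<in> Jmu R"
  shows "(a h x, a h y) \<in> Jmu R"
proof -
  have x: "x \<in> points Q" and y: "y \<in> points Q" and J: "Jd R x y = mom R" using xy by (auto simp: Jmu_def)
  have "Jd R (a h x) (a h y) = mom R"
  proof
    fix \<xi>
    have "Jd R (a h x) (a h y) \<xi> = - D1L (a h x) (a h y) (da h x (infinitesimal x (Ad G (inv\<^bsub>G\<^esub> h) \<xi>)))"
      using h x by (simp add: Jd_eq infinitesimal_act)
    also have "\<dots> = - D1L x y (infinitesimal x (Ad G (inv\<^bsub>G\<^esub> h) \<xi>))"
      by (simp add: DL_equivariant h x y)
    also have "\<dots> = Jd R x y (Ad G (inv\<^bsub>G\<^esub> h) \<xi>)" by (simp add: Jd_eq x)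
    also have "\<dots> = (mom R \<circ> Ad G (inv\<^bsub>G\<^esub> h)) \<xi>" by (simp add: J)
    also have "\<dots> = mom R \<xi>" using Ad_invariant h by simp
    finally show "Jd R (a h x) (a h y) \<xi> = mom R \<xi>" .
  qed
  then show ?thesis using h x y by (simp add: Jmu_def)
qed

section \<open>The affine discrete connection\<close>

abbreviation "Ac \<equiv> Acon R"

lemma UO_points: "(x, y) \<in> UO R \<Longrightarrow> x \<in> points Q \<and> y \<in> points Q"
  by (simp add: UO_def)

lemma UO_act: "(x, y) \<in> UO R \<Longrightarrow> g \<in> carrier G \<Longrightarrow> h \<in> carrier G \<Longrightarrow> (a g x, a h y) \<in> UO R"
  by (simp add: UO_def)

lemma level_invariant:
  assumes "h \<in> carrier G" "(x, y) \<in> Jmu R \<inter> nbU R"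
  shows "(a h x, a h y) \<in> Jmu R \<inter> nbU R"
proof -
  have "diag_action a h ` nbU R \<subseteq> nbU R"
    using connection assms(1) by (simp add: connection_domains_def invariant_set_def)
  then have "(a h x, a h y) \<in> nbU R" using assms(2) by (auto simp: diag_action_def)
  then show ?thesis using Jmu_invariant assms by simp
qed

lemma Acon_ex1:
  assumes "(x, y) \<in> UO R"
  shows "\<exists>!g. g \<in> carrier G \<and> (x, a (inv\<^bsub>G\<^esub> g) y) \<in> Jmu R \<inter> nbU R"
proof -
  have "\<forall>(q0, q1)\<in>UO R. \<exists>!g. g \<in> carrier G \<and> (q0, a (inv\<^bsub>G\<^esub> g) q1) \<in> Jmu R \<inter> nbU R"
    using connection unfolding connection_domains_def by (elim conjE)
  from bspec[OF this assms] show ?thesis by simp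
qed

lemma Acon_closed: "(x, y) \<in> UO R \<Longrightarrow> Ac x y \<in> carrier G"
  and Acon_level: "(x, y) \<in> UO R \<Longrightarrow> (x, a (inv\<^bsub>G\<^esub> (Ac x y)) y) \<in> Jmu R \<inter> nbU R"
  using theI'[OF Acon_ex1, of x y] unfolding Acon_def by blast+

lemma Acon_eqI:
  assumes "(x, y) \<in> UO R" "g \<in> carrier G" "(x, a (inv\<^bsub>G\<^esub> g) y) \<in> Jmu R \<inter> nbU R"
  shows "Ac x y = g"
  unfolding Acon_def by (rule the1_equality[OF Acon_ex1[OF assms(1)]]) (use assms in simp)

lemma Acon_eq_one:
  assumes "(x, y) \<in> nbU R \<inter> UO R" "Jd R x y = mom R"
  shows "Ac x y = e"
proof (rule Acon_eqI)
  interpret group G by (rule groups)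
  show "(x, y) \<in> UO R" using assms by simp
  then show "(x, a (inv\<^bsub>G\<^esub> e) y) \<in> Jmu R \<inter> nbU R" using assms UO_points[of x y] by (simp add: Jmu_def)
qed simp

text \<open>If \<open>g\<^sup>-\<^sup>1 y\<close> is in the level over \<open>x\<close>, then so is \<open>(h g)\<^sup>-\<^sup>1 (h y)\<close>, being the same point.\<close>

lemma Acon_right:
  assumes xy: "(x, y) \<in> UO R" and h: "h \<in> carrier G"
  shows "Ac x (a h y) = h \<otimes>\<^bsub>G\<^esub> Ac x y"
proof (rule Acon_eqI)
  interpret group G by (rule groups)
  note pts = UO_points[OF xy] Acon_closed[OF xy]
  have hy: "(a e x, a h y) \<in> UO R" by (rule UO_act[OF xy G_closed(1) h])
  then show "(x, a h y) \<in> UO R" using pts by simp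
  show "h \<otimes>\<^bsub>G\<^esub> Ac x y \<in> carrier G" using h pts by simp
  have "a (inv\<^bsub>G\<^esub> (h \<otimes>\<^bsub>G\<^esub> Ac x y)) (a h y) = a (inv\<^bsub>G\<^esub> (Ac x y)) y"
    using h pts by (simp add: inv_mult_group act_mult)
  then show "(x, a (inv\<^bsub>G\<^esub> (h \<otimes>\<^bsub>G\<^esub> Ac x y)) (a h y)) \<in> Jmu R \<inter> nbU R"
    using Acon_level[OF xy] by simp
qed

lemma Acon_diag:
  assumes xy: "(x, y) \<in> UO R" and h: "h \<in> carrier G"
  shows "Ac (a h x) (a h y) = h \<otimes>\<^bsub>G\<^esub> Ac x y \<otimes>\<^bsub>G\<^esub> inv\<^bsub>G\<^esub> h"
proof (rule Acon_eqI)
  interpret group G by (rule groups)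
  note pts = UO_points[OF xy] Acon_closed[OF xy]
  show "(a h x, a h y) \<in> UO R" by (rule UO_act[OF xy h h])
  show "h \<otimes>\<^bsub>G\<^esub> Ac x y \<otimes>\<^bsub>G\<^esub> inv\<^bsub>G\<^esub> h \<in> carrier G" using h pts by simp
  have "a (inv\<^bsub>G\<^esub> (h \<otimes>\<^bsub>G\<^esub> Ac x y \<otimes>\<^bsub>G\<^esub> inv\<^bsub>G\<^esub> h)) (a h y) = a h (a (inv\<^bsub>G\<^esub> (Ac x y)) y)"
    using h pts by (simp add: inv_mult_group act_mult)
  then show "(a h x, a (inv\<^bsub>G\<^esub> (h \<otimes>\<^bsub>G\<^esub> Ac x y \<otimes>\<^bsub>G\<^esub> inv\<^bsub>G\<^esub> h)) (a h y)) \<in> Jmu R \<inter> nbU R"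
    using level_invariant[OF h Acon_level[OF xy]] by simp
qed

text \<open>The unique point of the orbit of \<open>y\<close> that forms a horizontal pair with \<open>x\<close>; it is
\<open>\<overline>h\<^sub>d\<^bsup>x\<^esup>(\<pi>(y))\<close>, written as a function of \<open>y\<close> so that it can be differentiated on \<open>Q \<times> Q\<close>.\<close>

definition horizontal_part :: "'q \<Rightarrow> 'q \<Rightarrow> 'q" where
  "horizontal_part x y = a (inv\<^bsub>G\<^esub> (Ac x y)) y"

lemma horizontal_part_point: "(x, y) \<in> UO R \<Longrightarrow> horizontal_part x y \<in> points Q"
  using UO_points Acon_closed by (simp add: horizontal_part_def)

lemma horizontal_part_recover: "(x, y) \<in> UO R \<Longrightarrow> a (Ac x y) (horizontal_part x y) = y"
  using UO_points Acon_closed by (simp add: horizontal_part_def)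

lemma horizontal_part_proj: "(x, y) \<in> UO R \<Longrightarrow> \<pi> (horizontal_part x y) = \<pi> y"
  using UO_points Acon_closed by (simp add: horizontal_part_def)

lemma Acon_horizontal_part:
  assumes "(x, y) \<in> UO R"
  shows "Ac x (horizontal_part x y) = e"
proof -
  interpret group G by (rule groups)
  show ?thesis
    unfolding horizontal_part_def using Acon_right[OF assms, of "inv\<^bsub>G\<^esub> (Ac x y)"] Acon_closed[OF assms] by simp
qed

lemma horizontal_part_fixed: "(x, y) \<in> UO R \<Longrightarrow> Ac x y = e \<Longrightarrow> horizontal_part x y = y"
proof -
  interpret group G by (rule groups)
  show "(x, y) \<in> UO R \<Longrightarrow> Ac x y = e \<Longrightarrow> horizontal_part x y = y"
    using UO_points by (simp add: horizontal_part_def)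
qed

lemma horizontal_part_unique:
  assumes xy: "(x, y) \<in> UO R" and z: "z \<in> points Q" "\<pi> z = \<pi> y" "Ac x z = e"
  shows "z = horizontal_part x y"
proof -
  interpret group G by (rule groups)
  obtain g where g: "g \<in> carrier G" "z = a g y" using proj_eqD z by metis
  then have "e = g \<otimes>\<^bsub>G\<^esub> Ac x y" using Acon_right[OF xy g(1)] z(3) by simp
  then have "g = inv\<^bsub>G\<^esub> (Ac x y)" using inv_equality[of g "Ac x y"] g Acon_closed[OF xy] by simp
  then show ?thesis using g by (simp add: horizontal_part_def)
qed

lemma horizontal_part_diag:
  assumes xy: "(x, y) \<in> UO R" and h: "h \<in> carrier G"
  shows "horizontal_part (a h x) (a h y) = a h (horizontal_part x y)"
proof -
  interpret group G by (rule groups)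
  show ?thesis
    using UO_points[OF xy] Acon_closed[OF xy] h
    by (simp add: horizontal_part_def Acon_diag[OF xy h] inv_mult_group act_mult)
qed

lemma hd_bar_eq:
  assumes xy: "(x, y) \<in> UO R"
  shows "hd_bar R x (\<pi> y) = horizontal_part x y"
  unfolding hd_bar_def
proof (rule the_equality)
  show "horizontal_part x y \<in> points Q \<and> \<pi> (horizontal_part x y) = \<pi> y \<and> Ac x (horizontal_part x y) = e"
    using horizontal_part_point horizontal_part_proj Acon_horizontal_part xy by simp
next
  fix z assume "z \<in> points Q \<and> \<pi> z = \<pi> y \<and> Ac x z = e"
  then show "z = horizontal_part x y" using horizontal_part_unique[OF xy] by simp
qed

lemma UO_open: "openin (prod_topology (mtop Q) (mtop Q)) (UO R)"
  and Acon_smooth: "smooth_map_on (UO R) (prod_mfd Q Q) GM (\<lambda>(x, y). Ac x y)"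
proof -
  show s: "smooth_map_on (UO R) (prod_mfd Q Q) GM (\<lambda>(x, y). Ac x y)"
    using connection unfolding connection_domains_def by (elim conjE)
  have "openin (mtop (prod_mfd Q Q)) (UO R)" using s unfolding smooth_map_on_def by (elim conjE)
  then show "openin (prod_topology (mtop Q) (mtop Q)) (UO R)" by (simp add: prod_mfd_def)
qed

lemma UO_slice1: "y \<in> points Q \<Longrightarrow> openin (mtop Q) {x \<in> points Q. (x, y) \<in> UO R}"
  using openin_continuous_map_preimage[OF _ UO_open, of "mtop Q" "\<lambda>x. (x, y)"]
  by (simp add: continuous_map_pairwise comp_def)

lemma UO_slice2: "x \<in> points Q \<Longrightarrow> openin (mtop Q) {y \<in> points Q. (x, y) \<in> UO R}"
  using openin_continuous_map_preimage[OF _ UO_open, of "mtop Q" "\<lambda>y. (x, y)"]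
  by (simp add: continuous_map_pairwise comp_def)

lemma Acon_tmap2: "(x, y) \<in> UO R \<Longrightarrow> \<exists>A. has_tmap2 Q Q GM Ac x y A"
  by (rule smooth_imp_has_tmap2[OF mQ mQ mG Acon_smooth])

lemma horizontal_part_tmap2:
  assumes xy: "(x, y) \<in> UO R"
  shows "\<exists>A. has_tmap2 Q Q Q horizontal_part x y A"
proof -
  have x: "x \<in> points Q" and y: "y \<in> points Q" using UO_points[OF xy] by auto
  obtain A where A: "has_tmap2 Q Q GM Ac x y A" using Acon_tmap2[OF xy] by blast
  obtain I where I: "has_tmap GM GM (m_inv G) (Ac x y) I" using inv_tmap[OF Acon_closed[OF xy]] by blast
  obtain C where C: "has_tmap2 GM Q Q a (inv\<^bsub>G\<^esub> (Ac x y)) y C"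
    using act_tmap2[of "inv\<^bsub>G\<^esub> (Ac x y)" y] Acon_closed[OF xy] y by auto
  have "has_tmap2 Q Q Q (\<lambda>x y. a (inv\<^bsub>G\<^esub> (Ac x y)) y) x y (\<lambda>v. C (I (A v), snd v))"
    by (rule has_tmap2_compose[OF mQ mQ mG mQ has_tmap2_after[OF mQ mQ mG A I] has_tmap2_snd[OF mQ x y] C])
  then show ?thesis by (auto simp: horizontal_part_def[abs_def])
qed

section \<open>Vertical vectors and horizontal lifts\<close>

text \<open>With \<open>c = \<A>\<^sub>d(q, q)\<close>, every \<open>x\<close> near \<open>q\<close> is \<open>f(x) g(x)\<close> for \<open>f(x) = \<A>\<^sub>d(q, x) c\<^sup>-\<^sup>1\<close> and \<open>g(x) = c S(q, x)\<close>, where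
\<open>f(q) = e\<close> and \<open>g(q) = q\<close>.  The product rule gives \<open>v = (df v)\<^sub>Q(q) + dg v\<close>, and \<open>dg v = 0\<close> since \<open>g\<close> factors
through \<open>\<pi>\<close>.\<close>

lemma kernel_infinitesimal:
  assumes q: "q \<in> points Q" and v: "d\<pi> q v = 0"
  shows "\<exists>\<xi>. v = infinitesimal q \<xi>"
proof -
  interpret group G by (rule groups)
  have "\<pi> q \<in> points B" using smooth_map_on_point[OF proj_smooth q] by simp
  then have qq: "(q, q) \<in> UO R" using connection q by (simp add: UO_def connection_domains_def)
  define c where "c = Ac q q"
  have c: "c \<in> carrier G" using Acon_closed[OF qq] by (simp add: c_def)
  let ?f = "\<lambda>x. Ac q x \<otimes>\<^bsub>G\<^esub> inv\<^bsub>G\<^esub> c" and ?g = "\<lambda>x. a c (horizontal_part q x)"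
  obtain A where A: "has_tmap2 Q Q GM Ac q q A" using Acon_tmap2[OF qq] by blast
  obtain S where S: "has_tmap2 Q Q Q horizontal_part q q S" using horizontal_part_tmap2[OF qq] by blast
  have cp: "inv\<^bsub>G\<^esub> c \<in> points GM" using c by (simp add: pointsG)
  obtain C where C: "has_tmap2 GM GM GM (mult G) (Ac q q) (inv\<^bsub>G\<^esub> c) C"
    using mult_tmap2[of "Ac q q" "inv\<^bsub>G\<^esub> c"] c by (auto simp: c_def)
  obtain Df where Df: "has_tmap Q GM ?f q Df"
    using has_tmap_compose2[OF mQ mG mG has_tmap2_slice2[OF mQ mQ A] has_tmap_const[OF q cp] C] by blast
  obtain Dg where Dg: "has_tmap Q Q ?g q Dg"
    using has_tmap_compose[OF mQ mQ has_tmap2_slice2[OF mQ mQ S] act_tmap[OF c horizontal_part_point[OF qq]]] by blast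
  have gq: "?g q = q" using horizontal_part_recover[OF qq] by (simp add: c_def)
  have fq: "?f q = e" using c by (simp add: c_def)
  let ?V = "{x \<in> points Q. (q, x) \<in> UO R}"
  have V: "openin (mtop Q) ?V" "q \<in> ?V" using UO_slice2[OF q] q qq by auto
  have rec: "a (?f x) (?g x) = x" if "x \<in> ?V" for x
  proof -
    have x: "x \<in> points Q" "(q, x) \<in> UO R" using that by auto
    have "a (?f x) (?g x) = a (?f x \<otimes>\<^bsub>G\<^esub> c) (horizontal_part q x)"
      using act_mult[of "?f x" c] Acon_closed[OF x(2)] c horizontal_part_point[OF x(2)] by simp
    also have "?f x \<otimes>\<^bsub>G\<^esub> c = Ac q x" using Acon_closed[OF x(2)] c by (simp add: m_assoc)
    finally show ?thesis using horizontal_part_recover[OF x(2)] by simp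
  qed
  have "has_tmap Q Q (\<lambda>x. a (?f x) (?g x)) q (\<lambda>v. infinitesimal (?g q) (Df v) + Dg v)"
    by (rule act_product_rule[OF mQ Df fq Dg])
  then have "has_tmap Q Q (\<lambda>x. x) q (\<lambda>v. infinitesimal q (Df v) + Dg v)"
    using has_tmap_cong[where N=Q, OF mQ V rec] by (simp add: gq)
  then have "v = infinitesimal q (Df v) + Dg v"
    using tmap_eq[OF mQ has_tmap_id[OF mQ q]] tmap_eq[OF mQ, of Q "\<lambda>x. x" q] by metis
  moreover have "Dg v = 0"
  proof (rule submersion_descent[OF mQ mB proj_smooth q proj_surj[OF q] _ v])
    let ?h = "\<lambda>r. cmap (chart_at Q q) (a c (hd_bar R q r))"
    have d: "((\<lambda>z. cmap (chart_at Q q) (?g (par Q q z))) has_derivative Dg) (at (crd Q q))"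
      using Dg par_crd[OF mQ q] gq by (simp add: has_tmap_def has_deriv_into_def)
    have "\<forall>\<^sub>F z in nhds (crd Q q). par Q q z \<in> ?V"
      using eventually_par[OF mQ q V] by (rule eventually_mono) simp
    then have "\<forall>\<^sub>F z in nhds (crd Q q). cmap (chart_at Q q) (?g (par Q q z)) = ?h (\<pi> (par Q q z))"
      by (rule eventually_mono) (simp add: hd_bar_eq)
    from has_derivative_cong_nhds[OF this] d
    show "((\<lambda>z. ?h (\<pi> (par Q q z))) has_derivative Dg) (at (crd Q q))" by blast
  qed
  ultimately have "v = infinitesimal q (Df v)" by simp
  then show ?thesis by blast
qed

text \<open>The tangent space to the orbit consists of velocities of smooth curves, so the curve \<open>exp(t\<xi>)q\<close> must be
shown to be smooth and not only differentiable at \<open>0\<close>.  It is the composite of \<open>exp(t\<xi>)\<close>, the inclusion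
of \<open>G\<close> into the ambient symmetry group, whose action is assumed smooth, and the orbit map.\<close>

lemma infinitesimal_vertical:
  assumes q: "q \<in> points Q"
  shows "infinitesimal q \<xi> \<in> vertical G Q a q"
proof -
  let ?c = "\<lambda>t. a (expo R (t *\<^sub>R \<xi>)) q"
  have expoM: "smooth_map real_mfd (gmfd M) (\<lambda>t. expo R (t *\<^sub>R \<xi>))"
    by (rule smooth_map_on_compose[OF manifold_real mG mM expo_props(1) inclusion_smooth])
       (use smooth_map_on_point(2)[OF expo_props(1)] in auto)
  have "smooth_map real_mfd Q ?c"
    by (rule smooth_map_on_compose[OF manifold_real mM mQ expoM smooth_map_slice[OF mM mQ mQ act_smooth q]])
       (use smooth_map_on_point(2)[OF expoM] in auto)
  then have 1: "smooth_map_on {-1<..<1} real_mfd Q ?c"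
    by (rule smooth_map_on_subset) (simp_all add: real_mfd_def)
  have 2: "?c ` {-1<..<1} \<subseteq> orbit G a q"
  proof (rule image_subsetI)
    fix t :: real
    have "expo R (t *\<^sub>R \<xi>) \<in> carrier G"
      using smooth_map_on_point(2)[OF expo_props(1), of t \<xi>] by (simp add: pointsG)
    then show "?c t \<in> orbit G a q" unfolding orbit_def by blast
  qed
  have 3: "?c 0 = q" using q by (simp add: expo_props(2))
  have "velocity Q ?c = infinitesimal q \<xi>"
    using generator_eq[OF q, of \<xi>] by (simp add: generator_def)
  then have "\<exists>c. infinitesimal q \<xi> = velocity Q c \<and> (\<exists>\<epsilon>>0. smooth_map_on {-\<epsilon><..<\<epsilon>} real_mfd Q c \<and>
      c ` {-\<epsilon><..<\<epsilon>} \<subseteq> orbit G a q \<and> c 0 = q)"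
    using 1 2 3 by (intro exI[of _ ?c] conjI exI[of _ 1]) simp_all
  then show ?thesis unfolding vertical_def tangent_to_def by blast
qed

lemma vertical_kernel:
  assumes q: "q \<in> points Q" and v: "v \<in> vertical G Q a q"
  shows "d\<pi> q v = 0"
proof -
  obtain c \<epsilon> where c: "v = velocity Q c" "\<epsilon> > 0" "smooth_map_on {-\<epsilon><..<\<epsilon>} real_mfd Q c"
      "c ` {-\<epsilon><..<\<epsilon>} \<subseteq> orbit G a q" "c 0 = q"
    using v unfolding vertical_def tangent_to_def by blast
  have 0: "(0::real) \<in> {-\<epsilon><..<\<epsilon>}" using c(2) by simp
  obtain A where A: "has_deriv_into Q c 0 A"
    using smooth_imp_has_tmap[OF manifold_real mQ c(3) 0] by (auto simp: has_tmap_real_iff)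
  have "has_deriv_into B (\<lambda>t. \<pi> (c t)) 0 (\<lambda>t. d\<pi> q (A t))"
    by (rule has_deriv_into_chain[OF mQ A]) (simp add: c(5) proj_tmap[OF q])
  moreover have "\<pi> (c t) = \<pi> q" if "t \<in> {-\<epsilon><..<\<epsilon>}" for t
  proof -
    have "c t \<in> \<pi> q" using c(4) that by (auto simp: pi_eq_orbit)
    then show ?thesis unfolding proj_iff using q by auto
  qed
  then have "\<forall>\<^sub>F t in nhds 0. \<pi> (c t) = \<pi> q"
    using eventually_nhds_in_open[OF open_greaterThanLessThan 0] by (auto elim: eventually_mono)
  note has_deriv_into_cong[OF this, of B]
  ultimately have "has_deriv_into B (\<lambda>t. \<pi> q) (0::real) (\<lambda>t. d\<pi> q (A t))" by simp
  moreover have "has_deriv_into B (\<lambda>t. \<pi> q) (0::real) (\<lambda>t. 0)"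
    using smooth_map_on_point[OF proj_smooth q] by (intro has_deriv_into_const)
  ultimately have "(\<lambda>t. d\<pi> q (A t)) = (\<lambda>t. 0)" by (rule has_deriv_into_unique)
  from fun_cong[OF this, of 1] show ?thesis using c(1) velocity_eq[OF A] by simp
qed

lemma vertical_Dv: "q \<in> points Q \<Longrightarrow> vertical G Q a q \<subseteq> Dv R q"
  using horizontal unfolding horizontal_symmetry_group_def by blast

lemma splitting_at:
  assumes "q \<in> points Q"
  shows "direct_sum (vertical G Q a q) (Hb R q) (Dv R q)" "direct_sum (Wb R q) (Dv R q) UNIV"
proof -
  have "vertical G Q a q \<inter> Dv R q = vertical G Q a q" using vertical_Dv[OF assms] by blast
  then show "direct_sum (vertical G Q a q) (Hb R q) (Dv R q)" "direct_sum (Wb R q) (Dv R q) UNIV"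
    using splitting assms by (auto simp: adapted_splitting_def)
qed

abbreviation "Hor q \<equiv> {w + h | w h. w \<in> Wb R q \<and> h \<in> Hb R q}"

lemma dproj_linear: "q \<in> points Q \<Longrightarrow> linear (d\<pi> q)"
  by (rule has_tmap_linear[OF proj_tmap])

text \<open>\<open>TQ = \<W> \<oplus> \<V> \<oplus> \<H>\<close> and \<open>ker d\<pi> = \<V>\<close>: removing the vertical component of any preimage of \<open>\<delta>r\<close> gives existence,
and the difference of two horizontal lifts is vertical, hence zero.\<close>

lemma hlift_ex1:
  assumes q: "q \<in> points Q"
  shows "\<exists>!v. v \<in> Hor q \<and> d\<pi> q v = \<delta>r"
proof -
  note lin = dproj_linear[OF q]
  note s1 = direct_sumD[OF splitting_at(1)[OF q]]
  note s2 = direct_sumD[OF splitting_at(2)[OF q]]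
  obtain u where u: "d\<pi> q u = \<delta>r" using proj_surj[OF q] by (metis surjD)
  have "u \<in> {w + d | w d. w \<in> Wb R q \<and> d \<in> Dv R q}" using s2(4) by simp
  then obtain w d where wd: "w \<in> Wb R q" "d \<in> Dv R q" "u = w + d" by blast
  have "d \<in> {s + h | s h. s \<in> vertical G Q a q \<and> h \<in> Hb R q}" using s1(4) wd(2) by simp
  then obtain s h where sh: "s \<in> vertical G Q a q" "h \<in> Hb R q" "d = s + h" by blast
  have "d\<pi> q (w + h) = \<delta>r"
    using u vertical_kernel[OF q sh(1)] by (simp add: wd(3) sh(3) linear_add[OF lin])
  then have ex: "w + h \<in> Hor q \<and> d\<pi> q (w + h) = \<delta>r" using wd(1) sh(2) by blast
  have uniq: "v = v'" if v: "v \<in> Hor q \<and> d\<pi> q v = \<delta>r" and v': "v' \<in> Hor q \<and> d\<pi> q v' = \<delta>r" for v v'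
  proof -
    obtain w1 h1 where 1: "w1 \<in> Wb R q" "h1 \<in> Hb R q" "v = w1 + h1" using v by auto
    obtain w2 h2 where 2: "w2 \<in> Wb R q" "h2 \<in> Hb R q" "v' = w2 + h2" using v' by auto
    have "d\<pi> q (v - v') = 0" using v v' by (simp add: linear_diff[OF lin])
    then obtain \<xi> where "v - v' = infinitesimal q \<xi>" using kernel_infinitesimal[OF q] by blast
    then have ver: "v - v' \<in> vertical G Q a q" using infinitesimal_vertical[OF q] by simp
    have hd: "h1 - h2 \<in> Hb R q" by (rule subspace_diff[OF s1(2) 1(2) 2(2)])
    have "0 + (h1 - h2) \<in> {s + h | s h. s \<in> vertical G Q a q \<and> h \<in> Hb R q}"
      using hd subspace_0[OF s1(1)] by blast
    then have hD: "h1 - h2 \<in> Dv R q" using s1(4) by simp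
    have vD: "v - v' \<in> Dv R q" using ver vertical_Dv[OF q] by blast
    have "(v - v') - (h1 - h2) \<in> Dv R q" by (rule subspace_diff[OF s2(2) vD hD])
    moreover have wd: "(v - v') - (h1 - h2) = w1 - w2" using 1 2 by simp
    moreover have "w1 - w2 \<in> Wb R q" by (rule subspace_diff[OF s2(1) 1(1) 2(1)])
    ultimately have "w1 - w2 \<in> Wb R q \<inter> Dv R q" by simp
    then have "w1 - w2 = 0" unfolding s2(3) by simp
    then have "v - v' = h1 - h2" using wd by simp
    then have "v - v' \<in> vertical G Q a q \<inter> Hb R q" using ver hd by simp
    then show ?thesis unfolding s1(3) by simp
  qed
  show ?thesis by (rule ex1I[of "\<lambda>v. v \<in> Hor q \<and> d\<pi> q v = \<delta>r" "w + h", OF ex]) (rule uniq[OF _ ex])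
qed

lemma hlift_props: "q \<in> points Q \<Longrightarrow> hlift R q \<delta>r \<in> Hor q \<and> d\<pi> q (hlift R q \<delta>r) = \<delta>r"
  unfolding hlift_def by (rule theI'[OF hlift_ex1])

lemma hlift_eqI: "q \<in> points Q \<Longrightarrow> v \<in> Hor q \<Longrightarrow> d\<pi> q v = \<delta>r \<Longrightarrow> hlift R q \<delta>r = v"
  unfolding hlift_def by (rule the1_equality[OF hlift_ex1]) simp_all

lemma subspaces_at:
  assumes "q \<in> points Q"
  shows "subspace (Wb R q)" "subspace (Hb R q)" "subspace (Dv R q)" "subspace (vertical G Q a q)"
  by (fact direct_sumD[OF splitting_at(2)[OF assms]] direct_sumD[OF splitting_at(1)[OF assms]])+

lemma hlift_zero: "q \<in> points Q \<Longrightarrow> hlift R q 0 = 0"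
proof (rule hlift_eqI)
  assume q: "q \<in> points Q"
  have "0 + 0 \<in> Hor q" using subspace_0[OF subspaces_at(1)[OF q]] subspace_0[OF subspaces_at(2)[OF q]] by blast
  then show "0 \<in> Hor q" by simp
  show "d\<pi> q 0 = 0" by (rule linear_0[OF dproj_linear[OF q]])
qed

lemma hlift_horizontal:
  assumes q: "q \<in> points Q" and h: "h \<in> Hb R q"
  shows "hlift R q (d\<pi> q h) = h"
proof (rule hlift_eqI[OF q])
  have "0 + h \<in> Hor q" using subspace_0[OF subspaces_at(1)[OF q]] h by blast
  then show "h \<in> Hor q" by simp
qed simp

lemma dproj_act:
  assumes g: "g \<in> carrier G" and q: "q \<in> points Q"
  shows "d\<pi> (a g q) (da g q v) = d\<pi> q v"
proof -
  have "has_tmap Q B (\<lambda>x. \<pi> (a g x)) q (\<lambda>v. d\<pi> (a g q) (da g q v))"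
    by (rule has_tmap_compose[OF mQ mQ act_tmap[OF g q] proj_tmap[OF act_closed[OF g q]]])
  then have "has_tmap Q B \<pi> q (\<lambda>v. d\<pi> (a g q) (da g q v))"
    using has_tmap_cong[OF mQ openin_topspace q, of "\<lambda>x. \<pi> (a g x)" \<pi> B] g by simp
  from fun_cong[OF tmap_eq[OF mQ this], of v] show ?thesis by simp
qed

lemma bundle_act:
  assumes "g \<in> carrier G" "q \<in> points Q"
  shows "v \<in> Hb R q \<Longrightarrow> da g q v \<in> Hb R (a g q)" "v \<in> Wb R q \<Longrightarrow> da g q v \<in> Wb R (a g q)"
    "v \<in> Dv R q \<Longrightarrow> da g q v \<in> Dv R (a g q)"
proof -
  have inv: "invariant_bundle G Q a (Hb R)" "invariant_bundle G Q a (Wb R)" "invariant_bundle M Q a (Dv R)"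
    using splitting symM by (simp_all add: adapted_splitting_def symmetry_group_def)
  have "da g q ` Hb R q \<subseteq> Hb R (a g q)" "da g q ` Wb R q \<subseteq> Wb R (a g q)" "da g q ` Dv R q \<subseteq> Dv R (a g q)"
    using inv assms carrier_sub[OF assms(1)] by (simp_all add: invariant_bundle_def)
  then show "v \<in> Hb R q \<Longrightarrow> da g q v \<in> Hb R (a g q)" "v \<in> Wb R q \<Longrightarrow> da g q v \<in> Wb R (a g q)"
    "v \<in> Dv R q \<Longrightarrow> da g q v \<in> Dv R (a g q)"
    by (simp_all add: image_subset_iff)
qed

lemma hlift_act:
  assumes g: "g \<in> carrier G" and q: "q \<in> points Q"
  shows "hlift R (a g q) \<delta>r = da g q (hlift R q \<delta>r)"
proof (rule hlift_eqI[OF act_closed[OF g q]])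
  obtain w h where wh: "w \<in> Wb R q" "h \<in> Hb R q" "hlift R q \<delta>r = w + h" using hlift_props[OF q] by blast
  have "da g q (hlift R q \<delta>r) = da g q w + da g q h"
    unfolding wh(3) by (rule linear_add[OF has_tmap_linear[OF act_tmap[OF g q]]])
  then show "da g q (hlift R q \<delta>r) \<in> Hor (a g q)" using bundle_act[OF g q] wh by blast
  show "d\<pi> (a g q) (da g q (hlift R q \<delta>r)) = \<delta>r" using dproj_act[OF g q] hlift_props[OF q] by simp
qed

end


context reduced_system
begin

section \<open>The reduced Lagrangian and the reduced forces\<close>

lemma rho_one: "q \<in> points Q \<Longrightarrow> rho R q e = (\<lambda>g. (a g q, e)) ` carrier G"
proof -
  interpret group G by (rule groups)
  show "rho R q e = (\<lambda>g. (a g q, e)) ` carrier G"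
    unfolding rho_def orbit_def by (auto simp: r_inv)
qed

lemma rho_equivariant:
  assumes g: "g \<in> carrier G" and q: "q \<in> points Q" and w: "w \<in> carrier G"
  shows "rho R (a g q) (g \<otimes>\<^bsub>G\<^esub> w \<otimes>\<^bsub>G\<^esub> inv\<^bsub>G\<^esub> g) = rho R q w"
proof -
  interpret group G by (rule groups)
  have el: "z \<in> rho R q w \<longleftrightarrow> (\<exists>h\<in>carrier G. z = (a h q, h \<otimes>\<^bsub>G\<^esub> w \<otimes>\<^bsub>G\<^esub> inv\<^bsub>G\<^esub> h))" for z q w
    unfolding rho_def orbit_def by auto
  have sub: "rho R (a g q) (g \<otimes>\<^bsub>G\<^esub> w \<otimes>\<^bsub>G\<^esub> inv\<^bsub>G\<^esub> g) \<subseteq> rho R q w"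
    if g: "g \<in> carrier G" and q: "q \<in> points Q" and w: "w \<in> carrier G" for g q w
  proof
    fix z assume "z \<in> rho R (a g q) (g \<otimes>\<^bsub>G\<^esub> w \<otimes>\<^bsub>G\<^esub> inv\<^bsub>G\<^esub> g)"
    then obtain h where h: "h \<in> carrier G"
      "z = (a h (a g q), h \<otimes>\<^bsub>G\<^esub> (g \<otimes>\<^bsub>G\<^esub> w \<otimes>\<^bsub>G\<^esub> inv\<^bsub>G\<^esub> g) \<otimes>\<^bsub>G\<^esub> inv\<^bsub>G\<^esub> h)"
      unfolding el by blast
    have "z = (a (h \<otimes>\<^bsub>G\<^esub> g) q, (h \<otimes>\<^bsub>G\<^esub> g) \<otimes>\<^bsub>G\<^esub> w \<otimes>\<^bsub>G\<^esub> inv\<^bsub>G\<^esub> (h \<otimes>\<^bsub>G\<^esub> g))"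
      using h g q w by (simp add: act_mult inv_mult_group m_assoc)
    then show "z \<in> rho R q w" unfolding el using h g by (intro bexI[of _ "h \<otimes>\<^bsub>G\<^esub> g"]) simp_all
  qed
  have "rho R (a (inv\<^bsub>G\<^esub> g) (a g q))
      (inv\<^bsub>G\<^esub> g \<otimes>\<^bsub>G\<^esub> (g \<otimes>\<^bsub>G\<^esub> w \<otimes>\<^bsub>G\<^esub> inv\<^bsub>G\<^esub> g) \<otimes>\<^bsub>G\<^esub> inv\<^bsub>G\<^esub> (inv\<^bsub>G\<^esub> g))
      \<subseteq> rho R (a g q) (g \<otimes>\<^bsub>G\<^esub> w \<otimes>\<^bsub>G\<^esub> inv\<^bsub>G\<^esub> g)"
    by (rule sub) (use g q w in simp_all)
  moreover have "inv\<^bsub>G\<^esub> g \<otimes>\<^bsub>G\<^esub> (g \<otimes>\<^bsub>G\<^esub> w \<otimes>\<^bsub>G\<^esub> inv\<^bsub>G\<^esub> g) \<otimes>\<^bsub>G\<^esub> inv\<^bsub>G\<^esub> (inv\<^bsub>G\<^esub> g) = w"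
  proof -
    have "inv\<^bsub>G\<^esub> g \<otimes>\<^bsub>G\<^esub> (g \<otimes>\<^bsub>G\<^esub> w \<otimes>\<^bsub>G\<^esub> inv\<^bsub>G\<^esub> g) = w \<otimes>\<^bsub>G\<^esub> inv\<^bsub>G\<^esub> g"
      using g w by (simp add: m_assoc[symmetric])
    then show ?thesis using g w by (simp add: m_assoc)
  qed
  ultimately show ?thesis using sub[OF g q w] g q by (simp add: subset_antisym)
qed

lemma the_elem_image_const: "x \<in> X \<Longrightarrow> (\<And>y. y \<in> X \<Longrightarrow> f y = c) \<Longrightarrow> the_elem (f ` X) = c"
proof -
  assume "x \<in> X" "\<And>y. y \<in> X \<Longrightarrow> f y = c"
  then have "f ` X = {c}" by auto
  then show ?thesis by simp
qed

lemma Ymap_eq: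
  assumes q: "q \<in> points Q"
  shows "Ymap R (\<pi> q, r) = (rho R q e, r)"
proof -
  interpret group G by (rule groups)
  have "the_elem ((\<lambda>q. rho R q e) ` \<pi> q) = rho R q e"
  proof (rule the_elem_image_const[OF proj_refl[OF q]])
    fix y assume "y \<in> \<pi> q"
    then obtain g where g: "g \<in> carrier G" "y = a g q" unfolding proj_iff by blast
    then show "rho R y e = rho R q e" using rho_equivariant[OF g(1) q, of e] by simp
  qed
  then show ?thesis by (simp add: Ymap_def)
qed

text \<open>The value that a map induces on the orbit \<open>\<rho>(q, e)\<close> may be computed at any representative \<open>(g q, e)\<close>, once
it is known not to depend on \<open>g\<close>.\<close>

lemma the_elem_rho:
  assumes q: "q \<in> points Q" and f: "\<And>g. g \<in> carrier G \<Longrightarrow> f (a g q, e) = c"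
  shows "the_elem (f ` rho R q e) = c"
proof (rule the_elem_image_const)
  show "(a e q, e) \<in> rho R q e" unfolding rho_one[OF q] by (rule imageI) simp
  fix y assume "y \<in> rho R q e"
  then obtain g where "g \<in> carrier G" "y = (a g q, e)" unfolding rho_one[OF q] by blast
  then show "f y = c" using f by simp
qed

lemma horizontal_part_left:
  assumes xy: "(x, y) \<in> UO R" and g: "g \<in> carrier G"
  shows "hd_bar R (a g x) (\<pi> y) = a g (horizontal_part x y)"
proof -
  have "hd_bar R (a g x) (\<pi> (a g y)) = horizontal_part (a g x) (a g y)"
    by (rule hd_bar_eq[OF UO_act[OF xy g g]])
  then show ?thesis using horizontal_part_diag[OF xy g] g UO_points[OF xy] by simp
qed

lemma L_breve_eq:
  assumes xy: "(x, y) \<in> UO R"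
  shows "L_breve R (\<pi> x, \<pi> y) = L (x, horizontal_part x y)"
proof -
  have x: "x \<in> points Q" using UO_points[OF xy] by simp
  have "the_elem ((\<lambda>(q0, w0). L_check R q0 w0 (\<pi> y)) ` rho R x e) = L (x, horizontal_part x y)"
  proof (rule the_elem_rho[OF x])
    fix g assume g: "g \<in> carrier G"
    then have "a e (a g (horizontal_part x y)) = a g (horizontal_part x y)"
      using horizontal_part_point[OF xy] by simp
    then show "(case (a g x, e) of (q0, w0) \<Rightarrow> L_check R q0 w0 (\<pi> y)) = L (x, horizontal_part x y)"
      using L_invariant[OF g x horizontal_part_point[OF xy]]
      by (simp add: L_check_def F1_def horizontal_part_left[OF xy g])
  qed
  then show ?thesis by (simp add: L_breve_def L_hat_def Ymap_eq[OF x])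
qed

text \<open>The pullback of the reduced Lagrangian to \<open>Q \<times> Q\<close> is \<open>L\<^sub>d(x, S(x, y))\<close>, which is differentiable, and
differentiability descends.\<close>

lemma L_breve_tmap2:
  assumes xy: "(x, y) \<in> UO R"
  shows "\<exists>A. has_tmap2 B B real_mfd (\<lambda>r s. L_breve R (r, s)) (\<pi> x) (\<pi> y) A"
proof -
  have x: "x \<in> points Q" and y: "y \<in> points Q" using UO_points[OF xy] by auto
  obtain S where S: "has_tmap2 Q Q Q horizontal_part x y S" using horizontal_part_tmap2[OF xy] by blast
  obtain A where A: "has_tmap2 Q Q real_mfd (\<lambda>x y. L (x, y)) x (horizontal_part x y) A"
    using L_tmap2[OF x horizontal_part_point[OF xy]] by blast
  have "has_tmap2 Q Q real_mfd (\<lambda>x y. L (x, horizontal_part x y)) x y (\<lambda>v. A (fst v, S v))"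
    by (rule has_tmap2_compose[OF mQ mQ mQ mQ has_tmap2_fst[OF mQ x y] S A])
  then have "has_tmap2 Q Q real_mfd (\<lambda>x y. L_breve R (\<pi> x, \<pi> y)) x y (\<lambda>v. A (fst v, S v))"
    using has_tmap2_cong[where F="\<lambda>x y. L (x, horizontal_part x y)" and F'="\<lambda>x y. L_breve R (\<pi> x, \<pi> y)"
        and P=real_mfd, OF mQ mQ UO_open xy] by (simp add: L_breve_eq)
  from submersion_descent2[where f="\<lambda>r s. L_breve R (r, s)", OF mQ mB proj_smooth x proj_surj[OF x] y proj_surj[OF y] this]
  show ?thesis .
qed

abbreviation "D1Lb \<equiv> D1 B (L_breve R)"
abbreviation "D2Lb \<equiv> D2 B (L_breve R)"

lemma D1_L_breve:
  assumes xy: "(x, y) \<in> UO R"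
  shows "D1Lb (\<pi> x) (\<pi> y) (d\<pi> x v) = tmap Q real_mfd (\<lambda>x'. L (x', horizontal_part x' y)) x v"
proof -
  have x: "x \<in> points Q" and y: "y \<in> points Q" using UO_points[OF xy] by auto
  obtain A where A: "has_tmap2 B B real_mfd (\<lambda>r s. L_breve R (r, s)) (\<pi> x) (\<pi> y) A" using L_breve_tmap2[OF xy] by blast
  have "has_tmap Q real_mfd (\<lambda>x'. L_breve R (\<pi> x', \<pi> y)) x (\<lambda>v. A (d\<pi> x v, 0))"
    by (rule has_tmap_compose[OF mQ mB proj_tmap[OF x] has_tmap2_slice1[OF mB mB A]])
  then have "has_tmap Q real_mfd (\<lambda>x'. L (x', horizontal_part x' y)) x (\<lambda>v. A (d\<pi> x v, 0))"
    using has_tmap_cong[OF mQ UO_slice1[OF y], of x "\<lambda>x'. L_breve R (\<pi> x', \<pi> y)" "\<lambda>x'. L (x', horizontal_part x' y)" real_mfd] x xy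
    by (simp add: L_breve_eq)
  from tmap_eq[OF mQ this] D1_eq[OF mB A] show ?thesis by simp
qed

lemma D2_L_breve:
  assumes xy: "(x, y) \<in> UO R"
  shows "D2Lb (\<pi> x) (\<pi> y) (d\<pi> y v) = tmap Q real_mfd (\<lambda>y'. L (x, horizontal_part x y')) y v"
proof -
  have x: "x \<in> points Q" and y: "y \<in> points Q" using UO_points[OF xy] by auto
  obtain A where A: "has_tmap2 B B real_mfd (\<lambda>r s. L_breve R (r, s)) (\<pi> x) (\<pi> y) A" using L_breve_tmap2[OF xy] by blast
  have "has_tmap Q real_mfd (\<lambda>y'. L_breve R (\<pi> x, \<pi> y')) y (\<lambda>v. A (0, d\<pi> y v))"
    by (rule has_tmap_compose[OF mQ mB proj_tmap[OF y] has_tmap2_slice2[OF mB mB A]])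
  then have "has_tmap Q real_mfd (\<lambda>y'. L (x, horizontal_part x y')) y (\<lambda>v. A (0, d\<pi> y v))"
    using has_tmap_cong[OF mQ UO_slice2[OF x], of y "\<lambda>y'. L_breve R (\<pi> x, \<pi> y')" "\<lambda>y'. L (x, horizontal_part x y')" real_mfd] y xy
    by (simp add: L_breve_eq)
  from tmap_eq[OF mQ this] D2_eq[OF mB A] show ?thesis by simp
qed

lemma D2_L_check_eq:
  assumes xy: "(x, y) \<in> UO R" and e: "Ac x y = e"
  shows "D2_L_check R x e (\<pi> y) \<zeta> = D2L x y (infinitesimal y \<zeta>)"
proof -
  have x: "x \<in> points Q" and y: "y \<in> points Q" using UO_points[OF xy] by auto
  have eG: "e \<in> points GM" by (simp add: pointsG)
  have chk: "L_check R x w (\<pi> y) = L (x, a w y)" for w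
    by (simp add: L_check_def F1_def hd_bar_eq[OF xy] horizontal_part_fixed[OF xy e])
  have "has_tmap GM real_mfd (\<lambda>w. L (x, a w y)) e (\<lambda>\<zeta>. D1L x y 0 + D2L x y (infinitesimal y \<zeta>))"
    using L_product_rule[OF mG has_tmap_const[OF eG x] infinitesimal_tmap[OF y]] y by simp
  from tmap_eq[OF mG this] show ?thesis
    using linear_0[OF DL_linear(1)[OF x y]] by (simp add: D2_L_check_def chk)
qed

text \<open>Differentiating the constant \<open>y = \<A>\<^sub>d(x', y) S(x', y)\<close> at \<open>x' = x\<close> gives \<open>0 = (d\<A>\<^sub>d v)\<^sub>Q(y) + dS v\<close>.  The
  reduced Lagrangian contributes \<open>D\<^sub>1L\<^sub>d v + D\<^sub>2L\<^sub>d(dS v)\<close>, so the difference is \<open>D\<^sub>2L\<^sub>d((d\<A>\<^sub>d v)\<^sub>Q)\<close>, which is how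
  the force is defined.\<close>

lemma force_minus:
  assumes xy: "(x, y) \<in> UO R" and e: "Ac x y = e"
  shows "D2_L_check R x e (\<pi> y) (tmap Q GM (\<lambda>x'. Ac x' y) x v) = D1L x y v - D1Lb (\<pi> x) (\<pi> y) (d\<pi> x v)"
proof -
  have x: "x \<in> points Q" and y: "y \<in> points Q" using UO_points[OF xy] by auto
  have fix_y: "horizontal_part x y = y" by (rule horizontal_part_fixed[OF xy e])
  obtain A where A: "has_tmap2 Q Q GM Ac x y A" using Acon_tmap2[OF xy] by blast
  obtain S where S: "has_tmap2 Q Q Q horizontal_part x y S" using horizontal_part_tmap2[OF xy] by blast
  have dA: "has_tmap Q GM (\<lambda>x'. Ac x' y) x (\<lambda>v. A (v, 0))" by (rule has_tmap2_slice1[OF mQ mQ A])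
  have dS: "has_tmap Q Q (\<lambda>x'. horizontal_part x' y) x (\<lambda>v. S (v, 0))" by (rule has_tmap2_slice1[OF mQ mQ S])
  have "has_tmap Q Q (\<lambda>x'. a (Ac x' y) (horizontal_part x' y)) x (\<lambda>v. infinitesimal y (A (v, 0)) + S (v, 0))"
    using act_product_rule[OF mQ dA e dS] fix_y by simp
  then have "has_tmap Q Q (\<lambda>x'. y) x (\<lambda>v. infinitesimal y (A (v, 0)) + S (v, 0))"
    using has_tmap_cong[OF mQ UO_slice1[OF y], of x "\<lambda>x'. a (Ac x' y) (horizontal_part x' y)" "\<lambda>x'. y" Q] x xy
    by (simp add: horizontal_part_recover)
  from tmap_eq[OF mQ this] tmap_eq[OF mQ has_tmap_const[OF x y]]
  have 0: "(\<lambda>v. infinitesimal y (A (v, 0)) + S (v, 0)) = (\<lambda>v. 0)" by simp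
  have "has_tmap Q real_mfd (\<lambda>x'. L (x', horizontal_part x' y)) x (\<lambda>v. D1L x y v + D2L x y (S (v, 0)))"
    using L_product_rule[OF mQ has_tmap_id[OF mQ x] dS] fix_y by simp
  from fun_cong[OF tmap_eq[OF mQ this], of v]
  have 1: "D1Lb (\<pi> x) (\<pi> y) (d\<pi> x v) = D1L x y v + D2L x y (S (v, 0))" by (simp add: D1_L_breve[OF xy])
  have 2: "D2L x y (infinitesimal y (A (v, 0))) + D2L x y (S (v, 0)) = 0"
    using fun_cong[OF 0, of v] linear_add[OF DL_linear(2)[OF x y], of "infinitesimal y (A (v, 0))" "S (v, 0)"]
      linear_0[OF DL_linear(2)[OF x y]] by simp
  have 3: "tmap Q GM (\<lambda>x'. Ac x' y) x v = A (v, 0)" using tmap_eq[OF mQ dA] by simp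
  show ?thesis unfolding 3 D2_L_check_eq[OF xy e] using 1 2 by linarith
qed

text \<open>As for \<open>force_minus\<close>, now differentiating \<open>y' = \<A>\<^sub>d(x, y') S(x, y')\<close>, whose derivative is the identity.\<close>

lemma force_plus:
  assumes xy: "(x, y) \<in> UO R" and e: "Ac x y = e"
  shows "D2_L_check R x e (\<pi> y) (tmap Q GM (Ac x) y v) = D2L x y v - D2Lb (\<pi> x) (\<pi> y) (d\<pi> y v)"
proof -
  have x: "x \<in> points Q" and y: "y \<in> points Q" using UO_points[OF xy] by auto
  have fix_y: "horizontal_part x y = y" by (rule horizontal_part_fixed[OF xy e])
  obtain A where A: "has_tmap2 Q Q GM Ac x y A" using Acon_tmap2[OF xy] by blast
  obtain S where S: "has_tmap2 Q Q Q horizontal_part x y S" using horizontal_part_tmap2[OF xy] by blast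
  have dA: "has_tmap Q GM (Ac x) y (\<lambda>v. A (0, v))" by (rule has_tmap2_slice2[OF mQ mQ A])
  have dS: "has_tmap Q Q (\<lambda>y'. horizontal_part x y') y (\<lambda>v. S (0, v))" by (rule has_tmap2_slice2[OF mQ mQ S])
  have "has_tmap Q Q (\<lambda>y'. a (Ac x y') (horizontal_part x y')) y (\<lambda>v. infinitesimal y (A (0, v)) + S (0, v))"
    using act_product_rule[OF mQ dA e dS] fix_y by simp
  then have "has_tmap Q Q (\<lambda>y'. y') y (\<lambda>v. infinitesimal y (A (0, v)) + S (0, v))"
    using has_tmap_cong[OF mQ UO_slice2[OF x], of y "\<lambda>y'. a (Ac x y') (horizontal_part x y')" "\<lambda>y'. y'" Q] y xy
    by (simp add: horizontal_part_recover)
  from tmap_eq[OF mQ this] tmap_eq[OF mQ has_tmap_id[OF mQ y]]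
  have 0: "(\<lambda>v. infinitesimal y (A (0, v)) + S (0, v)) = (\<lambda>v. v)" by simp
  have "has_tmap Q real_mfd (\<lambda>y'. L (x, horizontal_part x y')) y (\<lambda>v. D1L x y 0 + D2L x y (S (0, v)))"
    using L_product_rule[OF mQ has_tmap_const[OF y x] dS] fix_y by simp
  from fun_cong[OF tmap_eq[OF mQ this], of v]
  have 1: "D2Lb (\<pi> x) (\<pi> y) (d\<pi> y v) = D2L x y (S (0, v))"
    using linear_0[OF DL_linear(1)[OF x y]] by (simp add: D2_L_breve[OF xy])
  have 2: "D2L x y (infinitesimal y (A (0, v))) + D2L x y (S (0, v)) = D2L x y v"
    using fun_cong[OF 0, of v] linear_add[OF DL_linear(2)[OF x y], of "infinitesimal y (A (0, v))" "S (0, v)"] by simp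
  have 3: "tmap Q GM (Ac x) y v = A (0, v)" using tmap_eq[OF mQ dA] by simp
  show ?thesis unfolding 3 D2_L_check_eq[OF xy e] using 1 2 by linarith
qed

lemma Acon_diag_one: "(x, y) \<in> UO R \<Longrightarrow> Ac x y = e \<Longrightarrow> g \<in> carrier G \<Longrightarrow> Ac (a g x) (a g y) = e"
proof -
  interpret group G by (rule groups)
  show "(x, y) \<in> UO R \<Longrightarrow> Ac x y = e \<Longrightarrow> g \<in> carrier G \<Longrightarrow> Ac (a g x) (a g y) = e"
    by (simp add: Acon_diag)
qed

lemma F1_at_representative:
  assumes xy: "(x, y) \<in> UO R" and e: "Ac x y = e" and g: "g \<in> carrier G"
  shows "F1 R (a g x) e (\<pi> y) = a g y"
  using UO_points[OF xy] g
  by (simp add: F1_def horizontal_part_left[OF xy g] horizontal_part_fixed[OF xy e])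

text \<open>The right-hand side of \<open>force_minus\<close> takes the same value at all representatives \<open>(g x, g y)\<close>, because
\<open>L\<^sub>d\<close> is invariant and horizontal lifts are equivariant.  So the reduced force is well defined, and the
equivariance of \<open>\<A>\<^sub>d\<close> never has to be differentiated.\<close>

lemma F_breve_minus_eq:
  assumes xy: "(x, y) \<in> UO R" and e: "Ac x y = e"
  shows "F_breve_minus R (\<pi> x) (\<pi> y) \<delta> = D1L x y (hlift R x \<delta>) - D1Lb (\<pi> x) (\<pi> y) \<delta>"
proof -
  have x: "x \<in> points Q" and y: "y \<in> points Q" using UO_points[OF xy] by auto
  have "the_elem ((\<lambda>(q0, w0). let q1 = F1 R q0 w0 (\<pi> y) in D2_L_check R q0 w0 (\<pi> y)
        (tmap Q GM (\<lambda>x. Ac x q1) q0 (hlift R q0 \<delta>))) ` rho R x e) = D1L x y (hlift R x \<delta>) - D1Lb (\<pi> x) (\<pi> y) \<delta>"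
  proof (rule the_elem_rho[OF x])
    fix g assume g: "g \<in> carrier G"
    have "D2_L_check R (a g x) e (\<pi> (a g y)) (tmap Q GM (\<lambda>x'. Ac x' (a g y)) (a g x) (hlift R (a g x) \<delta>))
        = D1L (a g x) (a g y) (hlift R (a g x) \<delta>) - D1Lb (\<pi> (a g x)) (\<pi> (a g y)) (d\<pi> (a g x) (hlift R (a g x) \<delta>))"
      by (rule force_minus[OF UO_act[OF xy g g] Acon_diag_one[OF xy e g]])
    also have "\<dots> = D1L x y (hlift R x \<delta>) - D1Lb (\<pi> x) (\<pi> y) \<delta>"
      using hlift_props[OF act_closed[OF g x], of \<delta>] g x y by (simp add: hlift_act[OF g x] DL_equivariant[OF g x y])
    finally show "(case (a g x, e) of (q0, w0) \<Rightarrow> let q1 = F1 R q0 w0 (\<pi> y) in D2_L_check R q0 w0 (\<pi> y)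
        (tmap Q GM (\<lambda>x. Ac x q1) q0 (hlift R q0 \<delta>))) = D1L x y (hlift R x \<delta>) - D1Lb (\<pi> x) (\<pi> y) \<delta>"
      using g y by (simp add: F1_at_representative[OF xy e g] Let_def)
  qed
  then show ?thesis by (simp add: F_breve_minus_def F_hat_minus_def Ymap_eq[OF x])
qed

lemma F_breve_plus_eq:
  assumes xy: "(x, y) \<in> UO R" and e: "Ac x y = e"
  shows "F_breve_plus R (\<pi> x) (\<pi> y) \<delta> = D2L x y (hlift R y \<delta>) - D2Lb (\<pi> x) (\<pi> y) \<delta>"
proof -
  have x: "x \<in> points Q" and y: "y \<in> points Q" using UO_points[OF xy] by auto
  have "the_elem ((\<lambda>(q0, w0). let q1 = F1 R q0 w0 (\<pi> y) in D2_L_check R q0 w0 (\<pi> y)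
        (tmap Q GM (\<lambda>x. Ac q0 x) q1 (hlift R q1 \<delta>))) ` rho R x e) = D2L x y (hlift R y \<delta>) - D2Lb (\<pi> x) (\<pi> y) \<delta>"
  proof (rule the_elem_rho[OF x])
    fix g assume g: "g \<in> carrier G"
    have "D2_L_check R (a g x) e (\<pi> (a g y)) (tmap Q GM (Ac (a g x)) (a g y) (hlift R (a g y) \<delta>))
        = D2L (a g x) (a g y) (hlift R (a g y) \<delta>) - D2Lb (\<pi> (a g x)) (\<pi> (a g y)) (d\<pi> (a g y) (hlift R (a g y) \<delta>))"
      by (rule force_plus[OF UO_act[OF xy g g] Acon_diag_one[OF xy e g]])
    also have "\<dots> = D2L x y (hlift R y \<delta>) - D2Lb (\<pi> x) (\<pi> y) \<delta>"
      using hlift_props[OF act_closed[OF g y], of \<delta>] g x y by (simp add: hlift_act[OF g y] DL_equivariant[OF g x y])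
    finally show "(case (a g x, e) of (q0, w0) \<Rightarrow> let q1 = F1 R q0 w0 (\<pi> y) in D2_L_check R q0 w0 (\<pi> y)
        (tmap Q GM (\<lambda>x. Ac q0 x) q1 (hlift R q1 \<delta>))) = D2L x y (hlift R y \<delta>) - D2Lb (\<pi> x) (\<pi> y) \<delta>"
      using g y by (simp add: F1_at_representative[OF xy e g] Let_def)
  qed
  then show ?thesis by (simp add: F_breve_plus_def F_hat_plus_def Ymap_eq[OF x])
qed

section \<open>Reduced constraints\<close>

lemma Dv_breve_eq:
  assumes q: "q \<in> points Q"
  shows "Dv_breve R (\<pi> q) = d\<pi> q ` Dv R q"
proof
  show "d\<pi> q ` Dv R q \<subseteq> Dv_breve R (\<pi> q)" unfolding Dv_breve_def using proj_refl[OF q] by blast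
  show "Dv_breve R (\<pi> q) \<subseteq> d\<pi> q ` Dv R q"
  proof
    fix u assume "u \<in> Dv_breve R (\<pi> q)"
    then obtain x v where xv: "x \<in> \<pi> q" "v \<in> Dv R x" "u = d\<pi> x v" unfolding Dv_breve_def by blast
    obtain g where g: "g \<in> carrier G" "x = a g q" using xv(1) unfolding proj_iff by blast
    have x: "x \<in> points Q" using g q by simp
    have ig: "inv\<^bsub>G\<^esub> g \<in> carrier G" using g by simp
    have to_q: "a (inv\<^bsub>G\<^esub> g) x = q" using g q by simp
    have "da (inv\<^bsub>G\<^esub> g) x v \<in> Dv R q" using bundle_act(3)[OF ig x xv(2)] to_q by simp
    moreover have "d\<pi> q (da (inv\<^bsub>G\<^esub> g) x v) = u" using dproj_act[OF ig x, of v] to_q xv(3) by simp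
    ultimately show "u \<in> d\<pi> q ` Dv R q" by (metis imageI)
  qed
qed

lemma Phi_eq:
  assumes xy: "(x, y) \<in> UO R"
  shows "Phi R (orbit G (diag_action a) (x, y)) = (rho R x (Ac x y), \<pi> y)"
  unfolding Phi_def
proof (rule the_elem_image_const)
  have pts: "x \<in> points Q" "y \<in> points Q" using UO_points[OF xy] by auto
  show "diag_action a e (x, y) \<in> orbit G (diag_action a) (x, y)" unfolding orbit_def using G_closed(1) by blast
  fix z assume "z \<in> orbit G (diag_action a) (x, y)"
  then obtain g where g: "g \<in> carrier G" "z = (a g x, a g y)" unfolding orbit_def diag_action_def by auto
  show "(case z of (q0, q1) \<Rightarrow> (rho R q0 (Ac q0 q1), \<pi> q1)) = (rho R x (Ac x y), \<pi> y)"
    using g pts rho_equivariant[OF g(1) pts(1) Acon_closed[OF xy]] by (simp add: Acon_diag[OF xy g(1)])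
qed

text \<open>If \<open>(u, v) \<in> \<D>\<^sub>d\<close> has the same reduced image as \<open>(x, y)\<close>, translate it so that \<open>u = x\<close>.  Then \<open>v\<close> and \<open>y\<close> lie in
one orbit and are both horizontal over \<open>x\<close>, hence equal.\<close>

lemma Dd_breve_iff:
  assumes xy: "(x, y) \<in> UO R" and e: "Ac x y = e"
  shows "(\<pi> x, \<pi> y) \<in> Dd_breve R \<longleftrightarrow> (x, y) \<in> Dd R"
proof -
  have pts: "x \<in> points Q" "y \<in> points Q" and O: "(\<pi> x, \<pi> y) \<in> nbO R" using xy by (auto simp: UO_def)
  have inv: "(a g u, a g v) \<in> Dd R" if "g \<in> carrier G" "(u, v) \<in> Dd R" for g u v
  proof -
    have "diag_action a g ` Dd R \<subseteq> Dd R"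
      using symM carrier_sub[OF that(1)] by (simp add: symmetry_group_def invariant_set_def)
    then show ?thesis using that(2) by (auto simp: diag_action_def)
  qed
  have "(\<pi> x, \<pi> y) \<in> Dd_breve R \<longleftrightarrow> (rho R x e, \<pi> y) \<in> Dd_hat R"
    using O by (simp add: Dd_breve_def Ymap_eq[OF pts(1)])
  also have "\<dots> \<longleftrightarrow> (x, y) \<in> Dd R"
  proof
    assume "(x, y) \<in> Dd R"
    then have "orbit G (diag_action a) (x, y) \<in> orbits G (Dd R \<inter> UO R) (diag_action a)"
      unfolding orbits_def using xy by blast
    then have "Phi R (orbit G (diag_action a) (x, y)) \<in> Dd_hat R" unfolding Dd_hat_def by (rule imageI)
    then show "(rho R x e, \<pi> y) \<in> Dd_hat R" by (simp add: Phi_eq[OF xy] e)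
  next
    assume "(rho R x e, \<pi> y) \<in> Dd_hat R"
    then obtain p where p: "p \<in> Dd R \<inter> UO R" "Phi R (orbit G (diag_action a) p) = (rho R x e, \<pi> y)"
      unfolding Dd_hat_def orbits_def by auto
    obtain u v where uv: "p = (u, v)" by (cases p)
    then have D: "(u, v) \<in> Dd R" and U: "(u, v) \<in> UO R" using p(1) by auto
    have upts: "u \<in> points Q" "v \<in> points Q" using UO_points[OF U] by auto
    have eq: "rho R u (Ac u v) = rho R x e" "\<pi> v = \<pi> y"
      using p(2) Phi_eq[OF U] uv by auto
    interpret group G by (rule groups)
    have "(a e u, e \<otimes>\<^bsub>G\<^esub> Ac u v \<otimes>\<^bsub>G\<^esub> inv\<^bsub>G\<^esub> e) \<in> rho R u (Ac u v)"
      unfolding rho_def orbit_def by (intro CollectI exI[of _ e]) simp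
    then have "(u, Ac u v) \<in> rho R u (Ac u v)" using upts Acon_closed[OF U] by simp
    then obtain g where g: "g \<in> carrier G" "u = a g x" "Ac u v = e"
      unfolding eq(1) rho_one[OF pts(1)] by blast
    have ig: "inv\<^bsub>G\<^esub> g \<in> carrier G" using g by simp
    have ux: "a (inv\<^bsub>G\<^esub> g) u = x" using g pts by simp
    have "Ac x (a (inv\<^bsub>G\<^esub> g) v) = e" using Acon_diag_one[OF U g(3) ig] ux by simp
    then have "a (inv\<^bsub>G\<^esub> g) v = horizontal_part x y"
      by (intro horizontal_part_unique[OF xy]) (use ig upts eq(2) in simp_all)
    then have "a (inv\<^bsub>G\<^esub> g) v = y" using horizontal_part_fixed[OF xy e] by simp
    then show "(x, y) \<in> Dd R" using inv[OF ig D] ux by simp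
  qed
  finally show ?thesis .
qed

section \<open>Equivalence of the reduced and unreduced equations\<close>

text \<open>Vertical vectors are generators \<open>\<xi>\<^sub>Q\<close>, and on these the two terms are \<open>-\<mu>(\<xi>)\<close> and, by invariance of \<open>L\<^sub>d\<close>,
\<open>\<mu>(\<xi>)\<close>.\<close>

lemma vertical_equation:
  assumes q: "x \<in> points Q" "y \<in> points Q" "z \<in> points Q"
    and J: "Jd R x y = mom R" "Jd R y z = mom R" and v: "v \<in> vertical G Q a y"
  shows "D1L y z v + D2L x y v = 0"
proof -
  obtain \<xi> where \<xi>: "v = infinitesimal y \<xi>"
    using kernel_infinitesimal[OF q(2) vertical_kernel[OF q(2) v]] by blast
  have "D1L y z (infinitesimal y \<xi>) = - mom R \<xi>" using fun_cong[OF J(2), of \<xi>] by (simp add: Jd_eq q)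
  moreover have "D1L x y (infinitesimal x \<xi>) = - mom R \<xi>" using fun_cong[OF J(1), of \<xi>] by (simp add: Jd_eq q)
  ultimately show ?thesis using DL_infinitesimal[OF q(1,2), of \<xi>] \<xi> by simp
qed

text \<open>The reduced covector at \<open>\<delta>r\<close> is the unreduced one at the horizontal lift of \<open>\<delta>r\<close>, and the vertical
component of a vector of \<open>\<D>\<close> contributes to neither.\<close>

lemma equation_iff:
  assumes xy: "(x, y) \<in> nbU R \<inter> UO R" "Jd R x y = mom R"
    and yz: "(y, z) \<in> nbU R \<inter> UO R" "Jd R y z = mom R"
  shows "annihilates (\<lambda>v. D1L y z v + D2L x y v) (Dv R y) \<longleftrightarrow>
         annihilates (\<lambda>v. D1Lb (\<pi> y) (\<pi> z) v + D2Lb (\<pi> x) (\<pi> y) v +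
            F_breve_plus R (\<pi> x) (\<pi> y) v + F_breve_minus R (\<pi> y) (\<pi> z) v) (Dv_breve R (\<pi> y))"
proof -
  have U: "(x, y) \<in> UO R" "(y, z) \<in> UO R" using xy yz by auto
  have pts: "x \<in> points Q" "y \<in> points Q" "z \<in> points Q" using UO_points U by blast+
  have e: "Ac x y = e" "Ac y z = e" using Acon_eq_one xy yz by blast+
  let ?E = "\<lambda>v. D1L y z v + D2L x y v"
  let ?F = "\<lambda>v. D1Lb (\<pi> y) (\<pi> z) v + D2Lb (\<pi> x) (\<pi> y) v +
            F_breve_plus R (\<pi> x) (\<pi> y) v + F_breve_minus R (\<pi> y) (\<pi> z) v"
  have F: "?F \<delta> = ?E (hlift R y \<delta>)" for \<delta>
    by (simp add: F_breve_plus_eq[OF U(1) e(1)] F_breve_minus_eq[OF U(2) e(2)])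
  note ds = direct_sumD[OF splitting_at(1)[OF pts(2)]]
  have E: "?E v = ?F (d\<pi> y v)" if v: "v \<in> Dv R y" for v
  proof -
    have "v \<in> {s + h | s h. s \<in> vertical G Q a y \<and> h \<in> Hb R y}" unfolding ds(4) by (rule v)
    then obtain s h where sh: "s \<in> vertical G Q a y" "h \<in> Hb R y" "v = s + h" by blast
    have "d\<pi> y v = d\<pi> y h"
      using vertical_kernel[OF pts(2) sh(1)] by (simp add: sh(3) linear_add[OF dproj_linear[OF pts(2)]])
    then have "?F (d\<pi> y v) = ?E h" using F[of "d\<pi> y h"] hlift_horizontal[OF pts(2) sh(2)] by simp
    moreover have "?E v = ?E s + ?E h"
      by (simp add: sh(3) linear_add[OF DL_linear(1)[OF pts(2,3)]] linear_add[OF DL_linear(2)[OF pts(1,2)]])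
    moreover have "?E s = 0" by (rule vertical_equation[OF pts xy(2) yz(2) sh(1)])
    ultimately show ?thesis by simp
  qed
  have "annihilates ?F (Dv_breve R (\<pi> y)) \<longleftrightarrow> (\<forall>v\<in>Dv R y. ?F (d\<pi> y v) = 0)"
    unfolding Dv_breve_eq[OF pts(2)] annihilates_def by (rule ball_simps(9))
  also have "\<dots> \<longleftrightarrow> annihilates ?E (Dv R y)"
    unfolding annihilates_def by (rule ball_cong[OF refl]) (simp only: E)
  finally show ?thesis by (rule sym)
qed

lemma F_breve_zero:
  assumes "(x, y) \<in> nbU R \<inter> UO R" "Jd R x y = mom R"
  shows "F_breve_plus R (\<pi> x) (\<pi> y) 0 = 0" "F_breve_minus R (\<pi> x) (\<pi> y) 0 = 0"
proof -
  have U: "(x, y) \<in> UO R" and e: "Ac x y = e" using assms Acon_eq_one by auto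
  have pts: "x \<in> points Q" "y \<in> points Q" using UO_points[OF U] by auto
  obtain A where A: "has_tmap2 B B real_mfd (\<lambda>r s. L_breve R (r, s)) (\<pi> x) (\<pi> y) A" using L_breve_tmap2[OF U] by blast
  have "D1Lb (\<pi> x) (\<pi> y) 0 = 0" "D2Lb (\<pi> x) (\<pi> y) 0 = 0"
    using linear_0[OF has_tmap2_linear[OF A]] D1_eq[OF mB A] D2_eq[OF mB A] by (simp_all add: zero_prod_def)
  then show "F_breve_plus R (\<pi> x) (\<pi> y) 0 = 0" "F_breve_minus R (\<pi> x) (\<pi> y) 0 = 0"
    using linear_0[OF DL_linear(1)[OF pts]] linear_0[OF DL_linear(2)[OF pts]]
    by (simp_all add: F_breve_plus_eq[OF U e] F_breve_minus_eq[OF U e] hlift_zero pts)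
qed

end

theorem theorem11p13:
  fixes R :: "('q, 'e::banach, 'g, 'k::banach, 'b::banach) reduction"
    and M :: "('g, 'm::banach) lie_grp"
    and N :: nat and q :: "nat \<Rightarrow> 'q"
  assumes system: "nonholonomic_system R"
    and exponential: "exponential_map (grp R) (expo R)"
    and mu_dual: "linear (mom R)"
    and good: "mu_good M R"
    and Ad_invariant: "\<forall>g\<in>carrier (grp R). mom R \<circ> Ad (grp R) g = mom R"
    and quotient: "quotient_manifold (grp R) (cfg R) (act R) (qmf R)"
    and splitting: "adapted_splitting R"
    and connection: "connection_domains R"
    and curve: "discrete_curve (cfg R) N q"
    and momentum: "\<forall>k<N. Jd R (q k) (q (Suc k)) = mom R"
    and domain: "\<forall>k<N. (q k, q (Suc k)) \<in> nbU R \<inter> UO R"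
  shows "let r = (\<lambda>k. proj R (q k));
             S1 = ((\<forall>k<N. (q k, q (Suc k)) \<in> Dd R) \<and>
                   (\<forall>\<delta>q \<in> variations_in (Dv R) N q.
                      curve_diff (cfg R) (discrete_action N (Ld R)) q \<delta>q = 0));
             S2 = ((\<forall>k<N. (q k, q (Suc k)) \<in> Dd R) \<and>
                   (\<forall>k. 1 \<le> k \<and> k \<le> N - 1 \<longrightarrow>
                      annihilates (\<lambda>v. D1 (cfg R) (Ld R) (q k) (q (k + 1)) v +
                                       D2 (cfg R) (Ld R) (q (k - 1)) (q k) v)
                                  (Dv R (q k))));
             S3 = ((\<forall>\<delta>r \<in> variations_in (Dv_breve R) N r.
                      curve_diff (qmf R) (discrete_action N (L_breve R)) r \<delta>r =
                      - (\<Sum>k = 1..N - 1. F_breve_minus R (r k) (r (k + 1)) (\<delta>r k) +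
                                          F_breve_plus R (r (k - 1)) (r k) (\<delta>r k))) \<and>
                   (\<forall>k<N. (r k, r (Suc k)) \<in> Dd_breve R));
             S4 = ((\<forall>k. 1 \<le> k \<and> k \<le> N - 1 \<longrightarrow>
                      annihilates (\<lambda>v. D1 (qmf R) (L_breve R) (r k) (r (k + 1)) v +
                                       D2 (qmf R) (L_breve R) (r (k - 1)) (r k) v +
                                       F_breve_plus R (r (k - 1)) (r k) v +
                                       F_breve_minus R (r k) (r (k + 1)) v)
                                  (Dv_breve R (r k))) \<and>
                   (\<forall>k<N. (r k, r (Suc k)) \<in> Dd_breve R))
         in (S1 \<longleftrightarrow> S2) \<and> (S2 \<longleftrightarrow> S3) \<and> (S3 \<longleftrightarrow> S4)"
proof -
  interpret reduced_system R M
    by (unfold_locales) (fact system exponential good Ad_invariant quotient splitting connection)+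
  define r where "r k = \<pi> (q k)" for k
  have pts: "q k \<in> points Q" if "k \<le> N" for k
    using curve that by (simp add: discrete_curve_def)
  have dom: "(q k, q (Suc k)) \<in> nbU R \<inter> UO R" and mo: "Jd R (q k) (q (Suc k)) = mom R" if "k < N" for k
    using domain momentum that by auto
  have U: "(q k, q (Suc k)) \<in> UO R" and one: "Ac (q k) (q (Suc k)) = e" if "k < N" for k
    using dom[OF that] mo[OF that] Acon_eq_one by auto
  have rpts: "r k \<in> points B" if "k \<le> N" for k
    using smooth_map_on_point(2)[OF proj_smooth pts[OF that]] by (simp add: r_def)
  have Dd: "(\<forall>k<N. (r k, r (Suc k)) \<in> Dd_breve R) \<longleftrightarrow> (\<forall>k<N. (q k, q (Suc k)) \<in> Dd R)"
    using Dd_breve_iff[OF U one] by (simp add: r_def)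
  define P1 where "P1 \<longleftrightarrow> (\<forall>\<delta>q \<in> variations_in (Dv R) N q. curve_diff Q (discrete_action N L) q \<delta>q = 0)"
  define P2 where "P2 \<longleftrightarrow> (\<forall>k. 1 \<le> k \<and> k \<le> N - 1 \<longrightarrow>
      annihilates (\<lambda>v. D1L (q k) (q (k + 1)) v + D2L (q (k - 1)) (q k) v) (Dv R (q k)))"
  define P3 where "P3 \<longleftrightarrow> (\<forall>\<delta>r \<in> variations_in (Dv_breve R) N r. curve_diff B (discrete_action N (L_breve R)) r \<delta>r =
      - (\<Sum>k = 1..N - 1. F_breve_minus R (r k) (r (k + 1)) (\<delta>r k) + F_breve_plus R (r (k - 1)) (r k) (\<delta>r k)))"
  define P4 where "P4 \<longleftrightarrow> (\<forall>k. 1 \<le> k \<and> k \<le> N - 1 \<longrightarrow>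
      annihilates (\<lambda>v. D1Lb (r k) (r (k + 1)) v + D2Lb (r (k - 1)) (r k) v +
         F_breve_plus R (r (k - 1)) (r k) v + F_breve_minus R (r k) (r (k + 1)) v) (Dv_breve R (r k)))"
  have 12: "P1 \<longleftrightarrow> P2"
  proof -
    have "0 \<in> Dv R (q k)" if "k \<le> N" for k
      by (rule subspace_0[OF subspaces_at(3)[OF pts[OF that]]])
    from variational_iff_pointwise[where f=L and \<Phi>="\<lambda>_ _. 0" and q=q and N=N and D="Dv R", OF mQ pts _ this]
    show ?thesis using L_tmap2[OF pts pts] by (simp add: P1_def P2_def)
  qed
  have 34: "P3 \<longleftrightarrow> P4"
  proof -
    have tm: "\<exists>A. has_tmap2 B B real_mfd (\<lambda>x y. L_breve R (x, y)) (r k) (r (Suc k)) A" if "k < N" for k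
      using L_breve_tmap2[OF U[OF that]] by (simp add: r_def)
    have zero: "0 \<in> Dv_breve R (r k)" if "k \<le> N" for k
      unfolding r_def Dv_breve_eq[OF pts[OF that]]
      by (rule image_eqI[of _ _ 0]) (simp_all add: linear_0[OF dproj_linear[OF pts[OF that]]] subspace_0[OF subspaces_at(3)[OF pts[OF that]]])
    have F0: "F_breve_minus R (r k) (r (k + 1)) 0 + F_breve_plus R (r (k - 1)) (r k) 0 = 0"
      if "1 \<le> k" "k \<le> N - 1" for k
      using F_breve_zero(2)[OF dom mo, of k] F_breve_zero(1)[OF dom mo, of "k - 1"] that by (simp add: r_def)
    have "P3 \<longleftrightarrow> (\<forall>k. 1 \<le> k \<and> k \<le> N - 1 \<longrightarrow> annihilates (\<lambda>v. D1Lb (r k) (r (k + 1)) v + D2Lb (r (k - 1)) (r k) v +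
         (F_breve_minus R (r k) (r (k + 1)) v + F_breve_plus R (r (k - 1)) (r k) v)) (Dv_breve R (r k)))"
      unfolding P3_def
      by (rule variational_iff_pointwise[where f="L_breve R" and q=r and N=N and D="Dv_breve R"
          and \<Phi>="\<lambda>k v. F_breve_minus R (r k) (r (k + 1)) v + F_breve_plus R (r (k - 1)) (r k) v", OF mB rpts tm zero F0])
    then show ?thesis by (simp add: P4_def add.assoc add.commute add.left_commute)
  qed
  have 24: "P2 \<longleftrightarrow> P4"
  proof -
    have "annihilates (\<lambda>v. D1L (q k) (q (k + 1)) v + D2L (q (k - 1)) (q k) v) (Dv R (q k)) \<longleftrightarrow>
      annihilates (\<lambda>v. D1Lb (r k) (r (k + 1)) v + D2Lb (r (k - 1)) (r k) v +
         F_breve_plus R (r (k - 1)) (r k) v + F_breve_minus R (r k) (r (k + 1)) v) (Dv_breve R (r k))"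
      if k: "1 \<le> k \<and> k \<le> N - 1" for k
    proof -
      have kN: "k < N" "k - 1 < N" "Suc (k - 1) = k" using k by auto
      show ?thesis
        using equation_iff[OF dom[OF kN(2)] mo[OF kN(2)], unfolded kN(3), OF dom[OF kN(1)] mo[OF kN(1)]]
        by (simp add: r_def)
    qed
    then show ?thesis unfolding P2_def P4_def by blast
  qed
  show ?thesis
    unfolding Let_def r_def[symmetric] P1_def[symmetric] P2_def[symmetric] P3_def[symmetric] P4_def[symmetric] Dd
    using 12 34 24 by blast
qed

end
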